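(* Let $S$ be a countable right LCM semigroup and let $N$ be a scale on $S$ such that for any $s\in S$ and $t\in\ker N$ we have $sS\cap tS=rS$ for some $r\in s(\ker N)$. Let $\beta\ge0$. Then a Borel probability measure $\mu$ on $\widehat{E(S)}$ satisfying $$\mu(\lambda_s\cdot A)=N(s)^{-\beta}\mu(A)\quad\text{for all Borel } A\subset\widehat{E(S)}\text{ and all } s\in S$$ is unique if it exists, and we have $$\mu(Z_{s,F})=N(s)^{-\beta}+\sum_{\emptyset\neq K\subset [F]} (-1)^{|K|} N(q_K)^{-\beta}\qquad( * )$$ for all $s \in S$ and all finite subsets $F\subset sS$, where $[F]$ denotes the image of $F$ in $S/{\sim_N}$ and we use the convention $N(\infty)^{-\beta}=0$. Furthermore, such a measure exists (or, equivalently, a $\sigma^N$-KMS$_\beta$-state on $C^*(S)$ exists) if and only if the expression on the right in $( * )$ is nonnegative for $s=e$ and all finite subsets $[F]$ of $\{[t]\in S/{\sim_N}: [e]<[t]\}$.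
   Context: A right LCM semigroup is a left cancellative semigroup $S$ with identity element $e$ such that for all $s,t\in S$ either $sS\cap tS=\emptyset$ or $sS\cap tS=rS$ for some $r\in S$. A scale on $S$ is a semigroup homomorphism $N\colon S\to([1,+\infty),\cdot)$; $\ker N:=N^{-1}(1)$. $C^*(S)$ is the (universal) C$^*$-algebra generated by isometries $v_s$, $s\in S$, with relations $v_e=1$, $v_sv_t=v_{st}$, and $v_sv_s^*v_tv_t^*=v_rv_r^*$ if $sS\cap tS=rS$, $v_sv_s^*v_tv_t^*=0$ if $sS\cap tS=\emptyset$. The dynamics $\sigma^N$ is given by $\sigma^N_t(v_s)=N(s)^{it}v_s$. A $\sigma^N$-KMS$_\beta$-state is a state $\varphi$ on $C^*(S)$ such that $\varphi(ab)=\varphi(b\,\sigma^N_{i\beta}(a))$ for all $a,b$ in a dense subspace of $\sigma^N$-analytic elements. For $s\in S$ let $\lambda_s\colon S\to sS$, $t\mapsto st$, viewed as a partial bijection of $S$, and let $e_s:=\lambda_s\lambda_s^{-1}$. $E(S):=\{e_s\mid s\in S\}\cup\{0\}$ (a semilattice under composition, $0$ being the empty map). $\widehat{E(S)}$ is the compact space (topology of pointwise convergence) of nonzero semigroup homomorphisms $\chi\colon E(S)\to\{0,1\}$ with $\chi(0)=0$. For $\chi\in\widehat{E(S)}$ and $s\in S$, $(\lambda_s\cdot\chi)(e_r)=\chi(\lambda_s^{-1}e_r\lambda_s)$, and $\lambda_s\cdot A=\{\lambda_s\cdot\chi\mid\chi\in A\}$. For $s\in S$ and a finite $F\subset S$,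 $Z_s=\{\chi\mid\chi(e_s)=1\}$ and $Z_{s,F}=Z_s\setminus\bigcup_{t\in F}Z_t$. The assumption on $N$ implies that $t_1(\ker N)\cap t_2(\ker N)\neq\emptyset$ for all $t_1,t_2\in\ker N$, so that $s\sim_N t$ iff $sa=tb$ for some $a,b\in\ker N$ defines an equivalence relation on $S$; $[s]$ is the class of $s$. The relation $[s]\le[t]$ iff $sS\cap tS=t'S$ for some $t'\sim_N t$ (equivalently, $sS\supset t'S$ for some $t'\sim_N t$) is a well-defined partial order on $S/{\sim_N}$, in which any two elements $[s],[t]$ either have a least upper bound $[s]\vee[t]$ or have no common upper bound, in which case $[s]\vee[t]=\infty$. For a finite $K\subset S/{\sim_N}$ put $[q_K]:=\bigvee_{[s]\in K}[s]\in(S/{\sim_N})\cup\{\infty\}$; $q_K$ denotes any representative of this class if it is finite, and $q_K=\infty$ otherwise. ($N$ is constant on $\sim_N$-classes.)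
   Formalization: In the definition of a KMS_β-state, the dense subspace of analytic elements is additionally required to be invariant under the dynamics σ^N (the standard definition); without invariance the stated equivalence with existence of the measure can fail. *)

theory Defs
  imports "HOL-Probability.Probability" "HOL-Library.Poly_Mapping"
begin

class right_lcm_semigroup = monoid_mult +
  assumes mult_left_cancel_lcm: "s * t = s * t' \<Longrightarrow> t = t'"
    and right_lcm: "range ((*) s) \<inter> range ((*) t) = {} \<or>
                    (\<exists>r. range ((*) s) \<inter> range ((*) t) = range ((*) r))"

definition rideal :: "'a::right_lcm_semigroup \<Rightarrow> 'a set" where
  "rideal s = range ((*) s)"

definition scale :: "('a::right_lcm_semigroup \<Rightarrow> real) \<Rightarrow> bool" where
  "scale N \<longleftrightarrow> (\<forall>s. 1 \<le> N s) \<and> (\<forall>s t. N (s * t) = N s * N t)"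

definition ker_scale :: "('a::right_lcm_semigroup \<Rightarrow> real) \<Rightarrow> 'a set" where
  "ker_scale N = {s. N s = 1}"

subsection \<open>Unital C*-algebras\<close>

text \<open>The zero algebra is allowed, so the class does not extend
  \<^class>\<open>real_normed_algebra_1\<close>.\<close>

class unital_cstar_algebra = banach + real_normed_algebra + monoid_mult +
  fixes scaleC :: "complex \<Rightarrow> 'a \<Rightarrow> 'a" (infixr \<open>*\<^sub>C\<close> 75)
    and star :: "'a \<Rightarrow> 'a"
  assumes scaleC_add_right: "c *\<^sub>C (x + y) = c *\<^sub>C x + c *\<^sub>C y"
    and scaleC_add_left: "(c + d) *\<^sub>C x = c *\<^sub>C x + d *\<^sub>C x"
    and scaleC_scaleC: "c *\<^sub>C d *\<^sub>C x = (c * d) *\<^sub>C x"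
    and scaleR_scaleC: "r *\<^sub>R x = complex_of_real r *\<^sub>C x"
    and mult_scaleC_left: "c *\<^sub>C x * y = c *\<^sub>C (x * y)"
    and mult_scaleC_right: "x * c *\<^sub>C y = c *\<^sub>C (x * y)"
    and norm_scaleC: "norm (c *\<^sub>C x) = cmod c * norm x"
    and star_add: "star (x + y) = star x + star y"
    and star_scaleC: "star (c *\<^sub>C x) = cnj c *\<^sub>C star x"
    and star_mult: "star (x * y) = star y * star x"
    and star_star: "star (star x) = x"
    and cstar_identity: "norm (star x * x) = (norm x)\<^sup>2"

definition star_hom :: "('b::unital_cstar_algebra \<Rightarrow> 'c::unital_cstar_algebra) \<Rightarrow> bool" where
  "star_hom f \<longleftrightarrow>
     (\<forall>x y. f (x + y) = f x + f y) \<and> (\<forall>c x. f (c *\<^sub>C x) = c *\<^sub>C f x) \<and>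
     (\<forall>x y. f (x * y) = f x * f y) \<and> f 1 = 1 \<and> (\<forall>x. f (star x) = star (f x))"

definition cstar_state :: "('b::unital_cstar_algebra \<Rightarrow> complex) \<Rightarrow> bool" where
  "cstar_state \<phi> \<longleftrightarrow> bounded_linear \<phi> \<and> (\<forall>c x. \<phi> (c *\<^sub>C x) = c * \<phi> x) \<and>
     (\<forall>x. \<phi> (star x * x) \<in> \<real>\<^sub>\<ge>\<^sub>0) \<and> onorm \<phi> = 1"

subsection \<open>The universal C*-algebra of a right LCM semigroup\<close>

text \<open>The free unital *-algebra on symbols \<open>v\<^sub>s\<close>: finitely supported complex functions on the
  words in the letters \<open>v\<^sub>s\<close> and \<open>v\<^sub>s\<^sup>*\<close>, with convolution as product.\<close>

datatype 'a letter = Gen 'a | GenStar 'a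

datatype 'a gword = GWord "'a letter list"

instantiation gword :: (type) monoid_add
begin

definition zero_gword :: "'a gword" where "zero_gword = GWord []"

fun plus_gword :: "'a gword \<Rightarrow> 'a gword \<Rightarrow> 'a gword" where
  "plus_gword (GWord xs) (GWord ys) = GWord (xs @ ys)"

instance
proof
  show "a + b + c = a + (b + c)" for a b c :: "'a gword"
    by (cases a; cases b; cases c) simp
  show "0 + a = a" for a :: "'a gword" by (cases a) (simp add: zero_gword_def)
  show "a + 0 = a" for a :: "'a gword" by (cases a) (simp add: zero_gword_def)
qed

end

type_synonym 'a free_alg = "'a gword \<Rightarrow>\<^sub>0 complex"

fun letter_star :: "'a letter \<Rightarrow> 'a letter" where
  "letter_star (Gen s) = GenStar s"
| "letter_star (GenStar s) = Gen s"

fun word_star :: "'a gword \<Rightarrow> 'a gword" where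
  "word_star (GWord xs) = GWord (rev (map letter_star xs))"

definition free_star :: "'a free_alg \<Rightarrow> 'a free_alg" where
  "free_star x = Poly_Mapping.map cnj (Poly_Mapping.map_key word_star x)"

definition free_scale :: "complex \<Rightarrow> 'a free_alg \<Rightarrow> 'a free_alg" where
  "free_scale c x = Poly_Mapping.single 0 c * x"

definition fgen :: "'a \<Rightarrow> 'a free_alg" where
  "fgen s = Poly_Mapping.single (GWord [Gen s]) 1"

definition fproj :: "'a \<Rightarrow> 'a free_alg" where
  "fproj s = fgen s * free_star (fgen s)"

definition lcm_relators :: "'a::right_lcm_semigroup free_alg set" where
  "lcm_relators =
     {free_star (fgen s) * fgen s - 1 | s. True} \<union> {fgen 1 - 1} \<union>
     {fgen s * fgen t - fgen (s * t) | s t. True} \<union>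
     {fproj s * fproj t - fproj r | s t r. rideal s \<inter> rideal t = rideal r} \<union>
     {fproj s * fproj t | s t. rideal s \<inter> rideal t = {}}"

text \<open>C*-seminorms on the free algebra that vanish on the relators, i.e. the seminorms induced by
  *-homomorphisms into C*-algebras under which the images of the generators satisfy the
  relations. Their supremum is the universal seminorm; the resulting algebra is shown to have the
  universal property in \<open>lcm_cstar_universal\<close> below.\<close>

definition lcm_seminorm :: "('a::right_lcm_semigroup free_alg \<Rightarrow> real) \<Rightarrow> bool" where
  "lcm_seminorm p \<longleftrightarrow>
     (\<forall>x y. p (x + y) \<le> p x + p y) \<and> (\<forall>c x. p (free_scale c x) = cmod c * p x) \<and>
     (\<forall>x y. p (x * y) \<le> p x * p y) \<and> (\<forall>x. p (free_star x * x) = (p x)\<^sup>2) \<and>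
     (\<forall>x \<in> lcm_relators. p x = 0)"

definition univ_seminorm :: "'a::right_lcm_semigroup free_alg \<Rightarrow> real" where
  "univ_seminorm x = (SUP p\<in>Collect lcm_seminorm. p x)"

lemma word_star_star [simp]: "word_star (word_star w) = w"
proof -
  have "letter_star (letter_star l) = l" for l :: "'a letter" by (cases l) auto
  then show ?thesis by (cases w) (simp add: rev_map o_def)
qed

lemma inj_word_star: "inj word_star"
  by (metis injI word_star_star)

lemma word_star_add: "word_star (v + w) = word_star w + word_star v"
  by (cases v; cases w) simp

lemma word_star_zero [simp]: "word_star 0 = 0"
  by (simp add: zero_gword_def)

lemma free_alg_induct [case_names single add]:
  fixes x :: "'a free_alg"
  assumes "\<And>w c. P (Poly_Mapping.single w c)"
    and "\<And>x y. P x \<Longrightarrow> P y \<Longrightarrow> P (x + y)"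
  shows "P x"
proof (induction x rule: Poly_Mapping.update_induct)
  case const
  show ?case using assms(1)[of 0 0] by simp
next
  case (update f a b)
  have "Poly_Mapping.update a b f = f + Poly_Mapping.single a b"
    using update(1)
    by (intro poly_mapping_eqI)
      (auto simp: lookup_update lookup_add lookup_single when_def in_keys_iff)
  then show ?case using assms update by metis
qed

lemma lookup_free_star: "Poly_Mapping.lookup (free_star x) w = cnj (Poly_Mapping.lookup x (word_star w))"
  unfolding free_star_def by (simp add: map_key.rep_eq[OF inj_word_star] Poly_Mapping.map.rep_eq when_def)

lemma free_star_add: "free_star (x + y) = free_star x + free_star y"
  by (rule poly_mapping_eqI) (simp add: lookup_free_star lookup_add)

lemma free_star_single [simp]:
  "free_star (Poly_Mapping.single w c) = Poly_Mapping.single (word_star w) (cnj c)"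
proof -
  have "Poly_Mapping.map_key word_star (Poly_Mapping.single w c) = Poly_Mapping.single (word_star w) c"
    using map_key_single[OF inj_word_star, of "word_star w" c] by simp
  then show ?thesis by (simp add: free_star_def)
qed

lemma free_star_mult: "free_star (x * y) = free_star y * free_star x"
proof (induction x rule: free_alg_induct)
  case (single w c)
  show ?case
    by (induction y rule: free_alg_induct)
      (simp_all add: mult_single word_star_add free_star_add ring_distribs mult.commute)
qed (simp add: ring_distribs free_star_add)

lemma free_star_star [simp]: "free_star (free_star x) = x"
  by (induction x rule: free_alg_induct) (simp_all add: free_star_add)

lemma free_scale_single [simp]:
  "free_scale c (Poly_Mapping.single w d) = Poly_Mapping.single w (c * d)"
  by (simp add: free_scale_def mult_single)

lemma free_scale_add: "free_scale c (x + y) = free_scale c x + free_scale c y"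
  by (simp add: free_scale_def ring_distribs)

lemma free_scale_diff: "free_scale c (x - y) = free_scale c x - free_scale c y"
  by (simp add: free_scale_def ring_distribs)

lemma free_scale_add_left: "free_scale (c + d) x = free_scale c x + free_scale d x"
  by (simp add: free_scale_def ring_distribs single_add)

lemma free_scale_scale: "free_scale c (free_scale d x) = free_scale (c * d) x"
  by (simp add: free_scale_def mult.assoc[symmetric] mult_single)

lemma free_scale_one [simp]: "free_scale 1 x = x"
  by (simp add: free_scale_def)

lemma free_scale_zero [simp]: "free_scale 0 x = 0"
  by (simp add: free_scale_def)

lemma free_scale_mult_left: "free_scale c x * y = free_scale c (x * y)"
  by (simp add: free_scale_def mult.assoc)

lemma free_scale_mult_right: "x * free_scale c y = free_scale c (x * y)"
proof (induction x rule: free_alg_induct)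
  case (single w d)
  show ?case
    by (induction y rule: free_alg_induct)
      (simp_all add: mult_single free_scale_add ring_distribs mult.left_commute)
qed (simp add: ring_distribs free_scale_add)

lemma free_star_scale: "free_star (free_scale c x) = free_scale (cnj c) (free_star x)"
  by (induction x rule: free_alg_induct) (simp_all add: free_star_add free_scale_add)

lemma free_star_minus: "free_star (- x) = - free_star x"
  by (rule poly_mapping_eqI) (simp add: lookup_free_star)

lemma free_star_diff: "free_star (x - y) = free_star x - free_star y"
  by (rule poly_mapping_eqI) (simp add: lookup_free_star lookup_minus)

lemma free_star_one [simp]: "free_star 1 = 1"
  by (metis free_star_single single_one word_star_zero complex_cnj_one)


lemma lcm_seminormD:
  assumes "lcm_seminorm p"
  shows "p (x + y) \<le> p x + p y" "p (free_scale c x) = cmod c * p x" "p (x * y) \<le> p x * p y"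
    "p (free_star x * x) = (p x)\<^sup>2" "r \<in> lcm_relators \<Longrightarrow> p r = 0"
  using assms unfolding lcm_seminorm_def by blast+

lemma lcm_seminorm_zero [simp]: "lcm_seminorm p \<Longrightarrow> p 0 = 0"
  using lcm_seminormD(2)[of p 0 0] by simp

lemma lcm_seminorm_minus: "lcm_seminorm p \<Longrightarrow> p (- x) = p x"
  using lcm_seminormD(2)[of p "-1" x] by (simp add: free_scale_def single_uminus)

lemma lcm_seminorm_diff_le: "lcm_seminorm p \<Longrightarrow> p (x - y) \<le> p x + p y"
  using lcm_seminormD(1)[of p x "- y"] by (simp add: lcm_seminorm_minus)

lemma lcm_seminorm_nonneg: "lcm_seminorm p \<Longrightarrow> 0 \<le> p x"
  using lcm_seminorm_diff_le[of p x x] by simp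

lemma lcm_seminorm_commute: "lcm_seminorm p \<Longrightarrow> p (x - y) = p (y - x)"
  using lcm_seminorm_minus[of p "x - y"] by simp

lemma lcm_seminorm_star: "lcm_seminorm p \<Longrightarrow> p (free_star x) = p x"
proof -
  assume p: "lcm_seminorm p"
  have *: "p y \<le> p (free_star y)" for y
  proof (cases "p y = 0")
    case False
    have "p y * p y \<le> p (free_star y) * p y"
      using lcm_seminormD(3,4)[OF p] by (metis power2_eq_square)
    then show ?thesis using False lcm_seminorm_nonneg[OF p, of y] by simp
  qed (simp add: lcm_seminorm_nonneg[OF p])
  show ?thesis using *[of x] *[of "free_star x"] by simp
qed

lemma lcm_seminorm_le_one:
  assumes p: "lcm_seminorm p"
  shows "p (Poly_Mapping.single w 1) \<le> 1"
proof -
  have one: "p 1 \<le> 1"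
  proof -
    have "p 1 = (p 1)\<^sup>2" using lcm_seminormD(4)[OF p, of 1] by simp
    then show ?thesis by (auto simp: power2_eq_square)
  qed
  have gen: "p (fgen s) \<le> 1" for s
  proof -
    have "p (free_star (fgen s) * fgen s - 1) = 0"
      by (rule lcm_seminormD(5)[OF p]) (auto simp: lcm_relators_def)
    then have "p (free_star (fgen s) * fgen s) \<le> 1"
      using lcm_seminormD(1)[OF p, of "free_star (fgen s) * fgen s - 1" 1] one by simp
    then have "(p (fgen s))\<^sup>2 \<le> 1" by (simp add: lcm_seminormD(4)[OF p])
    then show ?thesis by (metis abs_square_le_1 abs_le_D1)
  qed
  have letter: "p (Poly_Mapping.single (GWord [l]) 1) \<le> 1" for l
  proof (cases l)
    case (GenStar s)
    then have "Poly_Mapping.single (GWord [l]) 1 = free_star (fgen s)"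
      by (simp add: fgen_def)
    then show ?thesis using gen[of s] by (simp add: lcm_seminorm_star[OF p])
  qed (use gen in \<open>simp add: fgen_def\<close>)
  obtain ls where w: "w = GWord ls" by (cases w)
  have "p (Poly_Mapping.single (GWord ls) 1) \<le> 1"
  proof (induction ls)
    case Nil
    show ?case using one by (simp flip: zero_gword_def add: single_one)
  next
    case (Cons l ls)
    have "Poly_Mapping.single (GWord (l # ls)) (1::complex) =
        Poly_Mapping.single (GWord [l]) 1 * Poly_Mapping.single (GWord ls) 1"
      by (simp add: mult_single)
    then have "p (Poly_Mapping.single (GWord (l # ls)) 1) \<le>
        p (Poly_Mapping.single (GWord [l]) 1) * p (Poly_Mapping.single (GWord ls) 1)"
      using lcm_seminormD(3)[OF p] by metis
    also have "\<dots> \<le> 1"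
      using letter Cons lcm_seminorm_nonneg[OF p] by (simp add: mult_le_one)
    finally show ?case .
  qed
  then show ?thesis using w by simp
qed

lemma lcm_seminorm_bounded: "\<exists>B. \<forall>p. lcm_seminorm p \<longrightarrow> p x \<le> B"
proof (induction x rule: free_alg_induct)
  case (single w c)
  have "p (Poly_Mapping.single w c) \<le> cmod c" if p: "lcm_seminorm p" for p
    using lcm_seminormD(2)[OF p, of c "Poly_Mapping.single w 1"] lcm_seminorm_le_one[OF p, of w]
    by (simp add: mult_left_le)
  then show ?case by blast
next
  case (add x y)
  then obtain A B where "\<forall>p. lcm_seminorm p \<longrightarrow> p x \<le> A" "\<forall>p. lcm_seminorm p \<longrightarrow> p y \<le> B"
    by blast
  then have "\<forall>p. lcm_seminorm p \<longrightarrow> p (x + y) \<le> A + B"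
    using lcm_seminormD(1) by (meson add_mono order_trans)
  then show ?case by blast
qed

lemma lcm_seminorm_trivial: "lcm_seminorm (\<lambda>_. 0)"
  by (simp add: lcm_seminorm_def)

lemma univ_seminorm_upper: "lcm_seminorm p \<Longrightarrow> p x \<le> univ_seminorm x"
  unfolding univ_seminorm_def
  by (rule cSUP_upper) (use lcm_seminorm_bounded[of x] in \<open>auto simp: bdd_above_def\<close>)

lemma univ_seminorm_least: "(\<And>p. lcm_seminorm p \<Longrightarrow> p x \<le> B) \<Longrightarrow> univ_seminorm x \<le> B"
  unfolding univ_seminorm_def
  by (rule cSUP_least) (use lcm_seminorm_trivial in auto)

lemma lcm_seminorm_univ: "lcm_seminorm univ_seminorm"
proof -
  let ?U = univ_seminorm
  have ge0: "0 \<le> ?U x" for x :: "'a free_alg"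
    using univ_seminorm_upper[OF lcm_seminorm_trivial] .
  have "?U (x + y) \<le> ?U x + ?U y" for x y :: "'a free_alg"
    by (rule univ_seminorm_least)
      (meson add_mono order_trans lcm_seminormD(1) univ_seminorm_upper)
  moreover have scale: "?U (free_scale c x) = cmod c * ?U x" for c and x :: "'a free_alg"
  proof -
    have le: "?U (free_scale c x) \<le> cmod c * ?U x" for c and x :: "'a free_alg"
    proof (rule univ_seminorm_least)
      fix p :: "'a free_alg \<Rightarrow> real" assume p: "lcm_seminorm p"
      show "p (free_scale c x) \<le> cmod c * ?U x"
        unfolding lcm_seminormD(2)[OF p] by (intro mult_left_mono univ_seminorm_upper p) simp
    qed
    show ?thesis
    proof (cases "c = 0")
      case True
      then show ?thesis using le[of 0 x] ge0[of "free_scale 0 x"] by simp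
    next
      case False
      have "?U x \<le> inverse (cmod c) * ?U (free_scale c x)"
        using le[of "inverse c" "free_scale c x"] False
        by (simp add: free_scale_scale norm_inverse)
      then have "cmod c * ?U x \<le> cmod c * (inverse (cmod c) * ?U (free_scale c x))"
        by (rule mult_left_mono) simp
      then have "cmod c * ?U x \<le> ?U (free_scale c x)"
        using False by (simp add: mult.assoc[symmetric])
      then show ?thesis using le[of c x] by simp
    qed
  qed
  moreover have "?U (x * y) \<le> ?U x * ?U y" for x y :: "'a free_alg"
  proof (rule univ_seminorm_least)
    fix p :: "'a free_alg \<Rightarrow> real" assume p: "lcm_seminorm p"
    have "p (x * y) \<le> p x * p y" using lcm_seminormD(3)[OF p] .
    also have "\<dots> \<le> ?U x * ?U y"
      using p by (intro mult_mono univ_seminorm_upper lcm_seminorm_nonneg ge0)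
    finally show "p (x * y) \<le> ?U x * ?U y" .
  qed
  moreover have "?U (free_star x * x) = (?U x)\<^sup>2" for x :: "'a free_alg"
  proof (rule antisym)
    show "?U (free_star x * x) \<le> (?U x)\<^sup>2"
    proof (rule univ_seminorm_least)
      fix p :: "'a free_alg \<Rightarrow> real" assume p: "lcm_seminorm p"
      show "p (free_star x * x) \<le> (?U x)\<^sup>2"
        unfolding lcm_seminormD(4)[OF p]
        by (intro power_mono univ_seminorm_upper lcm_seminorm_nonneg p)
    qed
    have "?U x \<le> sqrt (?U (free_star x * x))"
    proof (rule univ_seminorm_least)
      fix p :: "'a free_alg \<Rightarrow> real" assume p: "lcm_seminorm p"
      have "(p x)\<^sup>2 \<le> ?U (free_star x * x)"
        using univ_seminorm_upper[OF p, of "free_star x * x"] lcm_seminormD(4)[OF p] by simp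
      then show "p x \<le> sqrt (?U (free_star x * x))" by (rule real_le_rsqrt)
    qed
    then have "(?U x)\<^sup>2 \<le> (sqrt (?U (free_star x * x)))\<^sup>2"
      using ge0 by (rule power_mono)
    then show "(?U x)\<^sup>2 \<le> ?U (free_star x * x)" by (simp add: ge0)
  qed
  moreover have "?U x = 0" if "x \<in> lcm_relators" for x :: "'a free_alg"
  proof (rule antisym)
    show "?U x \<le> 0"
      by (rule univ_seminorm_least) (use lcm_seminormD(5)[OF _ that] in \<open>metis order_refl\<close>)
  qed (rule ge0)
  ultimately show ?thesis unfolding lcm_seminorm_def by blast
qed

lemmas univ_seminormD = lcm_seminormD[OF lcm_seminorm_univ]
lemmas univ_seminorm_zero [simp] = lcm_seminorm_zero[OF lcm_seminorm_univ]
lemmas univ_seminorm_minus = lcm_seminorm_minus[OF lcm_seminorm_univ]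
lemmas univ_seminorm_diff_le = lcm_seminorm_diff_le[OF lcm_seminorm_univ]
lemmas univ_seminorm_nonneg [simp] = lcm_seminorm_nonneg[OF lcm_seminorm_univ]
lemmas univ_seminorm_commute = lcm_seminorm_commute[OF lcm_seminorm_univ]
lemmas univ_seminorm_star [simp] = lcm_seminorm_star[OF lcm_seminorm_univ]

lemma univ_seminorm_triangle:
  "univ_seminorm (x - z) \<le> univ_seminorm (x - y) + univ_seminorm (y - z)"
  using univ_seminormD(1)[of "x - y" "y - z"] by simp

lemma univ_seminorm_abs_diff: "\<bar>univ_seminorm x - univ_seminorm y\<bar> \<le> univ_seminorm (x - y)"
  using univ_seminormD(1)[of "x - y" y] univ_seminormD(1)[of "y - x" x] univ_seminorm_commute[of x y]
  by simp

definition free_Cauchy :: "(nat \<Rightarrow> 'a::right_lcm_semigroup free_alg) \<Rightarrow> bool" where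
  "free_Cauchy X \<longleftrightarrow> (\<forall>e>0. \<exists>M. \<forall>m\<ge>M. \<forall>n\<ge>M. univ_seminorm (X m - X n) < e)"

definition completion_rel ::
    "(nat \<Rightarrow> 'a::right_lcm_semigroup free_alg) \<Rightarrow> (nat \<Rightarrow> 'a free_alg) \<Rightarrow> bool" where
  "completion_rel X Y \<longleftrightarrow>
     free_Cauchy X \<and> free_Cauchy Y \<and> (\<lambda>n. univ_seminorm (X n - Y n)) \<longlonglongrightarrow> 0"

lemma completion_rel_refl [simp]: "completion_rel X X \<longleftrightarrow> free_Cauchy X"
  by (simp add: completion_rel_def)

lemma free_Cauchy_const [simp]: "free_Cauchy (\<lambda>_. x)"
  by (simp add: free_Cauchy_def)

lemma tendsto_le_zero:
  fixes f :: "nat \<Rightarrow> real"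
  assumes "g \<longlonglongrightarrow> 0" "\<And>n. 0 \<le> f n" "\<And>n. f n \<le> g n"
  shows "f \<longlonglongrightarrow> 0"
  by (rule tendsto_sandwich[of "\<lambda>_. 0" f sequentially g]) (use assms in auto)

lemma completion_rel_sym: "completion_rel X Y \<Longrightarrow> completion_rel Y X"
  unfolding completion_rel_def by (simp add: univ_seminorm_commute)

lemma completion_rel_trans:
  assumes "completion_rel X Y" "completion_rel Y Z" shows "completion_rel X Z"
proof -
  have "(\<lambda>n. univ_seminorm (X n - Y n) + univ_seminorm (Y n - Z n)) \<longlonglongrightarrow> 0"
    using assms unfolding completion_rel_def by (intro tendsto_add_zero) auto
  then have "(\<lambda>n. univ_seminorm (X n - Z n)) \<longlonglongrightarrow> 0"
    by (rule tendsto_le_zero) (auto simp: univ_seminorm_triangle)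
  then show ?thesis using assms unfolding completion_rel_def by simp
qed

lemma free_Cauchy_le:
  assumes "free_Cauchy X" "\<And>m n. univ_seminorm (Z m - Z n) \<le> C * univ_seminorm (X m - X n)"
  shows "free_Cauchy Z"
  unfolding free_Cauchy_def
proof (intro allI impI)
  fix e :: real assume e: "e > 0"
  define D where "D = max C 1"
  have D: "D > 0" "C \<le> D" by (auto simp: D_def)
  obtain M where M: "\<forall>m\<ge>M. \<forall>n\<ge>M. univ_seminorm (X m - X n) < e / D"
    using assms(1) e D unfolding free_Cauchy_def by (meson divide_pos_pos)
  have "univ_seminorm (Z m - Z n) < e" if "m \<ge> M" "n \<ge> M" for m n
  proof -
    have "univ_seminorm (Z m - Z n) \<le> D * univ_seminorm (X m - X n)"
      using assms(2)[of m n] D mult_right_mono[OF D(2), of "univ_seminorm (X m - X n)"] by simp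
    also have "\<dots> < D * (e / D)" using M that D by (intro mult_strict_left_mono) auto
    finally show ?thesis using D by simp
  qed
  then show "\<exists>M. \<forall>m\<ge>M. \<forall>n\<ge>M. univ_seminorm (Z m - Z n) < e" by blast
qed

lemma free_Cauchy_le2:
  assumes "free_Cauchy X" "free_Cauchy Y" "C \<ge> 0"
    and "\<And>m n. univ_seminorm (Z m - Z n) \<le>
           C * (univ_seminorm (X m - X n) + univ_seminorm (Y m - Y n))"
  shows "free_Cauchy Z"
  unfolding free_Cauchy_def
proof (intro allI impI)
  fix e :: real assume e: "e > 0"
  define D where "D = max C 1"
  have D: "D > 0" "C \<le> D" by (auto simp: D_def)
  have eD: "e / D / 2 > 0" using e D by simp
  obtain M where M: "\<forall>m\<ge>M. \<forall>n\<ge>M. univ_seminorm (X m - X n) < e / D / 2"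
    using assms(1) eD unfolding free_Cauchy_def by blast
  obtain M' where M': "\<forall>m\<ge>M'. \<forall>n\<ge>M'. univ_seminorm (Y m - Y n) < e / D / 2"
    using assms(2) eD unfolding free_Cauchy_def by blast
  have "univ_seminorm (Z m - Z n) < e" if "m \<ge> max M M'" "n \<ge> max M M'" for m n
  proof -
    let ?s = "univ_seminorm (X m - X n) + univ_seminorm (Y m - Y n)"
    have "univ_seminorm (Z m - Z n) \<le> D * ?s"
      using assms(4)[of m n] mult_right_mono[OF D(2), of ?s] by simp
    also have "\<dots> < D * (e / D)"
    proof (intro mult_strict_left_mono D)
      have "univ_seminorm (X m - X n) < e / D / 2" "univ_seminorm (Y m - Y n) < e / D / 2"
        using M M' that by auto
      then show "?s < e / D" by linarith
    qed
    finally show ?thesis using D by simp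
  qed
  then show "\<exists>M. \<forall>m\<ge>M. \<forall>n\<ge>M. univ_seminorm (Z m - Z n) < e" by blast
qed

lemma free_Cauchy_norm_Cauchy:
  assumes "free_Cauchy X" shows "convergent (\<lambda>n. univ_seminorm (X n))"
proof (rule Cauchy_convergent, rule metric_CauchyI)
  fix e :: real assume "e > 0"
  then obtain M where M: "\<forall>m\<ge>M. \<forall>n\<ge>M. univ_seminorm (X m - X n) < e"
    using assms unfolding free_Cauchy_def by blast
  have "dist (univ_seminorm (X m)) (univ_seminorm (X n)) < e" if "m \<ge> M" "n \<ge> M" for m n
    using univ_seminorm_abs_diff[of "X m" "X n"] M that unfolding dist_real_def
    by (meson le_less_trans)
  then show "\<exists>M. \<forall>m\<ge>M. \<forall>n\<ge>M. dist (univ_seminorm (X m)) (univ_seminorm (X n)) < e" by blast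
qed

lemma free_Cauchy_bounded:
  assumes "free_Cauchy X" obtains B where "B \<ge> 0" "\<And>n. univ_seminorm (X n) \<le> B"
proof -
  obtain K where "K > 0" "\<forall>n. norm (univ_seminorm (X n)) \<le> K"
    using convergent_imp_Bseq[OF free_Cauchy_norm_Cauchy[OF assms]] by (auto elim: BseqE)
  then show ?thesis using that[of K] by simp
qed

lemma univ_seminorm_mult_diff:
  "univ_seminorm (a * b - c * d) \<le>
     univ_seminorm (a - c) * univ_seminorm b + univ_seminorm c * univ_seminorm (b - d)"
proof -
  have "a * b - c * d = (a - c) * b + c * (b - d)" by (simp add: algebra_simps)
  then show ?thesis
    using univ_seminormD(1)[of "(a - c) * b" "c * (b - d)"] univ_seminormD(3)[of "a - c" b]
      univ_seminormD(3)[of c "b - d"] by simp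
qed

lemma univ_seminorm_add_diff:
  "univ_seminorm ((a + b) - (c + d)) \<le> univ_seminorm (a - c) + univ_seminorm (b - d)"
  using univ_seminormD(1)[of "a - c" "b - d"] by (simp add: algebra_simps)

lemma free_Cauchy_add: "free_Cauchy X \<Longrightarrow> free_Cauchy Y \<Longrightarrow> free_Cauchy (\<lambda>n. X n + Y n)"
  by (rule free_Cauchy_le2[of X Y 1]) (auto simp: univ_seminorm_add_diff)

lemma free_Cauchy_scale: "free_Cauchy X \<Longrightarrow> free_Cauchy (\<lambda>n. free_scale c (X n))"
  by (rule free_Cauchy_le[where C = "cmod c"])
    (auto simp: free_scale_diff[symmetric] univ_seminormD(2))

lemma free_Cauchy_minus: "free_Cauchy X \<Longrightarrow> free_Cauchy (\<lambda>n. - X n)"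
  by (rule free_Cauchy_le[where C = 1]) (auto simp: univ_seminorm_commute)

lemma free_Cauchy_diff: "free_Cauchy X \<Longrightarrow> free_Cauchy Y \<Longrightarrow> free_Cauchy (\<lambda>n. X n - Y n)"
  using free_Cauchy_add[of X "\<lambda>n. - Y n"] free_Cauchy_minus[of Y] by simp

lemma free_Cauchy_star: "free_Cauchy X \<Longrightarrow> free_Cauchy (\<lambda>n. free_star (X n))"
  by (rule free_Cauchy_le[where C = 1]) (auto simp: free_star_diff[symmetric])

lemma free_Cauchy_mult:
  assumes X: "free_Cauchy X" and Y: "free_Cauchy Y"
  shows "free_Cauchy (\<lambda>n. X n * Y n)"
proof -
  obtain A where A: "A \<ge> 0" "\<And>n. univ_seminorm (X n) \<le> A" using free_Cauchy_bounded[OF X] by blast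
  obtain B where B: "B \<ge> 0" "\<And>n. univ_seminorm (Y n) \<le> B" using free_Cauchy_bounded[OF Y] by blast
  show ?thesis
  proof (rule free_Cauchy_le2[OF X Y, where C = "A + B"])
    fix m n
    have "univ_seminorm (X m * Y m - X n * Y n) \<le>
        univ_seminorm (X m - X n) * B + A * univ_seminorm (Y m - Y n)"
      using A B by (intro order_trans[OF univ_seminorm_mult_diff] add_mono mult_mono) auto
    also have "\<dots> \<le> (A + B) * (univ_seminorm (X m - X n) + univ_seminorm (Y m - Y n))"
      using mult_nonneg_nonneg[OF A(1) univ_seminorm_nonneg[of "X m - X n"]]
        mult_nonneg_nonneg[OF B(1) univ_seminorm_nonneg[of "Y m - Y n"]]
      by (simp add: algebra_simps)
    finally show "univ_seminorm (X m * Y m - X n * Y n) \<le>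
        (A + B) * (univ_seminorm (X m - X n) + univ_seminorm (Y m - Y n))" .
  qed (use A B in simp)
qed

lemma completion_rel_add:
  assumes "completion_rel X X'" "completion_rel Y Y'"
  shows "completion_rel (\<lambda>n. X n + Y n) (\<lambda>n. X' n + Y' n)"
proof -
  have "(\<lambda>n. univ_seminorm (X n - X' n) + univ_seminorm (Y n - Y' n)) \<longlonglongrightarrow> 0"
    using assms unfolding completion_rel_def by (intro tendsto_add_zero) auto
  then have "(\<lambda>n. univ_seminorm ((X n + Y n) - (X' n + Y' n))) \<longlonglongrightarrow> 0"
    by (rule tendsto_le_zero) (auto simp: univ_seminorm_add_diff)
  then show ?thesis using assms unfolding completion_rel_def by (simp add: free_Cauchy_add)
qed

lemma completion_rel_scale:
  assumes "completion_rel X Y"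
  shows "completion_rel (\<lambda>n. free_scale c (X n)) (\<lambda>n. free_scale c (Y n))"
proof -
  have "(\<lambda>n. cmod c * univ_seminorm (X n - Y n)) \<longlonglongrightarrow> cmod c * 0"
    using assms unfolding completion_rel_def by (intro tendsto_mult) auto
  then show ?thesis using assms unfolding completion_rel_def
    by (simp add: free_Cauchy_scale free_scale_diff[symmetric] univ_seminormD(2))
qed

lemma completion_rel_minus:
  "completion_rel X Y \<Longrightarrow> completion_rel (\<lambda>n. - X n) (\<lambda>n. - Y n)"
  unfolding completion_rel_def by (simp add: free_Cauchy_minus univ_seminorm_commute)

lemma completion_rel_diff:
  "completion_rel X X' \<Longrightarrow> completion_rel Y Y' \<Longrightarrow>
     completion_rel (\<lambda>n. X n - Y n) (\<lambda>n. X' n - Y' n)"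
  using completion_rel_add[OF _ completion_rel_minus, of X X' Y Y'] by simp

lemma completion_rel_star:
  "completion_rel X Y \<Longrightarrow> completion_rel (\<lambda>n. free_star (X n)) (\<lambda>n. free_star (Y n))"
  unfolding completion_rel_def by (simp add: free_Cauchy_star free_star_diff[symmetric])

lemma completion_rel_mult:
  assumes "completion_rel X X'" "completion_rel Y Y'"
  shows "completion_rel (\<lambda>n. X n * Y n) (\<lambda>n. X' n * Y' n)"
proof -
  have C: "free_Cauchy X'" "free_Cauchy Y"
    using assms unfolding completion_rel_def by auto
  obtain A where A: "A \<ge> 0" "\<And>n. univ_seminorm (X' n) \<le> A" using free_Cauchy_bounded[OF C(1)] by blast
  obtain B where B: "B \<ge> 0" "\<And>n. univ_seminorm (Y n) \<le> B" using free_Cauchy_bounded[OF C(2)] by blast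
  have "(\<lambda>n. univ_seminorm (X n - X' n) * B + A * univ_seminorm (Y n - Y' n)) \<longlonglongrightarrow> 0"
    using assms unfolding completion_rel_def
    by (intro tendsto_add_zero tendsto_mult_left_zero tendsto_mult_right_zero) auto
  then have "(\<lambda>n. univ_seminorm (X n * Y n - X' n * Y' n)) \<longlonglongrightarrow> 0"
  proof (rule tendsto_le_zero)
    show "univ_seminorm (X n * Y n - X' n * Y' n) \<le>
        univ_seminorm (X n - X' n) * B + A * univ_seminorm (Y n - Y' n)" for n
      using A B by (intro order_trans[OF univ_seminorm_mult_diff] add_mono mult_mono) auto
  qed simp
  then show ?thesis using assms unfolding completion_rel_def by (simp add: free_Cauchy_mult)
qed

lemma free_Cauchy_norm_lim:
  "free_Cauchy X \<Longrightarrow> (\<lambda>n. univ_seminorm (X n)) \<longlonglongrightarrow> lim (\<lambda>n. univ_seminorm (X n))"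
  using free_Cauchy_norm_Cauchy convergent_LIMSEQ_iff by blast

lemma completion_rel_norm:
  assumes "completion_rel X Y"
  shows "lim (\<lambda>n. univ_seminorm (X n)) = lim (\<lambda>n. univ_seminorm (Y n))"
proof -
  have X: "free_Cauchy X" and "free_Cauchy Y" and *: "(\<lambda>n. univ_seminorm (X n - Y n)) \<longlonglongrightarrow> 0"
    using assms by (auto simp: completion_rel_def)
  have "(\<lambda>n. \<bar>univ_seminorm (X n) - univ_seminorm (Y n)\<bar>) \<longlonglongrightarrow> 0"
    by (rule tendsto_le_zero[OF *]) (auto simp: univ_seminorm_abs_diff)
  then have "(\<lambda>n. univ_seminorm (X n) - univ_seminorm (Y n)) \<longlonglongrightarrow> 0"
    by (rule tendsto_rabs_zero_cancel)
  then have "(\<lambda>n. univ_seminorm (X n) - (univ_seminorm (X n) - univ_seminorm (Y n))) \<longlonglongrightarrow>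
      lim (\<lambda>n. univ_seminorm (X n)) - 0"
    by (intro tendsto_diff free_Cauchy_norm_lim X)
  then show ?thesis by (simp add: limI)
qed

text \<open>The elements of \<open>C\<^sup>*(S)\<close>: Cauchy sequences for the universal seminorm modulo null
  sequences.\<close>

quotient_type (overloaded) 'a lcm_cstar =
  "nat \<Rightarrow> 'a::right_lcm_semigroup free_alg" / partial: completion_rel
proof (rule part_equivpI)
  show "\<exists>X :: nat \<Rightarrow> 'a free_alg. completion_rel X X"
    by (intro exI[of _ "\<lambda>_. 0"]) simp
qed (auto intro!: sympI transpI intro: completion_rel_sym completion_rel_trans)

instantiation lcm_cstar :: (right_lcm_semigroup) "{real_normed_algebra, monoid_mult}"
begin

lift_definition zero_lcm_cstar :: "'a lcm_cstar" is "\<lambda>_. 0" by simp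
lift_definition one_lcm_cstar :: "'a lcm_cstar" is "\<lambda>_. 1" by simp
lift_definition plus_lcm_cstar :: "'a lcm_cstar \<Rightarrow> 'a lcm_cstar \<Rightarrow> 'a lcm_cstar"
  is "\<lambda>X Y n. X n + Y n" by (rule completion_rel_add)
lift_definition minus_lcm_cstar :: "'a lcm_cstar \<Rightarrow> 'a lcm_cstar \<Rightarrow> 'a lcm_cstar"
  is "\<lambda>X Y n. X n - Y n" by (rule completion_rel_diff)
lift_definition uminus_lcm_cstar :: "'a lcm_cstar \<Rightarrow> 'a lcm_cstar"
  is "\<lambda>X n. - X n" by (rule completion_rel_minus)
lift_definition times_lcm_cstar :: "'a lcm_cstar \<Rightarrow> 'a lcm_cstar \<Rightarrow> 'a lcm_cstar"
  is "\<lambda>X Y n. X n * Y n" by (rule completion_rel_mult)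
lift_definition scaleR_lcm_cstar :: "real \<Rightarrow> 'a lcm_cstar \<Rightarrow> 'a lcm_cstar"
  is "\<lambda>r X n. free_scale (complex_of_real r) (X n)" by (rule completion_rel_scale)
lift_definition norm_lcm_cstar :: "'a lcm_cstar \<Rightarrow> real"
  is "\<lambda>X. lim (\<lambda>n. univ_seminorm (X n))" by (rule completion_rel_norm)

definition dist_lcm_cstar :: "'a lcm_cstar \<Rightarrow> 'a lcm_cstar \<Rightarrow> real" where
  "dist_lcm_cstar x y = norm (x - y)"
definition sgn_lcm_cstar :: "'a lcm_cstar \<Rightarrow> 'a lcm_cstar" where
  "sgn_lcm_cstar x = inverse (norm x) *\<^sub>R x"
definition uniformity_lcm_cstar :: "('a lcm_cstar \<times> 'a lcm_cstar) filter" where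
  "uniformity_lcm_cstar = (INF e\<in>{0 <..}. principal {(x, y). dist x y < e})"
definition open_lcm_cstar :: "'a lcm_cstar set \<Rightarrow> bool" where
  "open_lcm_cstar U = (\<forall>x\<in>U. eventually (\<lambda>(x', y). x' = x \<longrightarrow> y \<in> U) uniformity)"

instance
proof
  fix x y z :: "'a lcm_cstar" and r r' :: real
  note C = free_Cauchy_add free_Cauchy_diff free_Cauchy_minus free_Cauchy_mult free_Cauchy_scale
  note L = free_Cauchy_norm_lim
  show "x + y + z = x + (y + z)" by transfer (auto intro!: C simp: add.assoc)
  show "x + y = y + x" by transfer (auto intro!: C simp: add.commute)
  show "0 + x = x" by transfer simp
  show "- x + x = 0" by transfer simp
  show "x - y = x + - y" by transfer (auto intro!: C)
  show "x * y * z = x * (y * z)" by transfer (auto intro!: C simp: mult.assoc)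
  show "(x + y) * z = x * z + y * z" by transfer (auto intro!: C simp: ring_distribs)
  show "x * (y + z) = x * y + x * z" by transfer (auto intro!: C simp: ring_distribs)
  show "1 * x = x" by transfer simp
  show "x * 1 = x" by transfer simp
  show "r *\<^sub>R (x + y) = r *\<^sub>R x + r *\<^sub>R y"
    by transfer (auto intro!: C simp: free_scale_add)
  show "(r + r') *\<^sub>R x = r *\<^sub>R x + r' *\<^sub>R x"
    by transfer (auto intro!: C simp: free_scale_add_left)
  show "r *\<^sub>R r' *\<^sub>R x = (r * r') *\<^sub>R x"
    by transfer (auto intro!: C simp: free_scale_scale)
  show "1 *\<^sub>R x = x" by transfer simp
  show "r *\<^sub>R x * y = r *\<^sub>R (x * y)"
    by transfer (auto intro!: C simp: free_scale_mult_left)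
  show "x * r *\<^sub>R y = r *\<^sub>R (x * y)"
    by transfer (auto intro!: C simp: free_scale_mult_right)
  show "norm (r *\<^sub>R x) = \<bar>r\<bar> * norm x"
    by transfer (auto intro!: limI tendsto_mult L simp: univ_seminormD(2))
  show "norm (x + y) \<le> norm x + norm y"
  proof (transfer, simp)
    fix X Y :: "nat \<Rightarrow> 'a free_alg" assume *: "free_Cauchy X" "free_Cauchy Y"
    show "lim (\<lambda>n. univ_seminorm (X n + Y n)) \<le>
        lim (\<lambda>n. univ_seminorm (X n)) + lim (\<lambda>n. univ_seminorm (Y n))"
      by (rule LIMSEQ_le[OF L[OF free_Cauchy_add[OF *]] tendsto_add[OF L[OF *(1)] L[OF *(2)]]])
        (auto intro: univ_seminormD(1))
  qed
  show "norm (x * y) \<le> norm x * norm y"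
  proof (transfer, simp)
    fix X Y :: "nat \<Rightarrow> 'a free_alg" assume *: "free_Cauchy X" "free_Cauchy Y"
    show "lim (\<lambda>n. univ_seminorm (X n * Y n)) \<le>
        lim (\<lambda>n. univ_seminorm (X n)) * lim (\<lambda>n. univ_seminorm (Y n))"
      by (rule LIMSEQ_le[OF L[OF free_Cauchy_mult[OF *]] tendsto_mult[OF L[OF *(1)] L[OF *(2)]]])
        (auto intro: univ_seminormD(3))
  qed
  show "norm x = 0 \<longleftrightarrow> x = 0"
  proof (transfer, simp)
    fix X :: "nat \<Rightarrow> 'a free_alg" assume *: "free_Cauchy X"
    show "lim (\<lambda>n. univ_seminorm (X n)) = 0 \<longleftrightarrow> completion_rel X (\<lambda>_. 0)"
      using * L[OF *] by (auto simp: completion_rel_def intro: limI)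
  qed
  show "dist x y = norm (x - y)" by (rule dist_lcm_cstar_def)
  show "sgn x = inverse (norm x) *\<^sub>R x" by (rule sgn_lcm_cstar_def)
  show "uniformity = (INF e\<in>{0 <..}. principal {(x, y :: 'a lcm_cstar). dist x y < e})"
    by (rule uniformity_lcm_cstar_def)
  show "open U = (\<forall>x\<in>U. eventually (\<lambda>(x', y). x' = x \<longrightarrow> y \<in> U) uniformity)"
    for U :: "'a lcm_cstar set" by (rule open_lcm_cstar_def)
qed

end

definition of_free :: "'a::right_lcm_semigroup free_alg \<Rightarrow> 'a lcm_cstar" where
  "of_free x = abs_lcm_cstar (\<lambda>_. x)"

lemma norm_of_free: "norm (of_free x) = univ_seminorm x"
  by (simp add: of_free_def norm_lcm_cstar.abs_eq)

lemma of_free_diff: "of_free (x - y) = of_free x - of_free y"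
  by (simp add: of_free_def minus_lcm_cstar.abs_eq)

lemma of_free_add: "of_free (x + y) = of_free x + of_free y"
  by (simp add: of_free_def plus_lcm_cstar.abs_eq)

lemma of_free_mult: "of_free (x * y) = of_free x * of_free y"
  by (simp add: of_free_def times_lcm_cstar.abs_eq)

lemma of_free_one: "of_free 1 = 1"
  by (simp add: of_free_def one_lcm_cstar_def)

lemma of_free_zero: "of_free 0 = 0"
  by (simp add: of_free_def zero_lcm_cstar_def)

lemma of_free_LIMSEQ_abs:
  fixes X :: "nat \<Rightarrow> 'a::right_lcm_semigroup free_alg"
  assumes X: "free_Cauchy X"
  shows "(\<lambda>n. of_free (X n)) \<longlonglongrightarrow> abs_lcm_cstar X"
proof (rule metric_LIMSEQ_I)
  fix e :: real assume e: "e > 0"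
  then obtain M where M: "\<forall>m\<ge>M. \<forall>n\<ge>M. univ_seminorm (X m - X n) < e / 2"
    using X unfolding free_Cauchy_def by (meson half_gt_zero)
  have "dist (of_free (X n)) (abs_lcm_cstar X) < e" if n: "n \<ge> M" for n
  proof -
    have C: "free_Cauchy (\<lambda>m. X n - X m)" using X by (intro free_Cauchy_diff) auto
    have "of_free (X n) - abs_lcm_cstar X = abs_lcm_cstar (\<lambda>m. X n - X m)"
      unfolding of_free_def using X by (simp add: minus_lcm_cstar.abs_eq)
    then have "dist (of_free (X n)) (abs_lcm_cstar X) = lim (\<lambda>m. univ_seminorm (X n - X m))"
      using C by (simp add: dist_norm norm_lcm_cstar.abs_eq)
    also have "\<dots> \<le> e / 2"
      by (rule LIMSEQ_le_const2[OF free_Cauchy_norm_lim[OF C]]) (use M n in \<open>auto intro: less_imp_le\<close>)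
    finally show ?thesis using e by simp
  qed
  then show "\<exists>M. \<forall>n\<ge>M. dist (of_free (X n)) (abs_lcm_cstar X) < e" by blast
qed

lemma of_free_dense:
  fixes x :: "'a::right_lcm_semigroup lcm_cstar"
  obtains X where "free_Cauchy X" "(\<lambda>n. of_free (X n)) \<longlonglongrightarrow> x"
proof -
  obtain X where "completion_rel X X" "x = abs_lcm_cstar X"
    by (metis Quotient_lcm_cstar Quotient_rep_reflp Quotient_abs_rep)
  then show ?thesis by (intro that[of X]) (auto intro: of_free_LIMSEQ_abs)
qed

instance lcm_cstar :: (right_lcm_semigroup) banach
proof
  fix F :: "nat \<Rightarrow> 'a lcm_cstar" assume F: "Cauchy F"
  have "\<exists>a. dist (of_free a) (F k) < inverse (real (Suc k))" for k
  proof -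
    obtain X where X: "(\<lambda>n. of_free (X n)) \<longlonglongrightarrow> F k" by (rule of_free_dense)
    show ?thesis using metric_LIMSEQ_D[OF X, of "inverse (real (Suc k))"] by auto
  qed
  then obtain a where a: "\<And>k. dist (of_free (a k)) (F k) < inverse (real (Suc k))" by metis
  have lim0: "(\<lambda>k. of_free (a k) - F k) \<longlonglongrightarrow> 0"
    by (rule tendsto_norm_zero_cancel, rule tendsto_le_zero[OF LIMSEQ_inverse_real_of_nat])
      (use a in \<open>auto simp: dist_norm intro: less_imp_le\<close>)
  have "Cauchy (\<lambda>k. of_free (a k))"
  proof (rule metric_CauchyI)
    fix e :: real assume e: "e > 0"
    obtain M where M: "\<forall>m\<ge>M. \<forall>n\<ge>M. dist (F m) (F n) < e / 3"
      using F e unfolding Cauchy_def by (meson divide_pos_pos zero_less_numeral)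
    obtain K where K: "\<forall>k\<ge>K. norm (of_free (a k) - F k) < e / 3"
      using LIMSEQ_D[OF lim0, of "e / 3"] e by auto
    have "dist (of_free (a m)) (of_free (a n)) < e" if "m \<ge> max M K" "n \<ge> max M K" for m n
    proof -
      have "dist (F m) (F n) < e / 3" "dist (of_free (a m)) (F m) < e / 3"
        "dist (of_free (a n)) (F n) < e / 3"
        using M K that by (auto simp: dist_norm)
      then show ?thesis
        using dist_triangle[of "of_free (a m)" "of_free (a n)" "F m"]
          dist_triangle[of "F m" "of_free (a n)" "F n"] dist_commute[of "of_free (a n)" "F n"]
        by linarith
    qed
    then show "\<exists>M. \<forall>m\<ge>M. \<forall>n\<ge>M. dist (of_free (a m)) (of_free (a n)) < e" by blast
  qed
  then have "free_Cauchy a"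
    unfolding free_Cauchy_def Cauchy_def dist_norm
    by (simp add: of_free_diff[symmetric] norm_of_free)
  then have "(\<lambda>k. of_free (a k) - (of_free (a k) - F k)) \<longlonglongrightarrow> abs_lcm_cstar a - 0"
    by (intro tendsto_diff of_free_LIMSEQ_abs lim0)
  then show "convergent F" by (auto simp: convergent_def)
qed

instantiation lcm_cstar :: (right_lcm_semigroup) unital_cstar_algebra
begin

lift_definition scaleC_lcm_cstar :: "complex \<Rightarrow> 'a lcm_cstar \<Rightarrow> 'a lcm_cstar"
  is "\<lambda>c X n. free_scale c (X n)" by (rule completion_rel_scale)
lift_definition star_lcm_cstar :: "'a lcm_cstar \<Rightarrow> 'a lcm_cstar"
  is "\<lambda>X n. free_star (X n)" by (rule completion_rel_star)

instance
proof
  fix x y z :: "'a lcm_cstar" and c d :: complex and r :: real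
  note C = free_Cauchy_add free_Cauchy_mult free_Cauchy_scale free_Cauchy_star
  note L = free_Cauchy_norm_lim
  show "c *\<^sub>C (x + y) = c *\<^sub>C x + c *\<^sub>C y"
    by transfer (auto intro!: C simp: free_scale_add)
  show "(c + d) *\<^sub>C x = c *\<^sub>C x + d *\<^sub>C x"
    by transfer (auto intro!: C simp: free_scale_add_left)
  show "c *\<^sub>C d *\<^sub>C x = (c * d) *\<^sub>C x"
    by transfer (auto intro!: C simp: free_scale_scale)
  show "c *\<^sub>C x * y = c *\<^sub>C (x * y)"
    by transfer (auto intro!: C simp: free_scale_mult_left)
  show "x * c *\<^sub>C y = c *\<^sub>C (x * y)"
    by transfer (auto intro!: C simp: free_scale_mult_right)
  show "r *\<^sub>R x = complex_of_real r *\<^sub>C x" by transfer (auto intro!: C)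
  show "norm (c *\<^sub>C x) = cmod c * norm x"
    by transfer (auto intro!: limI tendsto_mult L simp: univ_seminormD(2))
  show "star (x + y) = star x + star y" by transfer (auto intro!: C simp: free_star_add)
  show "star (c *\<^sub>C x) = cnj c *\<^sub>C star x" by transfer (auto intro!: C simp: free_star_scale)
  show "star (x * y) = star y * star x" by transfer (auto intro!: C simp: free_star_mult)
  show "star (star x) = x" by transfer simp
  show "norm (star x * x) = (norm x)\<^sup>2"
    by transfer (auto intro!: limI tendsto_power L simp: univ_seminormD(4))
qed

end

lemma of_free_star: "of_free (free_star x) = star (of_free x)"
  by (simp add: of_free_def star_lcm_cstar.abs_eq)

lemma of_free_scale: "of_free (free_scale c x) = c *\<^sub>C of_free x"
  by (simp add: of_free_def scaleC_lcm_cstar.abs_eq)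

definition lcm_gen :: "'a::right_lcm_semigroup \<Rightarrow> 'a lcm_cstar" where
  "lcm_gen s = of_free (fgen s)"

definition lcm_relations :: "('a::right_lcm_semigroup \<Rightarrow> 'b::unital_cstar_algebra) \<Rightarrow> bool" where
  "lcm_relations w \<longleftrightarrow>
     (\<forall>s. star (w s) * w s = 1) \<and> w 1 = 1 \<and> (\<forall>s t. w s * w t = w (s * t)) \<and>
     (\<forall>s t r. rideal s \<inter> rideal t = rideal r \<longrightarrow>
        w s * star (w s) * (w t * star (w t)) = w r * star (w r)) \<and>
     (\<forall>s t. rideal s \<inter> rideal t = {} \<longrightarrow> w s * star (w s) * (w t * star (w t)) = 0)"

lemma of_free_relator: "r \<in> lcm_relators \<Longrightarrow> of_free r = 0"
  using norm_of_free[of r] univ_seminormD(5)[of r] by simp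

lemma lcm_relations_gen: "lcm_relations (lcm_gen :: 'a::right_lcm_semigroup \<Rightarrow> 'a lcm_cstar)"
proof -
  have rel: "free_star (fgen s) * fgen s - 1 \<in> lcm_relators"
    "fgen s * fgen t - fgen (s * t) \<in> lcm_relators"
    "rideal s \<inter> rideal t = rideal r \<Longrightarrow> fproj s * fproj t - fproj r \<in> lcm_relators"
    "rideal s \<inter> rideal t = {} \<Longrightarrow> fproj s * fproj t \<in> lcm_relators" for s t r :: 'a
    unfolding lcm_relators_def by blast+
  have rel1: "fgen 1 - 1 \<in> (lcm_relators :: 'a free_alg set)"
    unfolding lcm_relators_def by blast
  have proj: "of_free (fproj s) = lcm_gen s * star (lcm_gen s)" for s :: 'a
    by (simp add: fproj_def lcm_gen_def of_free_mult of_free_star)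
  have eq: "of_free x = of_free y" if "x - y \<in> lcm_relators" for x y :: "'a free_alg"
    using of_free_relator[OF that] by (simp add: of_free_diff)
  have "star (lcm_gen s) * lcm_gen s = 1" for s :: 'a
    using eq[OF rel(1)[of s]] by (simp add: lcm_gen_def of_free_mult of_free_star of_free_one)
  moreover have "lcm_gen (1 :: 'a) = 1"
    using eq[OF rel1] by (simp add: lcm_gen_def of_free_one)
  moreover have "lcm_gen s * lcm_gen t = lcm_gen (s * t)" for s t :: 'a
    using eq[OF rel(2)[of s t]] by (simp add: lcm_gen_def of_free_mult)
  moreover have "of_free (fproj s) * of_free (fproj t) = of_free (fproj r)"
    if "rideal s \<inter> rideal t = rideal r" for s t r :: 'a
    using eq[OF rel(3)[OF that]] by (simp add: of_free_mult)
  moreover have "of_free (fproj s) * of_free (fproj t) = 0"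
    if "rideal s \<inter> rideal t = {}" for s t :: 'a
    using of_free_relator[OF rel(4)[OF that]] by (simp add: of_free_mult)
  ultimately show ?thesis unfolding lcm_relations_def proj by blast
qed

fun letter_eval :: "('a \<Rightarrow> 'b::unital_cstar_algebra) \<Rightarrow> 'a letter \<Rightarrow> 'b" where
  "letter_eval w (Gen s) = w s"
| "letter_eval w (GenStar s) = star (w s)"

fun word_eval :: "('a \<Rightarrow> 'b::unital_cstar_algebra) \<Rightarrow> 'a gword \<Rightarrow> 'b" where
  "word_eval w (GWord ls) = prod_list (map (letter_eval w) ls)"

definition free_eval :: "('a \<Rightarrow> 'b::unital_cstar_algebra) \<Rightarrow> 'a free_alg \<Rightarrow> 'b" where
  "free_eval w x = (\<Sum>k\<in>Poly_Mapping.keys x. Poly_Mapping.lookup x k *\<^sub>C word_eval w k)"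

lemma scaleC_zero [simp]: "0 *\<^sub>C x = 0" "c *\<^sub>C (0 :: 'b) = 0"
  for x :: "'b::unital_cstar_algebra"
  using norm_scaleC[of 0 x] norm_scaleC[of c "0::'b"] by simp_all

lemma scaleC_one [simp]: "1 *\<^sub>C x = x" for x :: "'b::unital_cstar_algebra"
  using scaleR_scaleC[of 1 x] by simp

lemma star_zero [simp]: "star (0 :: 'b::unital_cstar_algebra) = 0"
  using star_scaleC[of 0 "0::'b"] by simp

lemma star_one [simp]: "star (1 :: 'b::unital_cstar_algebra) = 1"
  using star_mult[of "star 1" "1 :: 'b"] by (simp add: star_star)

lemma norm_star [simp]: "norm (star x) = norm x" for x :: "'b::unital_cstar_algebra"
proof -
  have *: "norm y \<le> norm (star y)" for y :: 'b
  proof (cases "norm y = 0")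
    case False
    have "norm y * norm y \<le> norm (star y) * norm y"
      using norm_mult_ineq[of "star y" y] by (simp add: cstar_identity power2_eq_square)
    then show ?thesis using False by simp
  qed simp
  show ?thesis using *[of x] *[of "star x"] by (simp add: star_star)
qed

lemma bounded_linear_star: "bounded_linear (star :: 'b::unital_cstar_algebra \<Rightarrow> 'b)"
  by (rule bounded_linear_intro[where K = 1]) (simp_all add: star_add scaleR_scaleC star_scaleC)

lemma bounded_linear_scaleC: "bounded_linear (scaleC c :: 'b::unital_cstar_algebra \<Rightarrow> 'b)"
  by (rule bounded_linear_intro[where K = "cmod c"])
    (simp_all add: scaleC_add_right scaleR_scaleC scaleC_scaleC norm_scaleC mult.commute)

lemma free_eval_single [simp]: "free_eval w (Poly_Mapping.single k c) = c *\<^sub>C word_eval w k"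
  by (cases "c = 0") (simp_all add: free_eval_def)

lemma free_eval_add: "free_eval w (x + y) = free_eval w x + free_eval w y"
proof -
  let ?K = "Poly_Mapping.keys x \<union> Poly_Mapping.keys y"
  have "free_eval w z = (\<Sum>k\<in>?K. Poly_Mapping.lookup z k *\<^sub>C word_eval w k)"
    if "Poly_Mapping.keys z \<subseteq> ?K" for z
    unfolding free_eval_def
    by (rule sum.mono_neutral_left) (use that in \<open>auto simp: in_keys_iff\<close>)
  then show ?thesis
    using Poly_Mapping.keys_add[of x y]
    by (simp add: lookup_add scaleC_add_left sum.distrib)
qed

lemma word_eval_add: "word_eval w (k + l) = word_eval w k * word_eval w l"
  by (cases k; cases l) simp

lemma word_eval_star: "word_eval w (word_star k) = star (word_eval w k)"
proof -
  have "letter_eval w (letter_star l) = star (letter_eval w l)" for l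
    by (cases l) (simp_all add: star_star)
  then have "prod_list (map (letter_eval w) (rev (map letter_star ls))) =
      star (prod_list (map (letter_eval w) ls))" for ls
    by (induction ls) (simp_all add: star_mult)
  then show ?thesis by (cases k) simp
qed

lemma free_eval_one [simp]: "free_eval w (1 :: 'a free_alg) = 1"
proof -
  have "(1 :: 'a free_alg) = Poly_Mapping.single (GWord []) 1"
    by (simp add: single_one flip: zero_gword_def)
  then have "free_eval w (1 :: 'a free_alg) = 1 *\<^sub>C word_eval w (GWord [])"
    by (metis free_eval_single)
  then show ?thesis by simp
qed

lemma free_eval_scale: "free_eval w (free_scale c x) = c *\<^sub>C free_eval w x"
  by (induction x rule: free_alg_induct)
    (simp_all add: free_scale_add free_eval_add scaleC_add_right scaleC_scaleC)

lemma free_eval_mult: "free_eval w (x * y) = free_eval w x * free_eval w y"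
proof (induction x rule: free_alg_induct)
  case (single k c)
  show ?case
    by (induction y rule: free_alg_induct)
      (simp_all add: mult_single word_eval_add ring_distribs free_eval_add mult_scaleC_left
        mult_scaleC_right scaleC_scaleC mult.commute)
qed (simp add: ring_distribs free_eval_add)

lemma free_eval_star: "free_eval w (free_star x) = star (free_eval w x)"
  by (induction x rule: free_alg_induct)
    (simp_all add: free_star_add free_eval_add star_add star_scaleC word_eval_star)

lemma free_eval_diff: "free_eval w (x - y) = free_eval w x - free_eval w y"
  using free_eval_add[of w "x - y" y] by simp

lemma free_eval_gen [simp]: "free_eval w (fgen s) = w s"
  by (simp add: fgen_def)

lemma free_eval_relator:
  assumes "lcm_relations w" "r \<in> lcm_relators" shows "free_eval w r = 0"
proof -
  have "free_eval w (fproj s) = w s * star (w s)" for s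
    by (simp add: fproj_def free_eval_mult free_eval_star)
  then show ?thesis using assms
    unfolding lcm_relators_def lcm_relations_def
    by (auto simp: free_eval_diff free_eval_mult free_eval_star)
qed

lemma lcm_seminorm_eval:
  assumes "lcm_relations w" shows "lcm_seminorm (\<lambda>x. norm (free_eval w x))"
  unfolding lcm_seminorm_def
  by (auto simp: free_eval_add free_eval_scale free_eval_mult free_eval_star norm_scaleC
      cstar_identity free_eval_relator[OF assms] norm_triangle_ineq norm_mult_ineq)

lemma star_homD:
  assumes "star_hom f"
  shows "f (x + y) = f x + f y" "f (c *\<^sub>C x) = c *\<^sub>C f x" "f (x * y) = f x * f y" "f 1 = 1"
    "f (star x) = star (f x)"
  using assms unfolding star_hom_def by blast+

lemma star_hom_of_free:
  assumes f: "star_hom f" shows "f (of_free x) = free_eval (\<lambda>s. f (lcm_gen s)) x"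
proof (induction x rule: free_alg_induct)
  case (single k c)
  have letter: "f (of_free (Poly_Mapping.single (GWord [l]) 1)) = letter_eval (\<lambda>s. f (lcm_gen s)) l" for l
  proof (cases l)
    case (GenStar s)
    then have "Poly_Mapping.single (GWord [l]) 1 = free_star (fgen s)" by (simp add: fgen_def)
    then show ?thesis using GenStar by (simp add: of_free_star star_homD[OF f] lcm_gen_def)
  qed (simp add: lcm_gen_def fgen_def)
  have word: "f (of_free (Poly_Mapping.single (GWord ls) 1)) =
      word_eval (\<lambda>s. f (lcm_gen s)) (GWord ls)" for ls
  proof (induction ls)
    case Nil
    show ?case
      by (simp flip: zero_gword_def add: of_free_one star_homD[OF f])
        (simp add: zero_gword_def)
  next
    case (Cons l ls)
    have "Poly_Mapping.single (GWord (l # ls)) (1::complex) =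
        Poly_Mapping.single (GWord [l]) 1 * Poly_Mapping.single (GWord ls) 1"
      by (simp add: mult_single)
    then show ?case using Cons letter[of l] by (simp add: of_free_mult star_homD[OF f])
  qed
  have "Poly_Mapping.single k c = free_scale c (Poly_Mapping.single k 1)" by simp
  then show ?case using word
    by (cases k) (metis free_eval_scale free_eval_single of_free_scale star_homD(2)[OF f] scaleC_one)
qed (simp add: of_free_add free_eval_add star_homD[OF f])

lemma lcm_cstar_universal:
  fixes w :: "'a::right_lcm_semigroup \<Rightarrow> 'b::unital_cstar_algebra"
  assumes w: "lcm_relations w"
  shows "\<exists>!f. star_hom f \<and> continuous_on UNIV f \<and> (\<forall>s. f (lcm_gen s) = w s)"
proof -
  have le: "norm (free_eval w x) \<le> univ_seminorm x" for x
    using univ_seminorm_upper[OF lcm_seminorm_eval[OF w]] .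
  have le': "norm (free_eval w x - free_eval w y) \<le> norm (of_free x - of_free y)" for x y
    using le[of "x - y"] by (simp add: free_eval_diff of_free_diff[symmetric] norm_of_free)
  have conv: "convergent (\<lambda>n. free_eval w (X n))" if X: "(\<lambda>n. of_free (X n)) \<longlonglongrightarrow> x" for X x
  proof (rule Cauchy_convergent, rule metric_CauchyI)
    fix e :: real assume "e > 0"
    then obtain M where M: "\<forall>m\<ge>M. \<forall>n\<ge>M. dist (of_free (X m)) (of_free (X n)) < e"
      using LIMSEQ_imp_Cauchy[OF X] unfolding Cauchy_def by blast
    have "dist (free_eval w (X m)) (free_eval w (X n)) < e" if "m \<ge> M" "n \<ge> M" for m n
      using M that le'[of "X m" "X n"] unfolding dist_norm by (meson le_less_trans)
    then show "\<exists>M. \<forall>m\<ge>M. \<forall>n\<ge>M. dist (free_eval w (X m)) (free_eval w (X n)) < e" by blast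
  qed
  define R where "R x = (SOME X. (\<lambda>n. of_free (X n)) \<longlonglongrightarrow> x)" for x :: "'a lcm_cstar"
  have R: "(\<lambda>n. of_free (R x n)) \<longlonglongrightarrow> x" for x
  proof -
    obtain X where "(\<lambda>n. of_free (X n)) \<longlonglongrightarrow> x" by (rule of_free_dense)
    then show ?thesis
      unfolding R_def by (rule someI[where P = "\<lambda>X. (\<lambda>n. of_free (X n)) \<longlonglongrightarrow> x"])
  qed
  define f where "f x = lim (\<lambda>n. free_eval w (R x n))" for x
  have fR: "(\<lambda>n. free_eval w (R x n)) \<longlonglongrightarrow> f x" for x
    using conv[OF R] unfolding f_def by (simp add: convergent_LIMSEQ_iff)
  have lim: "(\<lambda>n. free_eval w (X n)) \<longlonglongrightarrow> f x" if X: "(\<lambda>n. of_free (X n)) \<longlonglongrightarrow> x" for X x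
  proof -
    have "(\<lambda>n. of_free (X n) - of_free (R x n)) \<longlonglongrightarrow> x - x" by (intro tendsto_diff X R)
    then have "(\<lambda>n. norm (of_free (X n) - of_free (R x n))) \<longlonglongrightarrow> 0"
      by (simp add: tendsto_norm_zero)
    then have "(\<lambda>n. norm (free_eval w (X n) - free_eval w (R x n))) \<longlonglongrightarrow> 0"
      by (rule tendsto_le_zero) (auto simp: le')
    then have "(\<lambda>n. free_eval w (X n) - free_eval w (R x n)) \<longlonglongrightarrow> 0"
      by (rule tendsto_norm_zero_cancel)
    then have "(\<lambda>n. free_eval w (X n) - free_eval w (R x n) + free_eval w (R x n)) \<longlonglongrightarrow> 0 + f x"
      by (intro tendsto_add fR)
    then show ?thesis by simp
  qed
  have f_eqI: "f x = a" if "(\<lambda>n. of_free (X n)) \<longlonglongrightarrow> x" "(\<lambda>n. free_eval w (X n)) \<longlonglongrightarrow> a" for x a X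
    using LIMSEQ_unique[OF lim[OF that(1)] that(2)] .
  have f_free: "f (of_free x) = free_eval w x" for x
    by (rule f_eqI[of "\<lambda>_. x"]) auto
  note bl = bounded_linear.tendsto[OF bounded_linear_scaleC] bounded_linear.tendsto[OF bounded_linear_star]
  have hom: "star_hom f"
    unfolding star_hom_def
  proof (intro conjI allI)
    show "f (x + y) = f x + f y" for x y
      by (rule f_eqI[of "\<lambda>n. R x n + R y n"])
        (auto simp: of_free_add free_eval_add intro!: tendsto_add R fR)
    show "f (c *\<^sub>C x) = c *\<^sub>C f x" for c x
      by (rule f_eqI[of "\<lambda>n. free_scale c (R x n)"])
        (auto simp: of_free_scale free_eval_scale intro!: bl R fR)
    show "f (x * y) = f x * f y" for x y
      by (rule f_eqI[of "\<lambda>n. R x n * R y n"])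
        (auto simp: of_free_mult free_eval_mult intro!: tendsto_mult R fR)
    show "f (star x) = star (f x)" for x
      by (rule f_eqI[of "\<lambda>n. free_star (R x n)"])
        (auto simp: of_free_star free_eval_star intro!: bl R fR)
    show "f 1 = 1" using f_free[of 1] by (simp add: of_free_one)
  qed
  have bound: "norm (f x) \<le> norm x" for x
  proof (rule LIMSEQ_le[OF tendsto_norm[OF fR] tendsto_norm[OF R]])
    have "norm (free_eval w (R x n)) \<le> norm (of_free (R x n))" for n
      unfolding norm_of_free by (rule le)
    then show "\<exists>N. \<forall>n\<ge>N. norm (free_eval w (R x n)) \<le> norm (of_free (R x n))"
      by blast
  qed
  have "bounded_linear f"
  proof (rule bounded_linear_intro[where K = 1])
    show "f (x + y) = f x + f y" for x y by (rule star_homD(1)[OF hom])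
    show "f (r *\<^sub>R x) = r *\<^sub>R f x" for r x
      unfolding scaleR_scaleC by (rule star_homD(2)[OF hom])
    show "norm (f x) \<le> norm x * 1" for x using bound[of x] by simp
  qed
  then have cont: "continuous_on UNIV f" by (rule bounded_linear.continuous_on) simp
  show ?thesis
  proof (rule ex1I[of _ f])
    show "star_hom f \<and> continuous_on UNIV f \<and> (\<forall>s. f (lcm_gen s) = w s)"
      using hom cont by (simp add: lcm_gen_def f_free)
  next
    fix g assume g: "star_hom g \<and> continuous_on UNIV g \<and> (\<forall>s. g (lcm_gen s) = w s)"
    show "g = f"
    proof
      fix x
      have "(\<lambda>n. g (of_free (R x n))) \<longlonglongrightarrow> g x"
        using g R continuous_on_tendsto_compose[of UNIV g "\<lambda>n. of_free (R x n)" x sequentially]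
        by simp
      moreover have "g (of_free (R x n)) = free_eval w (R x n)" for n
        using g star_hom_of_free[of g] by simp
      ultimately show "g x = f x" using LIMSEQ_unique[OF _ fR[of x]] by simp
    qed
  qed
qed

text \<open>The automorphism \<open>\<sigma>\<^sup>N\<^sub>t\<close>. Continuity is automatic for *-homomorphisms; it is listed
  so that uniqueness is the uniqueness part of the universal property above.\<close>

definition lcm_dynamics ::
    "('a::right_lcm_semigroup \<Rightarrow> real) \<Rightarrow> real \<Rightarrow> 'a lcm_cstar \<Rightarrow> 'a lcm_cstar" where
  "lcm_dynamics N t = (THE f. star_hom f \<and> continuous_on UNIV f \<and>
     (\<forall>s. f (lcm_gen s) = (complex_of_real (N s) powr (\<i> * complex_of_real t)) *\<^sub>C lcm_gen s))"

lemma lcm_dynamics: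
  assumes N: "scale N"
  shows "star_hom (lcm_dynamics N t)" "continuous_on UNIV (lcm_dynamics N t)"
    "lcm_dynamics N t (lcm_gen s) = (complex_of_real (N s) powr (\<i> * complex_of_real t)) *\<^sub>C lcm_gen s"
proof -
  define a where "a s = complex_of_real (N s) powr (\<i> * complex_of_real t)" for s
  have N1: "N s \<ge> 1" "N (s * s') = N s * N s'" for s s' using N by (auto simp: scale_def)
  have pos: "N s > 0" for s using N1(1)[of s] by linarith
  have "N 1 * N 1 = N 1" using N1(2)[of 1 1] by simp
  then have "N 1 = 1" using pos[of 1] by simp
  then have a1: "a 1 = 1" by (simp add: a_def)
  have am: "a (s * s') = a s * a s'" for s s'
    unfolding a_def using pos
    by (simp add: N1(2) powr_times_real less_imp_le)
  have cm: "cmod (a s) = 1" for s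
    unfolding a_def using pos[of s] by (simp add: norm_powr_real_powr)
  have ca: "cnj (a s) * a s = 1" "a s * cnj (a s) = 1" for s
    using cm[of s] complex_norm_square[of "a s"] by (simp_all add: mult.commute)
  have pr: "a s *\<^sub>C lcm_gen s * star (a s *\<^sub>C lcm_gen s) = lcm_gen s * star (lcm_gen s)" for s
    by (simp add: star_scaleC mult_scaleC_left mult_scaleC_right scaleC_scaleC ca)
  have "lcm_relations (\<lambda>s. a s *\<^sub>C lcm_gen s)"
    using lcm_relations_gen unfolding lcm_relations_def pr
    by (auto simp: star_scaleC mult_scaleC_left mult_scaleC_right scaleC_scaleC ca a1 am mult.commute)
  from theI'[OF lcm_cstar_universal[OF this]]
  show "star_hom (lcm_dynamics N t)" "continuous_on UNIV (lcm_dynamics N t)"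
    "lcm_dynamics N t (lcm_gen s) = (complex_of_real (N s) powr (\<i> * complex_of_real t)) *\<^sub>C lcm_gen s"
    unfolding lcm_dynamics_def a_def by auto
qed


text \<open>\<open>entire_extension \<sigma> a f\<close>: the element \<open>a\<close> is \<open>\<sigma>\<close>-analytic, with \<open>f z\<close> as the value
  \<open>\<sigma>\<^sub>z a\<close>; \<open>f\<close> is unique by the identity theorem.\<close>

definition entire_extension ::
    "(real \<Rightarrow> 'b::unital_cstar_algebra \<Rightarrow> 'b) \<Rightarrow> 'b \<Rightarrow> (complex \<Rightarrow> 'b) \<Rightarrow> bool" where
  "entire_extension \<sigma> a f \<longleftrightarrow>
     (\<forall>z. \<exists>d. ((\<lambda>w. inverse (w - z) *\<^sub>C (f w - f z)) \<longlongrightarrow> d) (at z)) \<and>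
     (\<forall>t. f (complex_of_real t) = \<sigma> t a)"

text \<open>As in Bratteli and Robinson, the dense subspace of analytic elements on which the KMS
  condition is tested is required to be invariant under the dynamics. Without invariance the
  subspace need not be a core for \<open>\<sigma>\<^sub>i\<^sub>\<beta>\<close>, and the condition would be too weak.\<close>

definition kms_state ::
    "(real \<Rightarrow> 'b::unital_cstar_algebra \<Rightarrow> 'b) \<Rightarrow> real \<Rightarrow> ('b \<Rightarrow> complex) \<Rightarrow> bool" where
  "kms_state \<sigma> \<beta> \<phi> \<longleftrightarrow> cstar_state \<phi> \<and>
     (\<exists>D. 0 \<in> D \<and> (\<forall>a\<in>D. \<forall>b\<in>D. a + b \<in> D) \<and> (\<forall>c. \<forall>a\<in>D. c *\<^sub>C a \<in> D) \<and>
        closure D = UNIV \<and> (\<forall>t. \<forall>a\<in>D. \<sigma> t a \<in> D) \<and>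
        (\<forall>a\<in>D. \<exists>f. entire_extension \<sigma> a f \<and>
           (\<forall>b\<in>D. \<phi> (a * b) = \<phi> (b * f (\<i> * complex_of_real \<beta>)))))"

subsection \<open>The semilattice of idempotents and its spectrum\<close>

text \<open>Partial bijections of \<open>S\<close> are maps of type \<^typ>\<open>'a \<Rightarrow> 'a option\<close>, composed by \<open>\<circ>\<^sub>m\<close>.\<close>

definition left_mult :: "'a::right_lcm_semigroup \<Rightarrow> ('a \<rightharpoonup> 'a)" where
  "left_mult s = (\<lambda>t. Some (s * t))"

definition partial_inv :: "('a \<rightharpoonup> 'a) \<Rightarrow> ('a \<rightharpoonup> 'a)" where
  "partial_inv f = (\<lambda>y. if \<exists>x. f x = Some y then Some (THE x. f x = Some y) else None)"

definition idem :: "'a::right_lcm_semigroup \<Rightarrow> ('a \<rightharpoonup> 'a)" where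
  "idem s = left_mult s \<circ>\<^sub>m partial_inv (left_mult s)"

definition idem_lattice :: "('a::right_lcm_semigroup \<rightharpoonup> 'a) set" where
  "idem_lattice = range idem \<union> {Map.empty}"

definition spectrum :: "(('a::right_lcm_semigroup \<rightharpoonup> 'a) \<Rightarrow> nat) set" where
  "spectrum = {\<xi> \<in> idem_lattice \<rightarrow>\<^sub>E {0, 1}.
     (\<forall>e\<in>idem_lattice. \<forall>f\<in>idem_lattice. \<xi> (e \<circ>\<^sub>m f) = \<xi> e * \<xi> f) \<and>
     \<xi> Map.empty = 0 \<and> (\<exists>e\<in>idem_lattice. \<xi> e \<noteq> 0)}"

definition spectrum_topology :: "(('a::right_lcm_semigroup \<rightharpoonup> 'a) \<Rightarrow> nat) topology" where
  "spectrum_topology =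
     subtopology (product_topology (\<lambda>_. discrete_topology {0, 1}) idem_lattice) spectrum"

definition spectrum_borel :: "(('a::right_lcm_semigroup \<rightharpoonup> 'a) \<Rightarrow> nat) measure" where
  "spectrum_borel = sigma spectrum {U. openin spectrum_topology U}"

definition spectrum_act ::
    "'a::right_lcm_semigroup \<Rightarrow> (('a \<rightharpoonup> 'a) \<Rightarrow> nat) \<Rightarrow> (('a \<rightharpoonup> 'a) \<Rightarrow> nat)" where
  "spectrum_act s \<xi> =
     (\<lambda>e\<in>idem_lattice. \<xi> (partial_inv (left_mult s) \<circ>\<^sub>m e \<circ>\<^sub>m left_mult s))"

definition cylinder :: "'a::right_lcm_semigroup \<Rightarrow> (('a \<rightharpoonup> 'a) \<Rightarrow> nat) set" where
  "cylinder s = {\<xi> \<in> spectrum. \<xi> (idem s) = 1}"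

definition cylinder_diff ::
    "'a::right_lcm_semigroup \<Rightarrow> 'a set \<Rightarrow> (('a \<rightharpoonup> 'a) \<Rightarrow> nat) set" where
  "cylinder_diff s F = cylinder s - (\<Union>t\<in>F. cylinder t)"

definition scaling_measure ::
    "('a::right_lcm_semigroup \<Rightarrow> real) \<Rightarrow> real \<Rightarrow> (('a \<rightharpoonup> 'a) \<Rightarrow> nat) measure \<Rightarrow> bool" where
  "scaling_measure N \<beta> \<mu> \<longleftrightarrow>
     prob_space \<mu> \<and> space \<mu> = spectrum \<and> sets \<mu> = sets spectrum_borel \<and>
     (\<forall>A \<in> sets spectrum_borel. \<forall>s.
        measure \<mu> (spectrum_act s ` A) = N s powr (- \<beta>) * measure \<mu> A)"

subsection \<open>The quotient by the kernel of the scale\<close>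

definition scale_rel :: "('a::right_lcm_semigroup \<Rightarrow> real) \<Rightarrow> ('a \<times> 'a) set" where
  "scale_rel N = {(s, t). \<exists>a\<in>ker_scale N. \<exists>b\<in>ker_scale N. s * a = t * b}"

definition scale_quot :: "('a::right_lcm_semigroup \<Rightarrow> real) \<Rightarrow> 'a set set" where
  "scale_quot N = UNIV // scale_rel N"

definition scale_class :: "('a::right_lcm_semigroup \<Rightarrow> real) \<Rightarrow> 'a \<Rightarrow> 'a set" where
  "scale_class N s = scale_rel N `` {s}"

definition class_le :: "('a::right_lcm_semigroup \<Rightarrow> real) \<Rightarrow> 'a set \<Rightarrow> 'a set \<Rightarrow> bool" where
  "class_le N C D \<longleftrightarrow>
     (\<exists>s t t'. C = scale_class N s \<and> D = scale_class N t \<and>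
        rideal s \<inter> rideal t = rideal t' \<and> (t', t) \<in> scale_rel N)"

definition class_lub ::
    "('a::right_lcm_semigroup \<Rightarrow> real) \<Rightarrow> 'a set set \<Rightarrow> 'a set \<Rightarrow> bool" where
  "class_lub N K Q \<longleftrightarrow> Q \<in> scale_quot N \<and> (\<forall>C\<in>K. class_le N C Q) \<and>
     (\<forall>R\<in>scale_quot N. (\<forall>C\<in>K. class_le N C R) \<longrightarrow> class_le N Q R)"

text \<open>A representative \<open>q\<^sub>K\<close> of the join of \<open>K\<close>, with \<^const>\<open>None\<close> for \<open>\<infinity>\<close>.\<close>

definition join_rep :: "('a::right_lcm_semigroup \<Rightarrow> real) \<Rightarrow> 'a set set \<Rightarrow> 'a option" where
  "join_rep N K =
     (if \<exists>Q. class_lub N K Q then Some (SOME q. class_lub N K (scale_class N q)) else None)"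

definition scale_powr ::
    "('a::right_lcm_semigroup \<Rightarrow> real) \<Rightarrow> real \<Rightarrow> 'a option \<Rightarrow> real" where
  "scale_powr N \<beta> q = (case q of None \<Rightarrow> 0 | Some t \<Rightarrow> N t powr (- \<beta>))"

definition incl_excl ::
    "('a::right_lcm_semigroup \<Rightarrow> real) \<Rightarrow> real \<Rightarrow> 'a \<Rightarrow> 'a set set \<Rightarrow> real" where
  "incl_excl N \<beta> s G =
     N s powr (- \<beta>) + (\<Sum>K | K \<subseteq> G \<and> K \<noteq> {}. (-1) ^ card K * scale_powr N \<beta> (join_rep N K))"

end

(*
  The cylinders Z_s are closed under intersection up to the empty set and generate the Borel sets,
  and scaling forces mu(Z_s) = N(s)^-beta; this gives uniqueness, and the formula is inclusion-exclusion.
  Conversely, the numbers N(q)^-beta prescribed for the finite intersections of cylinders are the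
  joint probabilities of events on {0,1}^S as soon as all the alternating sums in the formula are
  nonnegative, and by the Daniell-Kolmogorov theorem such events exist. They almost surely form a
  filter of principal right ideals, that is, a character. Left translation reduces the sums for
  general s to s = e.

  A KMS state satisfies phi(v_s v_s^* ) = N(s)^-beta, and the alternating sums are its values on
  the projections prod_t (1 - v_t v_t^* ). In the other direction, S acts on the spectrum by
  partial injections, hence by isometries on l^2 of the spectrum regarded as a discrete set, and
  integrating the vector states of the point masses delta_chi against mu gives a KMS state: a word
  w in the v_s and v_s^* has the value mu {chi. w chi = chi}.
*)

theory Submission
  imports Defs "HOL-Complex_Analysis.Complex_Analysis"
begin

section \<open>Alternating sums\<close>

text \<open>The sums in the formula run over sets of classes, while inclusion-exclusion for
  cylinders runs over sets of elements. An alternating sum does not notice that its family is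
  replaced by a non-injective image, as long as the summand depends only on the image: the surplus
  terms cancel. The quotient therefore enters only through the identification of its joins with
  meets of ideals; measures and states are handled with \<open>meet_weight\<close> on finite subsets
  of S.

  Two obstacles shape the operator-algebraic half. The KMS condition is given on some dense
  invariant subspace that may miss the generators, so the relation for \<open>v_s\<close> is
  recovered by a growth argument on the strip 0 \<le> Im z \<le> \<beta>. Conversely, the universal
  norm is a supremum of seminorms, so a functional on words extends to a state once its GNS operator
  norm is seen to be one of them; that norm is computed on the free algebra itself, without a
  Hilbert space.

  Countability of S lets almost sure statements hold for all pairs of ideals at once and gives the
  topology a countable base.\<close>

definition alt_sum :: "('b set \<Rightarrow> 'c::real_vector) \<Rightarrow> 'b set \<Rightarrow> 'c" where
  "alt_sum h F = (\<Sum>A\<in>Pow F. (- 1) ^ card A *\<^sub>R h A)"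

lemma alt_sum_empty [simp]: "alt_sum h {} = h {}"
  by (simp add: alt_sum_def)

lemma alt_sum_cong:
  assumes "\<And>A. A \<subseteq> F \<Longrightarrow> h A = h' A" shows "alt_sum h F = alt_sum h' F"
  unfolding alt_sum_def using assms by (intro sum.cong) auto

lemma alt_sum_insert_new:
  assumes "finite F" "x \<notin> F"
  shows "alt_sum h (insert x F) = alt_sum h F - alt_sum (\<lambda>A. h (insert x A)) F"
proof -
  have inj: "inj_on (insert x) (Pow F)"
    using assms(2) unfolding inj_on_def by (metis PowD insert_ident subsetD)
  have card: "card (insert x A) = Suc (card A)" if "A \<in> Pow F" for A
    using that assms by (metis PowD card_insert_disjoint rev_finite_subset subsetD)
  have "alt_sum h (insert x F) =
      alt_sum h F + (\<Sum>A\<in>insert x ` Pow F. (- 1) ^ card A *\<^sub>R h A)"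
    unfolding alt_sum_def Pow_insert by (rule sum.union_disjoint) (use assms in auto)
  also have "(\<Sum>A\<in>insert x ` Pow F. (- 1) ^ card A *\<^sub>R h A) =
      - alt_sum (\<lambda>A. h (insert x A)) F"
    unfolding alt_sum_def sum.reindex[OF inj] o_def sum_negf[symmetric]
    by (rule sum.cong) (simp_all add: card)
  finally show ?thesis by simp
qed

text \<open>If \<open>x\<close> lies in \<open>F\<close>, the terms of \<open>A\<close> and \<open>A \<triangle> {x}\<close> cancel.\<close>

lemma alt_sum_absorb:
  assumes "finite F" "x \<in> F"
  shows "alt_sum (\<lambda>A. h (insert x A)) F = 0"
proof -
  obtain F' where F: "F = insert x F'" "x \<notin> F'"
    using assms(2) by (meson mk_disjoint_insert)
  then show ?thesis
    using assms(1) alt_sum_insert_new[of F' x "\<lambda>A. h (insert x A)"] by simp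
qed

text \<open>For x in F the subtracted sum vanishes by \<open>alt_sum_absorb\<close>, so the
  recursion holds without a freshness hypothesis. This is what makes it usable for images, where
  inserted points may repeat.\<close>

lemma alt_sum_insert:
  assumes "finite F"
  shows "alt_sum h (insert x F) = alt_sum h F - alt_sum (\<lambda>A. h (insert x A)) F"
  using assms by (cases "x \<in> F") (simp_all add: insert_absorb alt_sum_absorb alt_sum_insert_new)

text \<open>A collision under f costs nothing, because \<open>alt_sum_insert\<close> on the right
  also covers points already present. The induction varies h, since each step replaces it by
  \<open>h (insert (f x) _)\<close>.\<close>

lemma alt_sum_image:
  assumes "finite F"
  shows "alt_sum (\<lambda>A. h (f ` A)) F = alt_sum h (f ` F)"
  using assms
proof (induction F arbitrary: h rule: finite_induct)
  case (insert x F)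
  show ?case
    using insert.IH[of h] insert.IH[of "\<lambda>A. h (insert (f x) A)"] insert.hyps(1)
    by (simp add: alt_sum_insert)
qed simp

text \<open>Z is kept arbitrary because removing \<open>B x\<close> subtracts the same expression
  for \<open>Z \<inter> B x\<close>, matching the recursion of
  \<open>alt_sum_insert\<close>.\<close>

lemma (in finite_measure) measure_Diff_UN:
  assumes "finite F" "Z \<in> sets M" "\<And>t. t \<in> F \<Longrightarrow> B t \<in> sets M"
  shows "measure M (Z - (\<Union>t\<in>F. B t)) = alt_sum (\<lambda>A. measure M (Z \<inter> (\<Inter>t\<in>A. B t))) F"
  using assms
proof (induction F arbitrary: Z rule: finite_induct)
  case (insert x F)
  have Zx: "Z \<inter> B x \<in> sets M" and UF: "(\<Union>t\<in>F. B t) \<in> sets M"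
    using insert by auto
  have "Z - (\<Union>t\<in>insert x F. B t) = (Z - (\<Union>t\<in>F. B t)) - (Z \<inter> B x - (\<Union>t\<in>F. B t))"
    by auto
  then have "measure M (Z - (\<Union>t\<in>insert x F. B t)) =
      measure M (Z - (\<Union>t\<in>F. B t)) - measure M (Z \<inter> B x - (\<Union>t\<in>F. B t))"
    using finite_measure_Diff[of "Z - (\<Union>t\<in>F. B t)" "Z \<inter> B x - (\<Union>t\<in>F. B t)"]
      insert.prems UF Zx by auto
  also have "\<dots> = alt_sum (\<lambda>A. measure M (Z \<inter> (\<Inter>t\<in>A. B t))) F -
      alt_sum (\<lambda>A. measure M (Z \<inter> B x \<inter> (\<Inter>t\<in>A. B t))) F"
    using insert.IH[of Z] insert.IH[of "Z \<inter> B x"] insert.prems Zx by simp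
  also have "\<dots> = alt_sum (\<lambda>A. measure M (Z \<inter> (\<Inter>t\<in>A. B t))) (insert x F)"
    using insert.hyps(1) by (simp add: alt_sum_insert Int_assoc)
  finally show ?case .
qed simp

section \<open>Events with prescribed joint probabilities\<close>

definition pattern_weight :: "('i set \<Rightarrow> real) \<Rightarrow> 'i set \<Rightarrow> 'i set \<Rightarrow> real" where
  "pattern_weight \<Phi> J A = (if A \<subseteq> J then alt_sum (\<lambda>K. \<Phi> (A \<union> K)) (J - A) else 0)"

text \<open>\<open>pattern_weight \<Phi> J A\<close> is the inclusion-exclusion value for the
  probability that, among the events of J, exactly those of A occur. A further index x splits this
  according to whether x occurs, since the term subtracted in the sum over
  \<open>insert x (J - A)\<close> is the weight of \<open>insert x A\<close>.\<close>

lemma pattern_weight_split: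
  assumes "finite J" "x \<notin> J" "A \<subseteq> J"
  shows "pattern_weight \<Phi> (insert x J) A + pattern_weight \<Phi> (insert x J) (insert x A) =
    pattern_weight \<Phi> J A"
proof -
  have "x \<notin> A" "insert x J - A = insert x (J - A)" "insert x J - insert x A = J - A"
    using assms by auto
  then show ?thesis
    using assms by (simp add: pattern_weight_def alt_sum_insert subset_insertI2)
qed

text \<open>The hypotheses say that \<open>\<Phi> A\<close> can be the probability of \<open>\<Inter>i\<in>A. E i\<close>: by inclusion-exclusion
  the alternating sum is the probability of the event that all \<open>E i\<close> with \<open>i \<in> A\<close> and none
  of the \<open>E i\<close> with \<open>i \<in> B\<close> occur. These events form a projective family.\<close>

lemma events_with_joint_probabilities:
  fixes \<Phi> :: "'i set \<Rightarrow> real"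
  assumes one: "\<Phi> {} = 1"
    and pos: "\<And>A B. finite A \<Longrightarrow> finite B \<Longrightarrow> 0 \<le> alt_sum (\<lambda>K. \<Phi> (A \<union> K)) B"
  obtains M :: "('i \<Rightarrow> real) measure" and E where "prob_space M" "\<And>i. E i \<in> sets M"
    "\<And>A. finite A \<Longrightarrow> measure M {x \<in> space M. \<forall>i\<in>A. x \<in> E i} = \<Phi> A"
proof -
  define w where "w = pattern_weight \<Phi>"
  have w0: "0 \<le> w J A" if "finite J" for J A
    unfolding w_def pattern_weight_def using that finite_subset by (auto intro!: pos)
  have w_out: "w J A = 0" if "\<not> A \<subseteq> J" for J A
    using that by (simp add: w_def pattern_weight_def)
  have total: "(\<Sum>A\<in>Pow J. w J A) = 1" if "finite J" for J
    using that
  proof (induction J rule: finite_induct)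
    case empty
    then show ?case by (simp add: w_def pattern_weight_def one)
  next
    case (insert x J)
    have inj: "inj_on (insert x) (Pow J)"
      using insert.hyps(2) unfolding inj_on_def by (metis PowD insert_ident subsetD)
    have "(\<Sum>A\<in>Pow (insert x J). w (insert x J) A) =
        (\<Sum>A\<in>Pow J. w (insert x J) A) + (\<Sum>A\<in>insert x ` Pow J. w (insert x J) A)"
      unfolding Pow_insert by (rule sum.union_disjoint) (use insert in auto)
    also have "\<dots> = (\<Sum>A\<in>Pow J. w (insert x J) A + w (insert x J) (insert x A))"
      by (simp add: sum.reindex[OF inj] sum.distrib)
    also have "\<dots> = (\<Sum>A\<in>Pow J. w J A)"
      using insert.hyps by (intro sum.cong) (auto simp: w_def pattern_weight_split)
    finally show ?case using insert.IH by simp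
  qed
  define p where "p J = embed_pmf (w J)" for J
  have pmf_p: "pmf (p J) A = w J A" if J: "finite J" for J A
    unfolding p_def
  proof (rule pmf_embed_pmf)
    show "0 \<le> w J A" for A using w0[OF J] .
    have "(\<integral>\<^sup>+ A. ennreal (w J A) \<partial>count_space UNIV) =
        (\<integral>\<^sup>+ A. ennreal (w J A) \<partial>count_space (Pow J))"
      by (rule nn_integral_count_space_eq) (auto simp: w_out)
    also have "\<dots> = (\<Sum>A\<in>Pow J. ennreal (w J A))"
      using J by (simp add: nn_integral_count_space_finite)
    also have "\<dots> = 1" using total[OF J] w0[OF J] by simp
    finally show "(\<integral>\<^sup>+ A. ennreal (w J A) \<partial>count_space UNIV) = 1" .
  qed
  have set_p: "set_pmf (p J) \<subseteq> Pow J" if "finite J" for J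
  proof
    fix A assume "A \<in> set_pmf (p J)"
    then have "w J A \<noteq> 0" using pmf_p[OF that] by (simp add: set_pmf_iff)
    then show "A \<in> Pow J" using w_out by blast
  qed
  \<comment> \<open>Forgetting x merges the patterns A and \<open>insert x A\<close>, whose weights
    add up by \<open>pattern_weight_split\<close>. Intersecting with the support first discards sets
    not contained in \<open>insert x J\<close>.\<close>
  have step: "map_pmf (\<lambda>A. A \<inter> J) (p (insert x J)) = p J" if J: "finite J" "x \<notin> J" for J x
  proof (rule pmf_eqI)
    fix A
    have "pmf (map_pmf (\<lambda>A. A \<inter> J) (p (insert x J))) A =
        measure (p (insert x J)) ((\<lambda>A. A \<inter> J) -` {A})"
      by (simp add: pmf_map)
    also have "\<dots> = measure (p (insert x J)) ((\<lambda>A. A \<inter> J) -` {A} \<inter> set_pmf (p (insert x J)))"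
      by (simp add: measure_Int_set_pmf)
    also have "(\<lambda>A. A \<inter> J) -` {A} \<inter> set_pmf (p (insert x J)) =
        (if A \<subseteq> J then {A, insert x A} else {}) \<inter> set_pmf (p (insert x J))"
      (is "?L = ?R")
    proof (rule set_eqI)
      fix B
      show "B \<in> ?L \<longleftrightarrow> B \<in> ?R"
      proof (cases "B \<in> set_pmf (p (insert x J))")
        case True
        then have "B \<subseteq> insert x J" using set_p[of "insert x J"] J(1) by blast
        then have "B \<inter> J = A \<longleftrightarrow> A \<subseteq> J \<and> (B = A \<or> B = insert x A)"
          using J(2) by blast
        then show ?thesis using True by simp
      qed simp
    qed
    also have "measure (p (insert x J)) \<dots> =
        measure (p (insert x J)) (if A \<subseteq> J then {A, insert x A} else {})"
      by (simp add: measure_Int_set_pmf)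
    also have "\<dots> = pmf (p J) A"
    proof (cases "A \<subseteq> J")
      case True
      then have "A \<noteq> insert x A" using J by auto
      then show ?thesis using True J
        by (simp add: measure_measure_pmf_finite pmf_p w_def pattern_weight_split)
    qed (use J in \<open>simp add: pmf_p w_out\<close>)
    finally show "pmf (map_pmf (\<lambda>A. A \<inter> J) (p (insert x J))) A = pmf (p J) A" .
  qed
  have marginal: "map_pmf (\<lambda>A. A \<inter> J) (p (J \<union> K)) = p J"
    if "finite J" "finite K" "K \<inter> J = {}" for J K
    using that(2,3)
  proof (induction K rule: finite_induct)
    case empty
    have "map_pmf (\<lambda>A. A \<inter> J) (p J) = map_pmf id (p J)"
      using set_p[OF that(1)] by (intro map_pmf_cong) auto
    then show ?case by (simp add: pmf.map_id)
  next
    case (insert x K)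
    have "map_pmf (\<lambda>A. A \<inter> J) (p (J \<union> K)) =
        map_pmf (\<lambda>A. A \<inter> J) (map_pmf (\<lambda>A. A \<inter> (J \<union> K)) (p (insert x (J \<union> K))))"
      using insert that(1) by (subst step) auto
    also have "\<dots> = map_pmf (\<lambda>A. A \<inter> J) (p (J \<union> insert x K))"
      by (simp add: pmf.map_comp o_def Int_assoc Int_absorb1)
    finally show ?case using insert by simp
  qed
  \<comment> \<open>The Kolmogorov limit is taken with real coordinates, a Polish space, so a
    pattern is coded by its indicator function on J.\<close>
  define enc :: "'i set \<Rightarrow> 'i set \<Rightarrow> 'i \<Rightarrow> real" where
    "enc J A = (\<lambda>j\<in>J. indicator A j)" for J A
  define P where "P J = distr (measure_pmf (p J)) (\<Pi>\<^sub>M i\<in>J. borel) (enc J)" for J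
  interpret PP: polish_projective "UNIV :: 'i set" P
  proof (intro polish_projective.intro projective_family.intro)
    fix J H :: "'i set" assume JH: "J \<subseteq> H" "finite H"
    have "p J = map_pmf (\<lambda>A. A \<inter> J) (p (J \<union> (H - J)))"
      using JH by (intro marginal[symmetric]) (auto intro: finite_subset)
    then have pJ: "p J = map_pmf (\<lambda>A. A \<inter> J) (p H)"
      using JH by (simp add: Un_absorb1)
    have res: "(\<lambda>f. restrict f J) \<in> measurable (\<Pi>\<^sub>M i\<in>H. borel) (\<Pi>\<^sub>M i\<in>J. (borel :: real measure))"
      using JH(1) by (rule measurable_restrict_subset)
    have "P J = distr (measure_pmf (p H)) (\<Pi>\<^sub>M i\<in>J. borel) (\<lambda>A. enc J (A \<inter> J))"
      unfolding P_def pJ map_pmf_rep_eq by (subst distr_distr) (auto simp: o_def enc_def space_PiM)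
    also have "(\<lambda>A. enc J (A \<inter> J)) = (\<lambda>f. restrict f J) \<circ> enc H"
      using JH(1) by (auto simp: fun_eq_iff enc_def restrict_def indicator_def)
    also have "distr (measure_pmf (p H)) (\<Pi>\<^sub>M i\<in>J. borel) ((\<lambda>f. restrict f J) \<circ> enc H) =
        distr (P H) (\<Pi>\<^sub>M i\<in>J. borel) (\<lambda>f. restrict f J)"
      unfolding P_def by (subst distr_distr) (auto intro!: res simp: enc_def space_PiM)
    finally show "P J = distr (P H) (\<Pi>\<^sub>M i\<in>J. borel) (\<lambda>f. restrict f J)" .
  next
    fix J :: "'i set"
    show "prob_space (P J)" unfolding P_def
      by (rule prob_space.prob_space_distr) (auto intro: prob_space_measure_pmf simp: enc_def space_PiM)
  qed
  define E where "E i = {x \<in> space PP.lim. x i = (1::real)}" for i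
  show ?thesis
  proof (rule that[of PP.lim E])
    show "prob_space PP.lim" by (rule PP.P.prob_space_axioms)
    show "E i \<in> sets PP.lim" for i
    proof -
      have "Measurable.pred (\<Pi>\<^sub>M i\<in>UNIV. borel) (\<lambda>x. x i = (1::real))" by measurable
      then show ?thesis unfolding E_def by (simp add: pred_def)
    qed
    fix A :: "'i set" assume A: "finite A"
    let ?X = "{x \<in> space (\<Pi>\<^sub>M i\<in>A. (borel :: real measure)). \<forall>i\<in>A. x i = 1}"
    have X: "?X \<in> sets (\<Pi>\<^sub>M i\<in>A. borel)"
      using A by measurable
    have "{x \<in> space PP.lim. \<forall>i\<in>A. x \<in> E i} = PP.emb UNIV A ?X"
      by (auto simp: E_def prod_emb_def space_PiM)
    then have "measure PP.lim {x \<in> space PP.lim. \<forall>i\<in>A. x \<in> E i} = measure (P A) ?X"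
      using PP.measure_lim_emb[OF _ A X] by simp
    also have "\<dots> = measure (p A) (enc A -` ?X)"
      unfolding P_def using X by (subst measure_distr) (auto simp: enc_def space_PiM)
    also have "enc A -` ?X = {B. A \<subseteq> B}"
      by (auto simp: enc_def space_PiM indicator_def split: if_splits)
    \<comment> \<open>All mass of \<open>p A\<close> sits on subsets of A, so only the pattern A
      itself remains, and its weight is an alternating sum over the empty set.\<close>
    also have "measure (p A) {B. A \<subseteq> B} = measure (p A) ({B. A \<subseteq> B} \<inter> set_pmf (p A))"
      by (simp add: measure_Int_set_pmf)
    also have "{B. A \<subseteq> B} \<inter> set_pmf (p A) = {A} \<inter> set_pmf (p A)"
      using set_p[OF A] by auto
    also have "measure (p A) ({A} \<inter> set_pmf (p A)) = \<Phi> A"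
      using A by (simp add: measure_Int_set_pmf measure_pmf_single pmf_p w_def pattern_weight_def)
    finally show "measure PP.lim {x \<in> space PP.lim. \<forall>i\<in>A. x \<in> E i} = \<Phi> A" .
  qed
qed

section \<open>Principal right ideals and classes modulo the kernel\<close>

lemma mult_left_cancel_lcm_iff [simp]:
  "s * t = s * t' \<longleftrightarrow> t = t'" for s :: "'a::right_lcm_semigroup"
  using mult_left_cancel_lcm by blast

lemma mem_rideal: "x \<in> rideal s \<longleftrightarrow> (\<exists>y. x = s * y)"
  by (auto simp: rideal_def)

lemma mult_in_rideal [simp]: "s * x \<in> rideal s"
  by (auto simp: mem_rideal)

lemma self_in_rideal [simp]: "s \<in> rideal s"
  using mult_in_rideal[of s 1] by simp

lemma rideal_nonempty [simp]: "rideal s \<noteq> {}" "{} \<noteq> rideal s"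
  using self_in_rideal by blast+

lemma rideal_one [simp]: "rideal 1 = UNIV"
  by (simp add: rideal_def)

lemma rideal_subset_iff: "rideal t \<subseteq> rideal s \<longleftrightarrow> t \<in> rideal s"
  by (metis mem_rideal mult.assoc self_in_rideal subset_iff)

lemma rideal_mult_right: "x \<in> rideal s \<Longrightarrow> x * y \<in> rideal s"
  by (auto simp: mem_rideal mult.assoc)

lemma mult_mem_rideal_mult [simp]: "s * x \<in> rideal (s * t) \<longleftrightarrow> x \<in> rideal t"
  by (auto simp: mem_rideal mult.assoc)

lemma rideal_mult: "rideal (s * t) = (*) s ` rideal t"
  by (auto simp: rideal_def mult.assoc image_image)

lemma rideal_Int_cases:
  obtains "rideal s \<inter> rideal t = {}" | r where "rideal s \<inter> rideal t = rideal r"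
  using right_lcm[of s t] by (auto simp: rideal_def)

text \<open>The generator of the meet lies in the ideal of s, so it can be written with s in front;
  in this form s can be cancelled.\<close>

lemma rideal_Int_cases_left:
  obtains "rideal s \<inter> rideal t = {}" | r where "rideal s \<inter> rideal t = rideal (s * r)"
proof (cases rule: rideal_Int_cases[of s t])
  case (2 r)
  then have "r \<in> rideal s" using self_in_rideal[of r] by blast
  then show ?thesis using 2 that by (auto simp: mem_rideal)
qed (use that in blast)

lemma rideal_INT_cases:
  assumes "finite A"
  obtains "(\<Inter>t\<in>A. rideal t) = {}" | q where "(\<Inter>t\<in>A. rideal t) = rideal q"
  using assms
proof (induction A arbitrary: thesis rule: finite_induct)
  case empty
  show ?case using empty(2)[of 1] by simp
next
  case (insert x A)
  show ?case
  proof (rule insert.IH)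
    assume "(\<Inter>t\<in>A. rideal t) = {}"
    then show ?thesis using insert.prems(1) by auto
  next
    fix q assume "(\<Inter>t\<in>A. rideal t) = rideal q"
    then show ?thesis
      using insert.prems by (cases rule: rideal_Int_cases[of x q]) auto
  qed
qed

text \<open>The value that a scaling measure must give to \<open>\<Inter>t\<in>A. Z\<^sub>t\<close>.\<close>

definition meet_weight :: "('a::right_lcm_semigroup \<Rightarrow> real) \<Rightarrow> real \<Rightarrow> 'a set \<Rightarrow> real" where
  "meet_weight N \<beta> A =
     (if \<exists>q. (\<Inter>t\<in>A. rideal t) = rideal q
      then N (SOME q. (\<Inter>t\<in>A. rideal t) = rideal q) powr (- \<beta>) else 0)"

lemma meet_weight_None: "(\<Inter>t\<in>A. rideal t) = {} \<Longrightarrow> meet_weight N \<beta> A = 0"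
  unfolding meet_weight_def using self_in_rideal by (metis empty_iff)

section \<open>The scale and the weights of meets\<close>

locale lcm_scale =
  fixes N :: "'a::right_lcm_semigroup \<Rightarrow> real"
  assumes scale: "scale N"
begin

lemma scale_ge_one: "1 \<le> N s"
  and scale_mult: "N (s * t) = N s * N t"
  using scale by (auto simp: scale_def)

lemma scale_pos: "0 < N s"
  using scale_ge_one[of s] by linarith

lemma scale_one [simp]: "N 1 = 1"
  using scale_mult[of 1 1] scale_pos[of 1] by simp

lemma scale_mono: "t \<in> rideal s \<Longrightarrow> N s \<le> N t"
  using scale_ge_one scale_pos by (auto simp: mem_rideal scale_mult)

text \<open>Generators of the same ideal divide each other and N is monotone under divisibility.
  This makes \<open>meet_weight\<close> independent of the chosen generator.\<close>

lemma scale_rideal_eq: "rideal s = rideal t \<Longrightarrow> N s = N t"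
  using scale_mono[of s t] scale_mono[of t s] by (metis antisym self_in_rideal)

text \<open>Both factors are at least 1, so a product equal to 1 forces both to be 1. Hence factors
  of kernel elements stay in the kernel.\<close>

lemma mult_in_ker_iff: "s * t \<in> ker_scale N \<longleftrightarrow> s \<in> ker_scale N \<and> t \<in> ker_scale N"
proof -
  have "s \<in> ker_scale N \<and> t \<in> ker_scale N" if "N s * N t = 1"
  proof -
    have "N s * 1 \<le> N s * N t" "1 * N t \<le> N s * N t"
      using scale_ge_one scale_pos by (intro mult_left_mono mult_right_mono; simp add: less_imp_le)+
    then show ?thesis using that scale_ge_one[of s] scale_ge_one[of t] by (simp add: ker_scale_def)
  qed
  then show ?thesis by (auto simp: ker_scale_def scale_mult)
qed

lemma one_in_ker [simp]: "1 \<in> ker_scale N"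
  by (simp add: ker_scale_def)

lemma ex_in_ker [simp]: "\<exists>k. k \<in> ker_scale N"
  using one_in_ker by blast

lemma meet_weight_Some:
  assumes "(\<Inter>t\<in>A. rideal t) = rideal q"
  shows "meet_weight N \<beta> A = N q powr (- \<beta>)"
proof -
  have "(\<Inter>t\<in>A. rideal t) = rideal (SOME q. (\<Inter>t\<in>A. rideal t) = rideal q)"
    using assms by (rule someI)
  then show ?thesis using assms scale_rideal_eq unfolding meet_weight_def by metis
qed

lemma meet_weight_empty [simp]: "meet_weight N \<beta> {} = 1"
  using meet_weight_Some[of "{}" 1] by simp

lemma meet_weight_singleton [simp]: "meet_weight N \<beta> {s} = N s powr (- \<beta>)"
  using meet_weight_Some[of "{s}" s] by simp

text \<open>Left translation by s is injective and carries the meet of A to that of its translate.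
  Inserting s itself takes care of empty A, where the meet of the translate would be all of
  S.\<close>

lemma meet_weight_mult_image:
  assumes "finite A"
  shows "meet_weight N \<beta> (insert s ((*) s ` A)) = N s powr (- \<beta>) * meet_weight N \<beta> A"
proof -
  have eq: "(\<Inter>t\<in>insert s ((*) s ` A). rideal t) = (*) s ` (\<Inter>t\<in>A. rideal t)"
  proof (intro set_eqI iffI)
    fix x assume x: "x \<in> (\<Inter>t\<in>insert s ((*) s ` A). rideal t)"
    then obtain y where "x = s * y" by (auto simp: mem_rideal)
    then show "x \<in> (*) s ` (\<Inter>t\<in>A. rideal t)" using x by auto
  qed auto
  show ?thesis
  proof (rule rideal_INT_cases[OF assms])
    assume "(\<Inter>t\<in>A. rideal t) = {}"
    then have "(\<Inter>t\<in>insert s ((*) s ` A). rideal t) = {}" unfolding eq by blast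
    then show ?thesis using \<open>(\<Inter>t\<in>A. rideal t) = {}\<close> by (simp only: meet_weight_None mult_zero_right)
  next
    fix q assume q: "(\<Inter>t\<in>A. rideal t) = rideal q"
    have sq: "(\<Inter>t\<in>insert s ((*) s ` A). rideal t) = rideal (s * q)"
      unfolding eq q rideal_mult ..
    show ?thesis
      unfolding meet_weight_Some[OF sq] meet_weight_Some[OF q] scale_mult
      using scale_pos by (simp add: powr_mult less_imp_le)
  qed
qed

text \<open>Translation by a generator of the meet of \<open>A\<close> reduces the general case to \<open>A = {}\<close>.\<close>

lemma alt_sum_meet_weight_nonneg:
  assumes pos: "\<And>F. finite F \<Longrightarrow> 0 \<le> alt_sum (meet_weight N \<beta>) F"
    and fin: "finite A" "finite B"
  shows "0 \<le> alt_sum (\<lambda>K. meet_weight N \<beta> (A \<union> K)) B"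
proof (rule rideal_INT_cases[OF fin(1)])
  assume "(\<Inter>t\<in>A. rideal t) = {}"
  then have "alt_sum (\<lambda>K. meet_weight N \<beta> (A \<union> K)) B = alt_sum (\<lambda>K. 0) B"
    by (intro alt_sum_cong meet_weight_None) auto
  then show ?thesis by (simp add: alt_sum_def)
next
  fix q assume q: "(\<Inter>t\<in>A. rideal t) = rideal q"
  \<comment> \<open>Elements of B whose ideal misses that of q contribute only zero terms. For the
    others the meet with the ideal of q is generated by q times some \<open>g b\<close>, and the
    factor q can be pulled out.\<close>
  define B' where "B' = {b \<in> B. rideal q \<inter> rideal b \<noteq> {}}"
  have "\<exists>g. rideal q \<inter> rideal b = rideal (q * g)" if "b \<in> B'" for b
    using that by (cases rule: rideal_Int_cases_left[of q b]) (auto simp: B'_def)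
  then obtain g where g: "\<And>b. b \<in> B' \<Longrightarrow> rideal q \<inter> rideal b = rideal (q * g b)" by metis
  have INT: "(\<Inter>t\<in>A \<union> K. rideal t) = rideal q \<inter> (\<Inter>b\<in>K. rideal q \<inter> rideal b)" for K
    using q by auto
  have "alt_sum (\<lambda>K. meet_weight N \<beta> (A \<union> K)) B = alt_sum (\<lambda>K. meet_weight N \<beta> (A \<union> K)) B'"
    unfolding alt_sum_def
  proof (rule sum.mono_neutral_right)
    show "\<forall>K\<in>Pow B - Pow B'. (- 1) ^ card K *\<^sub>R meet_weight N \<beta> (A \<union> K) = 0"
    proof
      fix K assume "K \<in> Pow B - Pow B'"
      then obtain b where "b \<in> K" "rideal q \<inter> rideal b = {}" by (auto simp: B'_def)
      then have "(\<Inter>t\<in>A \<union> K. rideal t) = {}" unfolding INT by blast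
      then show "(- 1) ^ card K *\<^sub>R meet_weight N \<beta> (A \<union> K) = 0" by (simp add: meet_weight_None)
    qed
  qed (use fin in \<open>auto simp: B'_def\<close>)
  also have "\<dots> = alt_sum (\<lambda>K. N q powr (- \<beta>) * meet_weight N \<beta> (g ` K)) B'"
  proof (rule alt_sum_cong)
    fix K assume K: "K \<subseteq> B'"
    then have "finite K" using fin by (auto simp: B'_def intro: finite_subset)
    have "(\<Inter>b\<in>K. rideal q \<inter> rideal b) = (\<Inter>b\<in>K. rideal (q * g b))"
      using K g by (intro INF_cong) auto
    then have "(\<Inter>t\<in>A \<union> K. rideal t) = (\<Inter>t\<in>insert q ((*) q ` g ` K). rideal t)"
      unfolding INT by (simp add: image_image)
    then have "meet_weight N \<beta> (A \<union> K) = meet_weight N \<beta> (insert q ((*) q ` g ` K))"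
      unfolding meet_weight_def by simp
    then show "meet_weight N \<beta> (A \<union> K) = N q powr (- \<beta>) * meet_weight N \<beta> (g ` K)"
      using meet_weight_mult_image \<open>finite K\<close> by simp
  qed
  also have "\<dots> = N q powr (- \<beta>) * alt_sum (\<lambda>K. meet_weight N \<beta> (g ` K)) B'"
    by (simp add: alt_sum_def sum_distrib_left mult.left_commute)
  \<comment> \<open>The map g may identify elements of \<open>B'\<close>;
    \<open>alt_sum_image\<close> absorbs this.\<close>
  also have "alt_sum (\<lambda>K. meet_weight N \<beta> (g ` K)) B' = alt_sum (meet_weight N \<beta>) (g ` B')"
    using fin by (intro alt_sum_image) (simp add: B'_def)
  finally show ?thesis using pos[of "g ` B'"] fin by (simp add: B'_def)
qed

end

section \<open>The order on classes modulo the kernel\<close>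

locale lcm_scale_ker = lcm_scale +
  assumes ker_Int: "t \<in> ker_scale N \<Longrightarrow> \<exists>k\<in>ker_scale N. rideal s \<inter> rideal t = rideal (s * k)"
begin

text \<open>The meet of the ideals of b and c is generated by b times a kernel element; as a product
  of kernel elements this generator is in the kernel, and so is its cofactor with respect to
  c.\<close>

lemma ker_common:
  assumes "b \<in> ker_scale N" "c \<in> ker_scale N"
  obtains k l where "k \<in> ker_scale N" "l \<in> ker_scale N" "b * k = c * l"
proof -
  obtain k where k: "k \<in> ker_scale N" "rideal b \<inter> rideal c = rideal (b * k)"
    using ker_Int assms(2) by blast
  then have "b * k \<in> rideal c" using self_in_rideal by blast
  then obtain l where l: "b * k = c * l" by (auto simp: mem_rideal)
  then have "c * l \<in> ker_scale N" using k(1) assms(1) mult_in_ker_iff[of b k] by simp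
  then show ?thesis using that[of k l] k(1) l mult_in_ker_iff[of c l] by blast
qed

lemma equiv_scale_rel: "equiv UNIV (scale_rel N)"
proof (rule equivI)
  show "refl (scale_rel N)" by (auto simp: refl_on_def scale_rel_def intro: one_in_ker)
  show "sym (scale_rel N)" 
  proof (rule symI)
    fix s t assume "(s, t) \<in> scale_rel N"
    then obtain a b where "a \<in> ker_scale N" "b \<in> ker_scale N" "t * b = s * a"
      by (auto simp: scale_rel_def)
    then show "(t, s) \<in> scale_rel N" unfolding scale_rel_def by blast
  qed
  show "trans (scale_rel N)"
  proof (rule transI)
    fix s t u assume "(s, t) \<in> scale_rel N" "(t, u) \<in> scale_rel N"
    then obtain a b c d where ker: "a \<in> ker_scale N" "b \<in> ker_scale N" "c \<in> ker_scale N" "d \<in> ker_scale N"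
      and eq: "s * a = t * b" "t * c = u * d" by (auto simp: scale_rel_def)
    \<comment> \<open>A common multiple of b and c inside the kernel splices the two equations at
      t.\<close>
    obtain k l where kl: "k \<in> ker_scale N" "l \<in> ker_scale N" "b * k = c * l"
      using ker_common ker by blast
    then have "s * (a * k) = u * (d * l)" using eq by (metis mult.assoc)
    then show "(s, u) \<in> scale_rel N"
      using ker kl mult_in_ker_iff unfolding scale_rel_def by blast
  qed
qed auto

lemma scale_class_eq_iff: "scale_class N s = scale_class N t \<longleftrightarrow> (s, t) \<in> scale_rel N"
  unfolding scale_class_def using equiv_scale_rel by (simp add: eq_equiv_class_iff)

lemma scale_quot_eq: "scale_quot N = range (scale_class N)"
  by (auto simp: scale_quot_def quotient_def scale_class_def)

lemma mult_ker_rel: "k \<in> ker_scale N \<Longrightarrow> (s * k, s) \<in> scale_rel N"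
  using one_in_ker mult.right_neutral[of "s * k"] unfolding scale_rel_def by blast

lemma scale_rel_scale: "(s, t) \<in> scale_rel N \<Longrightarrow> N s = N t"
proof -
  assume "(s, t) \<in> scale_rel N"
  then obtain a b where ab: "N a = 1" "N b = 1" "s * a = t * b"
    by (auto simp: scale_rel_def ker_scale_def)
  from arg_cong[OF ab(3), of N] ab(1,2) show ?thesis by (simp add: scale_mult)
qed

text \<open>This turns the order into divisibility up to a kernel factor on the right, free of the
  representatives and meets in \<open>class_le_def\<close>. All later facts about joins use this
  form.\<close>

lemma class_le_iff:
  "class_le N (scale_class N t) (scale_class N q) \<longleftrightarrow> (\<exists>k\<in>ker_scale N. q * k \<in> rideal t)"
proof
  assume "class_le N (scale_class N t) (scale_class N q)"
  then obtain s q1 t' where s: "(t, s) \<in> scale_rel N" "(q, q1) \<in> scale_rel N"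
    "rideal s \<inter> rideal q1 = rideal t'" "(t', q1) \<in> scale_rel N"
    by (auto simp: class_le_def scale_class_eq_iff)
  then have "t' \<in> rideal s" using self_in_rideal[of t'] by blast
  then obtain y where y: "t' = s * y" by (auto simp: mem_rideal)
  have "(q, t') \<in> scale_rel N"
    using s(2,4) equiv_scale_rel by (meson equivE symD transD)
  then obtain d c where cd: "d \<in> ker_scale N" "c \<in> ker_scale N" "q * d = t' * c"
    by (auto simp: scale_rel_def)
  obtain b a where ab: "b \<in> ker_scale N" "a \<in> ker_scale N" "t * b = s * a"
    using s(1) by (auto simp: scale_rel_def)
  \<comment> \<open>Passing from the representative s to t requires a factor a behind s. A kernel
    factor k moves \<open>y * c\<close> into the ideal of a, and then \<open>t * b = s * a\<close>
    brings t to the front.\<close>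
  obtain k where k: "k \<in> ker_scale N" "rideal (y * c) \<inter> rideal a = rideal (y * c * k)"
    using ker_Int ab(2) by blast
  then have "y * c * k \<in> rideal a" using self_in_rideal by blast
  then obtain z where "y * c * k = a * z" by (auto simp: mem_rideal)
  then have "q * (d * k) = t * (b * z)"
    using cd(3) ab(3) y by (simp add: mult.assoc[symmetric]) (simp add: mult.assoc)
  then show "\<exists>k\<in>ker_scale N. q * k \<in> rideal t"
    using cd k by (auto simp: mult_in_ker_iff mem_rideal intro!: bexI[of _ "d * k"])
next
  assume "\<exists>k\<in>ker_scale N. q * k \<in> rideal t"
  then obtain k where k: "k \<in> ker_scale N" "q * k \<in> rideal t" by blast
  then have qk: "q * k \<in> rideal q \<inter> rideal t" by simp
  then obtain r where r: "rideal q \<inter> rideal t = rideal (q * r)"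
    by (cases rule: rideal_Int_cases_left[of q t]) auto
  then obtain x where "q * k = q * (r * x)"
    using qk by (auto simp: mem_rideal mult.assoc)
  \<comment> \<open>Cancelling q exhibits r as a left factor of the kernel element k.\<close>
  then have "r \<in> ker_scale N" using k(1) by (auto simp: mult_in_ker_iff)
  then have "(q * r, q) \<in> scale_rel N" by (rule mult_ker_rel)
  then show "class_le N (scale_class N t) (scale_class N q)"
    using r by (auto simp: class_le_def Int_commute)
qed

text \<open>Applying N to both divisibility equations shows that the two cofactors have product of
  scale 1, so both lie in the kernel.\<close>

lemma class_le_antisym:
  assumes "class_le N (scale_class N s) (scale_class N t)" "class_le N (scale_class N t) (scale_class N s)"
  shows "(s, t) \<in> scale_rel N"
proof -
  obtain k x l y where k: "k \<in> ker_scale N" "t * k = s * x" and l: "l \<in> ker_scale N" "s * l = t * y"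
    using assms by (auto simp: class_le_iff mem_rideal)
  have "N t = N s * N x"
    using k(1) arg_cong[OF k(2), of N] by (simp add: ker_scale_def scale_mult)
  also have "N s = N t * N y"
    using l(1) arg_cong[OF l(2), of N] by (simp add: ker_scale_def scale_mult)
  finally have "N t * 1 = N t * (N y * N x)" by (simp add: mult.assoc)
  then have "N (y * x) = 1" using scale_pos[of t] by (simp add: scale_mult)
  then have "x \<in> ker_scale N" using mult_in_ker_iff[of y x] by (simp add: ker_scale_def)
  then show ?thesis using k unfolding scale_rel_def by auto metis
qed

text \<open>One element \<open>k\<close> serves all \<open>t \<in> A\<close>, because any two elements of the kernel have a common
  multiple in the kernel.\<close>

lemma class_upper_bound_iff:
  assumes "finite A"
  shows "(\<forall>C\<in>scale_class N ` A. class_le N C (scale_class N q)) \<longleftrightarrow>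
    (\<exists>k\<in>ker_scale N. q * k \<in> (\<Inter>t\<in>A. rideal t))"
  using assms
proof (induction A rule: finite_induct)
  case empty
  show ?case using one_in_ker by auto
next
  case (insert x A)
  have "\<exists>k\<in>ker_scale N. q * k \<in> rideal x \<inter> (\<Inter>t\<in>A. rideal t)"
    if asm: "k \<in> ker_scale N" "q * k \<in> rideal x" "l \<in> ker_scale N" "q * l \<in> (\<Inter>t\<in>A. rideal t)" for k l
  proof -
    obtain k' l' where kl: "k' \<in> ker_scale N" "k * k' = l * l'"
      using ker_common[OF asm(1,3)] by blast
    have "q * (k * k') \<in> rideal x" 
      unfolding mult.assoc[symmetric] using asm(2) by (rule rideal_mult_right)
    moreover have "q * (k * k') \<in> (\<Inter>t\<in>A. rideal t)"
    proof
      fix t assume "t \<in> A"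
      then have "q * l \<in> rideal t" using asm(4) by blast
      then show "q * (k * k') \<in> rideal t" 
        unfolding kl(2) mult.assoc[symmetric] by (rule rideal_mult_right)
    qed
    ultimately show ?thesis using asm(1) kl(1) mult_in_ker_iff[of k k'] by blast
  qed
  then have "(\<exists>k\<in>ker_scale N. q * k \<in> rideal x) \<and> (\<exists>k\<in>ker_scale N. q * k \<in> (\<Inter>t\<in>A. rideal t)) \<longleftrightarrow>
      (\<exists>k\<in>ker_scale N. q * k \<in> rideal x \<inter> (\<Inter>t\<in>A. rideal t))"
    by blast
  then show ?case
    using insert.IH by (simp add: class_le_iff)
qed

text \<open>By \<open>class_upper_bound_iff\<close> the upper bounds are the classes of those r that
  have a multiple \<open>r * k\<close>, with k in the kernel, in the meet. The meet is the ideal of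
  q, so this is exactly the condition that the class of q lies below that of r.\<close>

lemma class_lub_rideal_INT:
  assumes "finite A" "(\<Inter>t\<in>A. rideal t) = rideal q"
  shows "class_lub N (scale_class N ` A) (scale_class N q)"
  unfolding class_lub_def
proof (intro conjI)
  show "scale_class N q \<in> scale_quot N" by (simp add: scale_quot_eq)
  show "\<forall>C\<in>scale_class N ` A. class_le N C (scale_class N q)"
    unfolding class_upper_bound_iff[OF assms(1)] assms(2) by (auto intro!: bexI[of _ 1])
  show "\<forall>R\<in>scale_quot N. (\<forall>C\<in>scale_class N ` A. class_le N C R) \<longrightarrow> class_le N (scale_class N q) R"
  proof (intro ballI impI)
    fix R assume "R \<in> scale_quot N" and ub: "\<forall>C\<in>scale_class N ` A. class_le N C R"
    then obtain r where r: "R = scale_class N r" by (auto simp: scale_quot_eq)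
    show "class_le N (scale_class N q) R"
      using ub unfolding r class_upper_bound_iff[OF assms(1)] assms(2) class_le_iff .
  qed
qed

text \<open>The bridge between the two sides of the formula. An empty meet leaves no upper bound at
  all; otherwise the chosen representative of the join is equivalent to the generator of the meet by
  antisymmetry, and N is constant on classes.\<close>

lemma scale_powr_join_rep:
  assumes "finite A"
  shows "scale_powr N \<beta> (join_rep N (scale_class N ` A)) = meet_weight N \<beta> A"
proof (rule rideal_INT_cases[OF assms])
  assume empty: "(\<Inter>t\<in>A. rideal t) = {}"
  have "\<not> class_lub N (scale_class N ` A) Q" for Q
  proof
    assume Q: "class_lub N (scale_class N ` A) Q"
    then obtain q where "Q = scale_class N q" by (auto simp: class_lub_def scale_quot_eq)
    then show False
      using Q class_upper_bound_iff[OF assms, of q] empty by (auto simp: class_lub_def)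
  qed
  then show ?thesis using empty by (simp add: join_rep_def scale_powr_def meet_weight_None)
next
  fix q assume q: "(\<Inter>t\<in>A. rideal t) = rideal q"
  define q' where "q' = (SOME q. class_lub N (scale_class N ` A) (scale_class N q))"
  have lub: "class_lub N (scale_class N ` A) (scale_class N q)"
    using class_lub_rideal_INT[OF assms q] .
  then have lub': "class_lub N (scale_class N ` A) (scale_class N q')"
    unfolding q'_def by (rule someI[of "\<lambda>q. class_lub N (scale_class N ` A) (scale_class N q)"])
  have "(q', q) \<in> scale_rel N"
    by (rule class_le_antisym) (use lub lub' in \<open>auto simp: class_lub_def\<close>)
  moreover have "join_rep N (scale_class N ` A) = Some q'"
    using lub by (auto simp: join_rep_def q'_def)
  ultimately show ?thesis
    using scale_rel_scale meet_weight_Some[OF q] by (simp add: scale_powr_def)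
qed

lemma alt_sum_join_rep:
  assumes "finite F"
  shows "alt_sum (\<lambda>K. scale_powr N \<beta> (join_rep N K)) (scale_class N ` F) = alt_sum (meet_weight N \<beta>) F"
  unfolding alt_sum_image[OF assms, symmetric]
  using assms by (intro alt_sum_cong scale_powr_join_rep) (auto intro: finite_subset)

text \<open>For nonempty A inside the ideal of s, inserting s does not change the meet. The empty
  set has to be treated apart: its join would be the class of 1, while the formula puts
  \<open>N s powr (- \<beta>)\<close> there.\<close>

lemma incl_excl_eq_alt_sum:
  assumes "finite F" "F \<subseteq> rideal s"
  shows "incl_excl N \<beta> s (scale_class N ` F) = alt_sum (\<lambda>A. meet_weight N \<beta> (insert s A)) F"
proof -
  define h where "h K = (if K = {} then N s powr (- \<beta>) else scale_powr N \<beta> (join_rep N K))" for K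
  have "incl_excl N \<beta> s (scale_class N ` F) = alt_sum h (scale_class N ` F)"
  proof -
    have "alt_sum h (scale_class N ` F) =
        (-1) ^ card {} *\<^sub>R h {} + (\<Sum>K\<in>Pow (scale_class N ` F) - {{}}. (-1) ^ card K *\<^sub>R h K)"
      unfolding alt_sum_def using assms(1) by (subst sum.remove[of _ "{}"]) auto
    moreover have "Pow (scale_class N ` F) - {{}} = {K. K \<subseteq> scale_class N ` F \<and> K \<noteq> {}}" by auto
    ultimately show ?thesis
      unfolding incl_excl_def by (auto simp: h_def intro!: sum.cong)
  qed
  also have "\<dots> = alt_sum (\<lambda>A. h (scale_class N ` A)) F"
    by (rule alt_sum_image[OF assms(1), symmetric])
  also have "\<dots> = alt_sum (\<lambda>A. meet_weight N \<beta> (insert s A)) F"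
  proof (rule alt_sum_cong)
    fix A assume A: "A \<subseteq> F"
    show "h (scale_class N ` A) = meet_weight N \<beta> (insert s A)"
    proof (cases "A = {}")
      case False
      then obtain t where "t \<in> A" "rideal t \<subseteq> rideal s"
        using A assms(2) by (auto simp: rideal_subset_iff)
      then have "(\<Inter>t\<in>insert s A. rideal t) = (\<Inter>t\<in>A. rideal t)" by auto
      then have "meet_weight N \<beta> (insert s A) = meet_weight N \<beta> A"
        unfolding meet_weight_def by simp
      moreover have "finite A" using A assms(1) finite_subset by blast
      ultimately show ?thesis using False by (simp add: h_def scale_powr_join_rep)
    qed (simp add: h_def)
  qed
  finally show ?thesis .
qed

text \<open>Classes equal to \<open>[1]\<close> need not be tested, since they make the alternating sum vanish.\<close>

lemma incl_excl_nonneg_iff: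
  "(\<forall>G. finite G \<and> G \<subseteq> {C \<in> scale_quot N. class_le N (scale_class N 1) C \<and> C \<noteq> scale_class N 1} \<longrightarrow>
      0 \<le> incl_excl N \<beta> 1 G) \<longleftrightarrow>
   (\<forall>F. finite F \<longrightarrow> 0 \<le> alt_sum (meet_weight N \<beta>) F)"
proof -
  have ie: "incl_excl N \<beta> 1 (scale_class N ` F) = alt_sum (meet_weight N \<beta>) F" if "finite F" for F
  proof -
    have "meet_weight N \<beta> (insert 1 A) = meet_weight N \<beta> A" for A
      unfolding meet_weight_def by simp
    then show ?thesis using incl_excl_eq_alt_sum[OF that, of 1] by simp
  qed
  show ?thesis
  proof (intro iffI allI impI)
    fix F :: "'a set" assume F: "finite F"
      and pos: "\<forall>G. finite G \<and> G \<subseteq> {C \<in> scale_quot N. class_le N (scale_class N 1) C \<and> C \<noteq> scale_class N 1} \<longrightarrow>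
        0 \<le> incl_excl N \<beta> 1 G"
    show "0 \<le> alt_sum (meet_weight N \<beta>) F"
    proof (cases "scale_class N 1 \<in> scale_class N ` F")
      case True
      let ?h = "\<lambda>K. scale_powr N \<beta> (join_rep N K)"
      \<comment> \<open>Adding 1 does not change a meet of ideals, so adding its class does not
        change the weight, and \<open>alt_sum_absorb\<close> applies.\<close>
      have "?h (scale_class N ` A) = ?h (insert (scale_class N 1) (scale_class N ` A))" if "A \<subseteq> F" for A
      proof -
        have A: "finite A" using F that finite_subset by blast
        have "?h (scale_class N ` insert 1 A) = meet_weight N \<beta> (insert 1 A)"
          by (rule scale_powr_join_rep) (use A in simp)
        also have "\<dots> = meet_weight N \<beta> A"
          unfolding meet_weight_def by simp
        also have "\<dots> = ?h (scale_class N ` A)"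
          by (rule scale_powr_join_rep[OF A, symmetric])
        finally show ?thesis by simp
      qed
      then have "alt_sum ?h (scale_class N ` F) =
          alt_sum (\<lambda>K. ?h (insert (scale_class N 1) K)) (scale_class N ` F)"
        by (intro alt_sum_cong) (auto simp: subset_image_iff)
      also have "\<dots> = 0"
        using F True by (intro alt_sum_absorb[where h = ?h]) auto
      finally show ?thesis using F alt_sum_join_rep by simp
    next
      case False
      have "class_le N (scale_class N 1) (scale_class N t)" for t
        unfolding class_le_iff by (auto intro!: bexI[of _ 1])
      then have "0 \<le> incl_excl N \<beta> 1 (scale_class N ` F)"
        using F False by (intro pos[rule_format]) (auto simp: scale_quot_eq)
      then show ?thesis using ie F by simp
    qed
  next
    fix G assume pos: "\<forall>F. finite F \<longrightarrow> 0 \<le> alt_sum (meet_weight N \<beta>) F"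
      and G: "finite G \<and> G \<subseteq> {C \<in> scale_quot N. class_le N (scale_class N 1) C \<and> C \<noteq> scale_class N 1}"
    then have "G \<subseteq> range (scale_class N)" by (auto simp: scale_quot_eq)
    then obtain F where "finite F" "G = scale_class N ` F"
      using G finite_subset_image[of G "scale_class N" UNIV] by blast
    then show "0 \<le> incl_excl N \<beta> 1 G" using ie pos by simp
  qed
qed

end

section \<open>Characters of the idempotents\<close>

lemma partial_inv_left_mult:
  "partial_inv (left_mult s) y = (if y \<in> rideal s then Some (THE x. y = s * x) else None)"
  by (auto simp: partial_inv_def left_mult_def mem_rideal eq_commute)

lemma idem_apply: "idem s x = (if x \<in> rideal s then Some x else None)"
proof (cases "x \<in> rideal s")
  case True
  then obtain y where x: "x = s * y" by (auto simp: mem_rideal)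
  then have "partial_inv (left_mult s) x = Some y"
    by (simp add: partial_inv_left_mult)
  then show ?thesis using x by (simp add: idem_def map_comp_def left_mult_def)
qed (simp add: idem_def map_comp_def partial_inv_left_mult)

lemma idem_eq_iff: "idem s = idem t \<longleftrightarrow> rideal s = rideal t"
proof
  assume "idem s = idem t"
  then have "x \<in> rideal s \<longleftrightarrow> x \<in> rideal t" for x
    by (metis idem_apply option.distinct(1))
  then show "rideal s = rideal t" by blast
qed (simp add: idem_apply fun_eq_iff)

lemma idem_neq_empty [simp]: "idem s \<noteq> Map.empty" "Map.empty \<noteq> idem s"
proof -
  have "idem s s \<noteq> None" by (simp add: idem_apply)
  then show "idem s \<noteq> Map.empty" "Map.empty \<noteq> idem s" by metis+
qed

lemma idem_in_lattice [simp]: "idem s \<in> idem_lattice"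
  and empty_in_lattice [simp]: "Map.empty \<in> idem_lattice"
  by (auto simp: idem_lattice_def)

lemma idem_comp:
  "rideal s \<inter> rideal t = rideal r \<Longrightarrow> idem s \<circ>\<^sub>m idem t = idem r"
  by (auto simp: fun_eq_iff map_comp_def idem_apply)

lemma idem_comp_disjoint:
  "rideal s \<inter> rideal t = {} \<Longrightarrow> idem s \<circ>\<^sub>m idem t = Map.empty"
  by (auto simp: fun_eq_iff map_comp_def idem_apply)

lemma conj_apply:
  "(partial_inv (left_mult s) \<circ>\<^sub>m idem r \<circ>\<^sub>m left_mult s) x =
     (if s * x \<in> rideal r then Some x else None)"
  by (auto simp: map_comp_def left_mult_def idem_apply partial_inv_def)

text \<open>The conjugate is the identity on the x for which \<open>s * x\<close> lies in the meet
  of the two ideals; cancelling s leaves the ideal of t. So conjugation stays inside the lattice of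
  idempotents.\<close>

lemma conj_idem:
  assumes "rideal s \<inter> rideal r = rideal (s * t)"
  shows "partial_inv (left_mult s) \<circ>\<^sub>m idem r \<circ>\<^sub>m left_mult s = idem t"
proof
  fix x
  have "s * x \<in> rideal r \<longleftrightarrow> s * x \<in> rideal s \<inter> rideal r" by simp
  also have "\<dots> \<longleftrightarrow> x \<in> rideal t" unfolding assms by simp
  finally show "(partial_inv (left_mult s) \<circ>\<^sub>m idem r \<circ>\<^sub>m left_mult s) x = idem t x"
    unfolding conj_apply idem_apply by simp
qed

lemma conj_idem_disjoint:
  assumes "rideal s \<inter> rideal r = {}"
  shows "partial_inv (left_mult s) \<circ>\<^sub>m idem r \<circ>\<^sub>m left_mult s = Map.empty"
proof
  fix x
  have "s * x \<notin> rideal r" using assms mult_in_rideal[of s x] by blast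
  then show "(partial_inv (left_mult s) \<circ>\<^sub>m idem r \<circ>\<^sub>m left_mult s) x = None"
    unfolding conj_apply by simp
qed

lemma spectrum_values: "\<xi> \<in> spectrum \<Longrightarrow> e \<in> idem_lattice \<Longrightarrow> \<xi> e \<in> {0, 1}"
  by (auto simp: spectrum_def)

lemma spectrum_comp:
  "\<xi> \<in> spectrum \<Longrightarrow> e \<in> idem_lattice \<Longrightarrow> f \<in> idem_lattice \<Longrightarrow> \<xi> (e \<circ>\<^sub>m f) = \<xi> e * \<xi> f"
  by (auto simp: spectrum_def)

lemma spectrum_empty: "\<xi> \<in> spectrum \<Longrightarrow> \<xi> Map.empty = 0"
  by (auto simp: spectrum_def)

lemma spectrum_Int:
  "\<xi> \<in> spectrum \<Longrightarrow> rideal s \<inter> rideal t = rideal r \<Longrightarrow> \<xi> (idem r) = \<xi> (idem s) * \<xi> (idem t)"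
  using spectrum_comp[of \<xi> "idem s" "idem t"] by (simp add: idem_comp)

lemma spectrum_disjoint:
  "\<xi> \<in> spectrum \<Longrightarrow> rideal s \<inter> rideal t = {} \<Longrightarrow> \<xi> (idem s) * \<xi> (idem t) = 0"
  using spectrum_comp[of \<xi> "idem s" "idem t"] by (simp add: idem_comp_disjoint spectrum_empty)

text \<open>The idempotent of 1 is the unit of the lattice, so a character vanishing there vanishes
  everywhere.\<close>

lemma spectrum_idem_one:
  assumes "\<xi> \<in> spectrum" shows "\<xi> (idem 1) = 1"
proof (rule ccontr)
  assume "\<xi> (idem 1) \<noteq> 1"
  then have "\<xi> (idem 1) = 0" using spectrum_values[OF assms, of "idem 1"] by auto
  then have "\<xi> (idem s) = 0" for s
    using spectrum_Int[OF assms, of 1 s s] by simp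
  then have "\<xi> e = 0" if "e \<in> idem_lattice" for e
    using that spectrum_empty[OF assms] by (auto simp: idem_lattice_def)
  then show False using assms by (auto simp: spectrum_def)
qed

lemma spectrum_eqI:
  assumes "\<xi> \<in> spectrum" "\<eta> \<in> spectrum" "\<And>s. \<xi> (idem s) = \<eta> (idem s)"
  shows "\<xi> = \<eta>"
proof (rule extensionalityI[of _ idem_lattice])
  show "\<xi> \<in> extensional idem_lattice" "\<eta> \<in> extensional idem_lattice"
    using assms(1,2) by (auto simp: spectrum_def PiE_def)
  show "\<xi> e = \<eta> e" if "e \<in> idem_lattice" for e
    using that assms(3) spectrum_empty[OF assms(1)] spectrum_empty[OF assms(2)]
    by (auto simp: idem_lattice_def)
qed

text \<open>Characters of the idempotents correspond to filters of principal right ideals.\<close>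

definition ideal_filter :: "('a::right_lcm_semigroup \<Rightarrow> bool) \<Rightarrow> bool" where
  "ideal_filter P \<longleftrightarrow> P 1 \<and> (\<forall>r s t. rideal r \<inter> rideal s = rideal t \<longrightarrow> (P t \<longleftrightarrow> P r \<and> P s)) \<and>
     (\<forall>r s. rideal r \<inter> rideal s = {} \<longrightarrow> \<not> (P r \<and> P s))"

text \<open>The existential makes the value depend on the idempotent alone, since an ideal can have
  several generators; it also gives 0 at the empty map.\<close>

definition filter_char :: "('a::right_lcm_semigroup \<Rightarrow> bool) \<Rightarrow> ('a \<rightharpoonup> 'a) \<Rightarrow> nat" where
  "filter_char P = (\<lambda>e\<in>idem_lattice. if \<exists>s. e = idem s \<and> P s then 1 else 0)"

lemma filter_char_idem:
  assumes "ideal_filter P" shows "filter_char P (idem s) = of_bool (P s)"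
proof -
  have "P t \<longleftrightarrow> P s" if "rideal s = rideal t" for t
    using assms that unfolding ideal_filter_def by (metis Int_absorb)
  then have "(\<exists>t. idem s = idem t \<and> P t) \<longleftrightarrow> P s" by (metis idem_eq_iff)
  then show ?thesis by (simp add: filter_char_def)
qed

lemma filter_char_spectrum:
  assumes P: "ideal_filter P" shows "filter_char P \<in> spectrum"
proof -
  have empty: "filter_char P Map.empty = 0"
    by (auto simp: filter_char_def)
  have comp: "filter_char P (idem r \<circ>\<^sub>m idem s) = filter_char P (idem r) * filter_char P (idem s)" for r s
  proof (cases rule: rideal_Int_cases[of r s])
    case 1
    then show ?thesis
      using P by (simp add: idem_comp_disjoint empty filter_char_idem[OF P]) (auto simp: ideal_filter_def)
  next
    case (2 t)
    then have "P t \<longleftrightarrow> P r \<and> P s" using P by (auto simp: ideal_filter_def)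
    then show ?thesis by (simp add: idem_comp[OF 2] filter_char_idem[OF P])
  qed
  have "filter_char P (idem 1) = 1"
    using P by (simp add: filter_char_idem) (simp add: ideal_filter_def)
  then have "\<exists>e\<in>idem_lattice. filter_char P e \<noteq> 0"
    by (intro bexI[of _ "idem 1"]) auto
  moreover have "filter_char P (e \<circ>\<^sub>m f) = filter_char P e * filter_char P f"
    if "e \<in> idem_lattice" "f \<in> idem_lattice" for e f
    using that comp empty by (auto simp: idem_lattice_def)
  moreover have "filter_char P \<in> idem_lattice \<rightarrow>\<^sub>E {0, 1}"
    by (auto simp: filter_char_def)
  ultimately show ?thesis using empty by (simp add: spectrum_def)
qed

text \<open>Supplies a default character for the null set on which the random filter of
  \<open>ex_scaling_measure\<close> may fail to be one.\<close>

lemma ideal_filter_principal: "ideal_filter (\<lambda>s. x \<in> rideal s)"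
  unfolding ideal_filter_def by auto

lemma spectrum_act_idem:
  assumes "rideal s \<inter> rideal r = rideal (s * t)"
  shows "spectrum_act s \<xi> (idem r) = \<xi> (idem t)"
  unfolding spectrum_act_def conj_idem[OF assms, symmetric] by simp

lemma spectrum_act_idem_disjoint:
  assumes "\<xi> \<in> spectrum" "rideal s \<inter> rideal r = {}"
  shows "spectrum_act s \<xi> (idem r) = 0"
  using assms conj_idem_disjoint[OF assms(2)] by (simp add: spectrum_act_def spectrum_empty)

lemma rideal_Int_mult: "rideal s \<inter> rideal (s * t) = rideal (s * t)"
  by (auto simp: mem_rideal mult.assoc)

lemma spectrum_act_idem_mult [simp]: "spectrum_act s \<xi> (idem (s * t)) = \<xi> (idem t)"
  by (rule spectrum_act_idem) (rule rideal_Int_mult)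

lemma spectrum_act_empty: "\<xi> \<in> spectrum \<Longrightarrow> spectrum_act s \<xi> Map.empty = 0"
  by (simp add: spectrum_act_def spectrum_empty)

text \<open>Writing a translate as the character of a filter shows that it lies in the spectrum. The
  filter laws for P follow from those of \<xi>, because the injective left multiplication by s
  transports meets and disjointness of ideals.\<close>

lemma spectrum_act_eq_filter_char:
  fixes s :: "'a::right_lcm_semigroup"
  assumes \<xi>: "\<xi> \<in> spectrum"
  defines "P \<equiv> \<lambda>r. \<exists>t. rideal s \<inter> rideal r = rideal (s * t) \<and> \<xi> (idem t) = 1"
  shows "ideal_filter P" "spectrum_act s \<xi> = filter_char P"
proof -
  have act: "spectrum_act s \<xi> (idem r) = of_bool (P r)" for r
  proof (cases rule: rideal_Int_cases_left[of s r])
    case 1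
    then have "\<not> P r" unfolding P_def using self_in_rideal by (metis empty_iff)
    then show ?thesis using 1 spectrum_act_idem_disjoint[OF \<xi>] by simp
  next
    case (2 t)
    have "P r \<longleftrightarrow> \<xi> (idem t) = 1"
      unfolding P_def using 2 spectrum_act_idem by metis
    then show ?thesis
      using spectrum_act_idem[OF 2, of \<xi>] spectrum_values[OF \<xi>, of "idem t"] by auto
  qed
  have Pt: "P r \<longleftrightarrow> \<xi> (idem t) = 1" if "rideal s \<inter> rideal r = rideal (s * t)" for r t
    using act[of r] spectrum_act_idem[OF that, of \<xi>] by auto
  have Pn: "\<not> P r" if "rideal s \<inter> rideal r = {}" for r
    using that unfolding P_def by (metis empty_iff self_in_rideal)
  have inj: "inj ((*) s)" by (simp add: inj_def)
  show filter: "ideal_filter P"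
    unfolding ideal_filter_def
  proof (intro conjI allI impI)
    show "P 1" unfolding P_def by (rule exI[of _ 1]) (simp add: spectrum_idem_one[OF \<xi>, simplified])
  next
    fix a b c :: 'a assume abc: "rideal a \<inter> rideal b = rideal c"
    show "P c \<longleftrightarrow> P a \<and> P b"
    proof (cases "rideal s \<inter> rideal a = {} \<or> rideal s \<inter> rideal b = {}")
      case True
      then have "rideal s \<inter> rideal c = {}" using abc by blast
      then show ?thesis using True Pn by blast
    next
      case False
      obtain x where x: "rideal s \<inter> rideal a = rideal (s * x)"
        using False by (cases rule: rideal_Int_cases_left[of s a]) auto
      obtain y where y: "rideal s \<inter> rideal b = rideal (s * y)"
        using False by (cases rule: rideal_Int_cases_left[of s b]) auto
      \<comment> \<open>Both meets with the ideal of s are translates by s, so the meet for c is the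
        translate of the meet of the ideals of x and y; the two cases of that meet settle the
        claim.\<close>
      have "rideal s \<inter> rideal c = rideal (s * x) \<inter> rideal (s * y)"
        using x y abc by blast
      then have sc: "rideal s \<inter> rideal c = (*) s ` (rideal x \<inter> rideal y)"
        by (simp add: rideal_mult image_Int[OF inj])
      show ?thesis
      proof (cases rule: rideal_Int_cases[of x y])
        case 1
        then have "\<not> P c" using sc Pn by simp
        moreover have "\<not> (P a \<and> P b)"
          using spectrum_disjoint[OF \<xi> 1] Pt[OF x] Pt[OF y] by auto
        ultimately show ?thesis by blast
      next
        case (2 z)
        then have "rideal s \<inter> rideal c = rideal (s * z)" using sc by (simp add: rideal_mult)
        then show ?thesis
          using spectrum_Int[OF \<xi> 2] Pt x y by simp
      qed
    qed
  next
    fix a b :: 'a assume ab: "rideal a \<inter> rideal b = {}"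
    show "\<not> (P a \<and> P b)"
    proof
      assume "P a \<and> P b"
      then obtain x y where x: "rideal s \<inter> rideal a = rideal (s * x)" "\<xi> (idem x) = 1"
        and y: "rideal s \<inter> rideal b = rideal (s * y)" "\<xi> (idem y) = 1"
        by (auto simp: P_def)
      have "rideal (s * x) \<inter> rideal (s * y) = {}"
        using x(1) y(1) ab by blast
      then have "rideal x \<inter> rideal y = {}"
        unfolding rideal_mult image_Int[OF inj, symmetric] by simp
      then show False using spectrum_disjoint[OF \<xi>, of x y] x y by simp
    qed
  qed
  show "spectrum_act s \<xi> = filter_char P"
  proof (rule extensionalityI[of _ idem_lattice])
    show "spectrum_act s \<xi> e = filter_char P e" if "e \<in> idem_lattice" for e
      using that act filter_char_idem[OF filter] filter_char_spectrum[OF filter]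
      by (auto simp: idem_lattice_def spectrum_act_empty[OF \<xi>] spectrum_empty)
  qed (auto simp: spectrum_act_def filter_char_def)
qed

lemma spectrum_act_in_spectrum: "\<xi> \<in> spectrum \<Longrightarrow> spectrum_act s \<xi> \<in> spectrum"
  by (simp only: spectrum_act_eq_filter_char(2)) (rule filter_char_spectrum[OF spectrum_act_eq_filter_char(1)])

section \<open>Cylinders and translation of characters\<close>

lemma cylinder_subset: "cylinder s \<subseteq> spectrum"
  by (auto simp: cylinder_def)

lemma cylinder_one [simp]: "cylinder 1 = spectrum"
  unfolding cylinder_def using spectrum_idem_one by blast

lemma cylinder_Int: "rideal s \<inter> rideal t = rideal r \<Longrightarrow> cylinder s \<inter> cylinder t = cylinder r"
proof (rule set_eqI)
  fix \<xi> assume "rideal s \<inter> rideal t = rideal r"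
  then show "\<xi> \<in> cylinder s \<inter> cylinder t \<longleftrightarrow> \<xi> \<in> cylinder r"
    using spectrum_Int[of \<xi> s t r] by (auto simp: cylinder_def)
qed

lemma cylinder_disjoint: "rideal s \<inter> rideal t = {} \<Longrightarrow> cylinder s \<inter> cylinder t = {}"
proof (rule equals0I)
  fix \<xi> assume "rideal s \<inter> rideal t = {}" "\<xi> \<in> cylinder s \<inter> cylinder t"
  then show False using spectrum_disjoint[of \<xi> s t] by (simp add: cylinder_def)
qed

lemma spectrum_act_cylinder: "\<xi> \<in> spectrum \<Longrightarrow> spectrum_act s \<xi> \<in> cylinder s"
  using spectrum_act_in_spectrum spectrum_act_idem_mult[of s \<xi> 1]
  by (simp add: cylinder_def spectrum_idem_one)

definition spectrum_inv :: "'a::right_lcm_semigroup \<Rightarrow> (('a \<rightharpoonup> 'a) \<Rightarrow> nat) \<Rightarrow> (('a \<rightharpoonup> 'a) \<Rightarrow> nat)" where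
  "spectrum_inv s \<xi> = filter_char (\<lambda>t. \<xi> (idem (s * t)) = 1)"

text \<open>Left multiplication by s preserves meets and disjointness of ideals, so pulling \<xi>
  back along it gives a filter. The filter axiom at 1 is the membership of \<xi> in the cylinder of
  s.\<close>

lemma spectrum_inv:
  assumes \<xi>: "\<xi> \<in> cylinder s"
  shows spectrum_inv_in_spectrum: "spectrum_inv s \<xi> \<in> spectrum"
    and spectrum_inv_idem: "spectrum_inv s \<xi> (idem t) = \<xi> (idem (s * t))"
proof -
  have sp: "\<xi> \<in> spectrum" and s1: "\<xi> (idem s) = 1" using \<xi> by (auto simp: cylinder_def)
  have filter: "ideal_filter (\<lambda>t. \<xi> (idem (s * t)) = 1)"
    unfolding ideal_filter_def
  proof (intro conjI allI impI)
    show "\<xi> (idem (s * 1)) = 1" using s1 by simp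
  next
    fix a b c :: 'a assume "rideal a \<inter> rideal b = rideal c"
    then have "rideal (s * a) \<inter> rideal (s * b) = rideal (s * c)"
      unfolding rideal_mult by (subst image_Int[symmetric]) (auto simp: inj_def)
    from spectrum_Int[OF sp this]
    show "\<xi> (idem (s * c)) = 1 \<longleftrightarrow> \<xi> (idem (s * a)) = 1 \<and> \<xi> (idem (s * b)) = 1" by simp
  next
    fix a b :: 'a assume "rideal a \<inter> rideal b = {}"
    then have "rideal (s * a) \<inter> rideal (s * b) = {}"
      unfolding rideal_mult by auto
    from spectrum_disjoint[OF sp this]
    show "\<not> (\<xi> (idem (s * a)) = 1 \<and> \<xi> (idem (s * b)) = 1)" by auto
  qed
  show "spectrum_inv s \<xi> \<in> spectrum"
    unfolding spectrum_inv_def by (rule filter_char_spectrum[OF filter])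
  show "spectrum_inv s \<xi> (idem t) = \<xi> (idem (s * t))"
    unfolding spectrum_inv_def filter_char_idem[OF filter]
    using spectrum_values[OF sp, of "idem (s * t)"] by auto
qed

lemma spectrum_act_inv:
  assumes \<xi>: "\<xi> \<in> cylinder s" shows "spectrum_act s (spectrum_inv s \<xi>) = \<xi>"
proof (rule spectrum_eqI)
  have sp: "\<xi> \<in> spectrum" and s1: "\<xi> (idem s) = 1" using \<xi> by (auto simp: cylinder_def)
  show "\<xi> \<in> spectrum" by fact
  show "spectrum_act s (spectrum_inv s \<xi>) \<in> spectrum"
    using spectrum_act_in_spectrum spectrum_inv_in_spectrum[OF \<xi>] .
  fix r
  show "spectrum_act s (spectrum_inv s \<xi>) (idem r) = \<xi> (idem r)"
  proof (cases rule: rideal_Int_cases_left[of s r])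
    case 1
    then show ?thesis
      using spectrum_act_idem_disjoint[OF spectrum_inv_in_spectrum[OF \<xi>] 1]
        spectrum_disjoint[OF sp 1] s1 by simp
  next
    case (2 t)
    then show ?thesis
      using spectrum_act_idem[OF 2] spectrum_inv_idem[OF \<xi>] spectrum_Int[OF sp 2] s1 by simp
  qed
qed

lemma spectrum_inv_act:
  assumes "\<xi> \<in> spectrum" shows "spectrum_inv s (spectrum_act s \<xi>) = \<xi>"
proof (rule spectrum_eqI)
  show "spectrum_inv s (spectrum_act s \<xi>) \<in> spectrum"
    by (rule spectrum_inv_in_spectrum[OF spectrum_act_cylinder[OF assms]])
  show "spectrum_inv s (spectrum_act s \<xi>) (idem t) = \<xi> (idem t)" for t
    by (simp add: spectrum_inv_idem[OF spectrum_act_cylinder[OF assms]])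
qed (rule assms)

text \<open>Images of Borel sets need not be Borel in general; rewriting a translate as a preimage
  under the inverse makes its measurability accessible.\<close>

lemma spectrum_act_image:
  assumes "A \<subseteq> spectrum"
  shows "spectrum_act s ` A = {\<xi> \<in> cylinder s. spectrum_inv s \<xi> \<in> A}"
proof (intro set_eqI iffI)
  fix \<xi> assume "\<xi> \<in> {\<xi> \<in> cylinder s. spectrum_inv s \<xi> \<in> A}"
  then show "\<xi> \<in> spectrum_act s ` A" using spectrum_act_inv[of \<xi> s] by (metis (mono_tags) image_eqI mem_Collect_eq)
next
  fix \<xi> assume "\<xi> \<in> spectrum_act s ` A"
  then obtain \<eta> where "\<eta> \<in> A" "\<xi> = spectrum_act s \<eta>" by blast
  moreover from this have "\<eta> \<in> spectrum" using assms by blast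
  ultimately show "\<xi> \<in> {\<xi> \<in> cylinder s. spectrum_inv s \<xi> \<in> A}"
    using spectrum_act_cylinder[of \<eta> s] spectrum_inv_act[of \<eta> s] by simp
qed

lemma spectrum_act_spectrum: "spectrum_act s ` spectrum = cylinder s"
  unfolding spectrum_act_image[OF order_refl] using spectrum_inv_in_spectrum by blast

lemma spectrum_act_cylinder_image: "spectrum_act s ` cylinder t = cylinder (s * t)"
proof -
  have "\<xi> \<in> cylinder s" if "\<xi> \<in> cylinder (s * t)" for \<xi>
    using cylinder_Int[OF rideal_Int_mult, of s t] that by blast
  then show ?thesis
    unfolding spectrum_act_image[OF cylinder_subset]
    by (auto simp: cylinder_def spectrum_inv_in_spectrum spectrum_inv_idem)
qed

section \<open>Scaling measures\<close>

lemma topspace_spectrum [simp]: "topspace spectrum_topology = spectrum"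
  by (simp add: spectrum_topology_def) (auto simp: spectrum_def)

lemma openin_spectrum_subset: "{U. openin spectrum_topology U} \<subseteq> Pow spectrum"
  using openin_subset[of spectrum_topology] by auto

lemma space_spectrum_borel [simp]: "space spectrum_borel = spectrum"
  unfolding spectrum_borel_def
  by (rule space_measure_of) (rule openin_spectrum_subset)

lemma sets_spectrum_borel:
  "sets spectrum_borel = sigma_sets spectrum {U. openin spectrum_topology U}"
  unfolding spectrum_borel_def
  by (rule sets_measure_of) (rule openin_spectrum_subset)

lemma openin_cylinder: "openin spectrum_topology (cylinder s)"
proof -
  have "openin (product_topology (\<lambda>_. discrete_topology {0, 1}) idem_lattice)
      {\<xi> \<in> topspace (product_topology (\<lambda>_. discrete_topology {0, 1}) idem_lattice). \<xi> (idem s) \<in> {1::nat}}"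
    by (rule openin_continuous_map_preimage[OF continuous_map_product_projection]) auto
  moreover have "cylinder s =
      {\<xi> \<in> topspace (product_topology (\<lambda>_. discrete_topology {0, 1}) idem_lattice). \<xi> (idem s) \<in> {1::nat}} \<inter> spectrum"
    by (auto simp: cylinder_def spectrum_def)
  ultimately show ?thesis unfolding spectrum_topology_def openin_subtopology by blast
qed

lemma cylinder_sets [measurable]: "cylinder s \<in> sets spectrum_borel"
  unfolding sets_spectrum_borel using openin_cylinder by blast

text \<open>An open set is a union of basic sets that fix the values at finitely many idempotents.
  Only countably many finite sets of idempotents exist, so the union is countable, and each basic
  set is a finite combination of cylinders and complements.\<close>

lemma sets_spectrum_borel_cylinders:
  assumes count: "countable (UNIV :: 'a::right_lcm_semigroup set)"
  shows "sets (spectrum_borel :: (('a \<rightharpoonup> 'a) \<Rightarrow> nat) measure) = sigma_sets spectrum (range cylinder)"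
    (is "_ = ?S")
proof
  interpret S: sigma_algebra spectrum ?S
    by (rule sigma_algebra_sigma_sets) (use cylinder_subset in auto)
  have cl: "countable (idem_lattice :: ('a \<rightharpoonup> 'a) set)"
    unfolding idem_lattice_def using count by (simp add: countable_image)
  \<comment> \<open>\<open>B (J, A)\<close> is the basic open set of characters that take the value
    1 on J exactly at A.\<close>
  define B where "B JA = {\<xi> \<in> spectrum. \<forall>j\<in>fst JA. \<xi> j = Suc 0 \<longleftrightarrow> j \<in> snd JA}"
    for JA :: "('a \<rightharpoonup> 'a) set \<times> ('a \<rightharpoonup> 'a) set"
  have single: "{\<xi> \<in> spectrum. \<xi> j = Suc 0 \<longleftrightarrow> b} \<in> ?S" if j: "j \<in> idem_lattice" for j b
  proof -
    have "{\<xi> \<in> spectrum. \<xi> j = Suc 0} \<in> ?S"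
    proof (cases "j = Map.empty")
      case True
      then have "{\<xi> \<in> spectrum. \<xi> j = Suc 0} = {}" by (auto dest: spectrum_empty)
      then show ?thesis by (simp only: S.empty_sets)
    next
      case False
      then obtain s where "j = idem s" using j by (auto simp: idem_lattice_def)
      then have "{\<xi> \<in> spectrum. \<xi> j = Suc 0} = cylinder s" by (simp add: cylinder_def)
      then show ?thesis by auto
    qed
    moreover from this have "spectrum - {\<xi> \<in> spectrum. \<xi> j = Suc 0} \<in> ?S" by (rule S.compl_sets)
    moreover have "spectrum - {\<xi> \<in> spectrum. \<xi> j = Suc 0} = {\<xi> \<in> spectrum. \<xi> j \<noteq> Suc 0}" by auto
    ultimately show ?thesis by (cases b) simp_all
  qed
  have B: "B JA \<in> ?S" if "finite (fst JA)" "fst JA \<subseteq> idem_lattice" for JA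
  proof -
    have "B JA = spectrum \<inter> (\<Inter>j\<in>fst JA. {\<xi> \<in> spectrum. \<xi> j = Suc 0 \<longleftrightarrow> j \<in> snd JA})"
      by (auto simp: B_def)
    also have "\<dots> \<in> ?S"
      using that single by (cases "fst JA = {}") (auto intro!: S.finite_INT S.Int)
    finally show ?thesis .
  qed
  define I where "I = {J :: ('a \<rightharpoonup> 'a) set. finite J \<and> J \<subseteq> idem_lattice}"
  have cI: "countable I" unfolding I_def using countable_Collect_finite_subset[OF cl] .
  have "U \<in> ?S" if U: "openin spectrum_topology U" for U
  proof -
    let ?K = "{JA \<in> I \<times> I. B JA \<subseteq> U}"
    obtain T where T: "openin (product_topology (\<lambda>_. discrete_topology {0, 1}) idem_lattice) T"
      and UT: "U = T \<inter> spectrum"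
      using U unfolding spectrum_topology_def openin_subtopology by blast
    have "U = (\<Union>JA\<in>?K. B JA)"
    proof
      show "U \<subseteq> (\<Union>JA\<in>?K. B JA)"
      proof
        fix \<xi> assume \<xi>: "\<xi> \<in> U"
        have "\<forall>x\<in>T. \<exists>W. finite {i \<in> idem_lattice. W i \<noteq> topspace (discrete_topology {0, 1::nat})} \<and>
            (\<forall>i\<in>idem_lattice. openin (discrete_topology {0, 1}) (W i)) \<and>
            x \<in> Pi\<^sub>E idem_lattice W \<and> Pi\<^sub>E idem_lattice W \<subseteq> T"
          using T by (rule openin_product_topology_alt[THEN iffD1])
        moreover have "\<xi> \<in> T" using \<xi> UT by blast
        ultimately obtain W where W: "finite {i \<in> idem_lattice. W i \<noteq> {0, 1::nat}}"
          "\<xi> \<in> Pi\<^sub>E idem_lattice W" "Pi\<^sub>E idem_lattice W \<subseteq> T"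
          unfolding topspace_discrete_topology by blast
        define J where "J = {i \<in> idem_lattice. W i \<noteq> {0, 1::nat}}"
        define A where "A = {j \<in> J. \<xi> j = Suc 0}"
        have "B (J, A) \<subseteq> U"
        proof
          fix \<eta> assume \<eta>: "\<eta> \<in> B (J, A)"
          then have sp: "\<eta> \<in> spectrum" "\<xi> \<in> spectrum" using \<xi> UT by (auto simp: B_def)
          have "\<eta> j \<in> W j" if j: "j \<in> idem_lattice" for j
          proof (cases "j \<in> J")
            case True
            then have "\<eta> j = \<xi> j"
              using \<eta> spectrum_values[OF sp(1) j] spectrum_values[OF sp(2) j] by (auto simp: B_def A_def)
            then show ?thesis using W(2) j by auto
          next
            case False
            then show ?thesis using spectrum_values[OF sp(1) j] j by (simp add: J_def)
          qed
          then have "\<eta> \<in> Pi\<^sub>E idem_lattice W"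
            using sp(1) by (auto simp: spectrum_def PiE_def)
          then show "\<eta> \<in> U" using W(3) sp UT by auto
        qed
        moreover have "(J, A) \<in> I \<times> I"
        proof -
          have "finite J" using W(1) unfolding J_def .
          moreover have "J \<subseteq> idem_lattice" unfolding J_def by blast
          moreover have "A \<subseteq> J" unfolding A_def by blast
          ultimately show ?thesis using finite_subset[of A J] unfolding I_def by blast
        qed
        moreover have "\<xi> \<in> B (J, A)" using \<xi> UT unfolding B_def A_def by simp
        ultimately show "\<xi> \<in> (\<Union>JA\<in>?K. B JA)" by blast
      qed
    qed auto
    moreover have "(\<Union>JA\<in>?K. B JA) \<in> ?S"
    proof (rule S.countable_UN'')
      show "countable ?K" by (rule countable_subset[of _ "I \<times> I"]) (use cI in auto)
    qed (use B in \<open>auto simp: I_def\<close>)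
    ultimately show ?thesis by (simp only:)
  qed
  then show "sets (spectrum_borel :: (('a \<rightharpoonup> 'a) \<Rightarrow> nat) measure) \<subseteq> ?S"
    unfolding sets_spectrum_borel by (intro sigma_sets_mono) auto
  show "?S \<subseteq> sets (spectrum_borel :: (('a \<rightharpoonup> 'a) \<Rightarrow> nat) measure)"
    using sets.sigma_sets_subset[of "range cylinder" spectrum_borel] cylinder_sets
    by (simp add: image_subset_iff)
qed

text \<open>The empty set is added because disjoint ideals have disjoint cylinders.\<close>

lemma Int_stable_cylinders: "Int_stable (insert {} (range cylinder))"
proof (rule Int_stableI)
  fix A B :: "(('a \<rightharpoonup> 'a) \<Rightarrow> nat) set"
  assume AB: "A \<in> insert {} (range cylinder)" "B \<in> insert {} (range cylinder)"
  have "cylinder s \<inter> cylinder t \<in> insert {} (range cylinder)" for s t :: 'a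
  proof (cases rule: rideal_Int_cases[of s t])
    case 1
    then show ?thesis by (simp only: cylinder_disjoint insertI1)
  next
    case (2 r)
    then show ?thesis by (simp only: cylinder_Int rangeI insertI2)
  qed
  then show "A \<inter> B \<in> insert {} (range cylinder)" using AB by auto
qed

text \<open>Uniqueness on an intersection-stable generator; the exhausting sequence is constant,
  since the whole spectrum is the cylinder of 1.\<close>

lemma spectrum_measure_eqI:
  fixes \<mu> \<nu> :: "(('a::right_lcm_semigroup \<rightharpoonup> 'a) \<Rightarrow> nat) measure"
  assumes count: "countable (UNIV :: 'a set)"
    and sets: "sets \<mu> = sets spectrum_borel" "sets \<nu> = sets spectrum_borel"
    and fin: "emeasure \<mu> spectrum \<noteq> \<infinity>"
    and eq: "\<And>s. emeasure \<mu> (cylinder s) = emeasure \<nu> (cylinder s)"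
  shows "\<mu> = \<nu>"
proof (rule measure_eqI_generator_eq[where E = "insert {} (range cylinder)" and \<Omega> = spectrum
      and A = "\<lambda>_. spectrum"])
  have "sigma_sets spectrum (insert {} (range cylinder)) = sigma_sets spectrum (range (cylinder :: 'a \<Rightarrow> _))"
  proof (rule sigma_sets_eqI)
    fix A :: "(('a \<rightharpoonup> 'a) \<Rightarrow> nat) set" assume "A \<in> insert {} (range cylinder)"
    then show "A \<in> sigma_sets spectrum (range cylinder)"
      using sigma_sets.Empty sigma_sets.Basic by blast
  next
    fix A :: "(('a \<rightharpoonup> 'a) \<Rightarrow> nat) set" assume "A \<in> range cylinder"
    then show "A \<in> sigma_sets spectrum (insert {} (range cylinder))"
      by (intro sigma_sets.Basic insertI2)
  qed
  then show "sets \<mu> = sigma_sets spectrum (insert {} (range cylinder))"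
    "sets \<nu> = sigma_sets spectrum (insert {} (range cylinder))"
    using sets sets_spectrum_borel_cylinders[OF count] by (simp_all only:)
  show "range (\<lambda>_::nat. spectrum) \<subseteq> insert {} (range (cylinder :: 'a \<Rightarrow> _))"
    using rangeI[of cylinder "1::'a"] unfolding cylinder_one by blast
  show "insert {} (range cylinder) \<subseteq> Pow (spectrum :: (('a \<rightharpoonup> 'a) \<Rightarrow> nat) set)"
    using cylinder_subset by blast
  show "emeasure \<mu> X = emeasure \<nu> X" if "X \<in> insert {} (range cylinder)" for X
    using that eq by auto
qed (use fin Int_stable_cylinders in simp_all)

section \<open>Measurability of translations\<close>

lemma measurable_into_spectrum:
  assumes count: "countable (UNIV :: 'a::right_lcm_semigroup set)"
    and "\<And>x. x \<in> space M \<Longrightarrow> f x \<in> (spectrum :: (('a \<rightharpoonup> 'a) \<Rightarrow> nat) set)"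
    and "\<And>s. {x \<in> space M. f x \<in> cylinder s} \<in> sets M"
  shows "f \<in> measurable M spectrum_borel"
proof (rule measurable_sigma_sets[OF sets_spectrum_borel_cylinders[OF count]])
  fix y :: "(('a \<rightharpoonup> 'a) \<Rightarrow> nat) set" assume "y \<in> range cylinder"
  then obtain s where "y = cylinder s" by blast
  then have "f -` y \<inter> space M = {x \<in> space M. f x \<in> cylinder s}" by blast
  then show "f -` y \<inter> space M \<in> sets M" using assms(3) by (simp only:)
next
  show "range cylinder \<subseteq> Pow (spectrum :: (('a \<rightharpoonup> 'a) \<Rightarrow> nat) set)"
    using cylinder_subset by blast
qed (use assms(2) in blast)

text \<open>The preimage of the cylinder of t is the cylinder of \<open>s * t\<close>.\<close>

lemma spectrum_inv_measurable:
  assumes count: "countable (UNIV :: 'a::right_lcm_semigroup set)"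
  shows "spectrum_inv s \<in> measurable (restrict_space spectrum_borel (cylinder s))
    (spectrum_borel :: (('a \<rightharpoonup> 'a) \<Rightarrow> nat) measure)"
proof (rule measurable_into_spectrum[OF count])
  have sp: "space (restrict_space spectrum_borel (cylinder s)) = cylinder s"
    using cylinder_subset[of s] by (auto simp: space_restrict_space)
  show "spectrum_inv s x \<in> spectrum" if "x \<in> space (restrict_space spectrum_borel (cylinder s))" for x
    using that unfolding sp by (rule spectrum_inv_in_spectrum)
  show "{x \<in> space (restrict_space spectrum_borel (cylinder s)). spectrum_inv s x \<in> cylinder t} \<in>
      sets (restrict_space spectrum_borel (cylinder s))" for t
  proof -
    have eq: "{x \<in> space (restrict_space spectrum_borel (cylinder s)). spectrum_inv s x \<in> cylinder t} =
        cylinder (s * t)"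
      unfolding sp spectrum_act_image[OF cylinder_subset, symmetric] spectrum_act_cylinder_image ..
    have "cylinder (s * t) \<subseteq> cylinder s"
      unfolding spectrum_act_cylinder_image[symmetric]
      by (intro image_subsetI spectrum_act_cylinder) (rule cylinder_subset[THEN subsetD])
    then show ?thesis
      unfolding eq by (subst sets_restrict_space_iff) (auto simp: cylinder_subset Int_absorb2)
  qed
qed

lemma spectrum_act_image_sets:
  assumes count: "countable (UNIV :: 'a::right_lcm_semigroup set)"
    and A: "A \<in> sets (spectrum_borel :: (('a \<rightharpoonup> 'a) \<Rightarrow> nat) measure)"
  shows "spectrum_act s ` A \<in> sets spectrum_borel"
proof -
  have "A \<subseteq> spectrum" using sets.sets_into_space[OF A] by simp
  then have "spectrum_act s ` A =
      spectrum_inv s -` A \<inter> space (restrict_space spectrum_borel (cylinder s))"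
    using cylinder_subset[of s] by (auto simp: spectrum_act_image space_restrict_space)
  also have "\<dots> \<in> sets (restrict_space spectrum_borel (cylinder s))"
    by (rule measurable_sets[OF spectrum_inv_measurable[OF count] A])
  finally show ?thesis
    by (subst (asm) sets_restrict_space_iff) (auto simp: cylinder_subset Int_absorb2)
qed

lemma spectrum_act_measurable:
  assumes count: "countable (UNIV :: 'a::right_lcm_semigroup set)"
  shows "spectrum_act s \<in> measurable spectrum_borel (spectrum_borel :: (('a \<rightharpoonup> 'a) \<Rightarrow> nat) measure)"
proof (rule measurable_into_spectrum[OF count])
  fix t
  show "{\<xi> \<in> space spectrum_borel. spectrum_act s \<xi> \<in> cylinder t} \<in> sets spectrum_borel"
  proof (cases rule: rideal_Int_cases_left[of s t])
    case 1
    then have "{\<xi> \<in> space spectrum_borel. spectrum_act s \<xi> \<in> cylinder t} = {}"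
      by (auto simp: cylinder_def spectrum_act_idem_disjoint)
    then show ?thesis by (simp only: sets.empty_sets)
  next
    case (2 r)
    then have "{\<xi> \<in> space spectrum_borel. spectrum_act s \<xi> \<in> cylinder t} = cylinder r"
      using spectrum_act_in_spectrum by (auto simp: cylinder_def spectrum_act_idem)
    then show ?thesis by (simp only: cylinder_sets)
  qed
qed (simp add: spectrum_act_in_spectrum)

section \<open>Uniqueness, values and existence of scaling measures\<close>

context lcm_scale
begin

text \<open>Scaling is an equality of two finite measures in \<open>A\<close>, so it suffices to test it on the
  cylinders, where \<open>\<lambda>\<^sub>s \<cdot> Z\<^sub>t = Z\<^sub>s\<^sub>t\<close>.\<close>

lemma scaling_measure_iff_cylinders:
  assumes count: "countable (UNIV :: 'a set)"
  shows "scaling_measure N \<beta> \<mu> \<longleftrightarrow>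
    prob_space \<mu> \<and> sets \<mu> = sets spectrum_borel \<and> (\<forall>s. measure \<mu> (cylinder s) = N s powr (- \<beta>))"
    (is "_ \<longleftrightarrow> ?R")
proof
  assume \<mu>: "scaling_measure N \<beta> \<mu>"
  then interpret prob_space \<mu> by (simp add: scaling_measure_def)
  have sp: "space \<mu> = spectrum" using \<mu> by (simp add: scaling_measure_def)
  have "spectrum \<in> sets (spectrum_borel :: (('a \<rightharpoonup> 'a) \<Rightarrow> nat) measure)"
    using cylinder_sets[of "1::'a"] by (simp only: cylinder_one)
  then have "measure \<mu> (spectrum_act s ` spectrum) = N s powr (- \<beta>) * measure \<mu> spectrum" for s
    using \<mu> by (simp add: scaling_measure_def)
  moreover have "measure \<mu> spectrum = 1" using prob_space unfolding sp .
  ultimately show ?R using \<mu> by (simp add: scaling_measure_def spectrum_act_spectrum)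
next
  assume R: ?R
  then interpret prob_space \<mu> by simp
  have sets: "sets \<mu> = sets spectrum_borel" and cyl: "\<And>s. measure \<mu> (cylinder s) = N s powr (- \<beta>)"
    using R by auto
  have sp: "space \<mu> = spectrum" using sets_eq_imp_space_eq[OF sets] by simp
  have act: "measure \<mu> (spectrum_act s ` A) = N s powr (- \<beta>) * measure \<mu> A"
    if A: "A \<in> sets spectrum_borel" for s A
  proof -
    \<comment> \<open>The measure of the translate of a set by s is the push-forward of the
      restriction of \<mu> to the cylinder of s along \<open>spectrum_inv s\<close>; it is compared
      with a multiple of \<mu>.\<close>
    let ?R = "restrict_space \<mu> (cylinder s)"
    have inv: "spectrum_inv s \<in> measurable ?R spectrum_borel"
      using spectrum_inv_measurable[OF count, of s]
      by (simp add: measurable_cong_sets[OF sets_restrict_space_cong[OF sets] refl])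
    have em: "emeasure (distr ?R spectrum_borel (spectrum_inv s)) B = emeasure \<mu> (spectrum_act s ` B)"
      if B: "B \<in> sets spectrum_borel" for B
    proof -
      have Bs: "B \<subseteq> spectrum" using sets.sets_into_space[OF B] by simp
      have "emeasure (distr ?R spectrum_borel (spectrum_inv s)) B =
          emeasure ?R (spectrum_inv s -` B \<inter> space ?R)"
        by (rule emeasure_distr[OF inv B])
      also have "spectrum_inv s -` B \<inter> space ?R = spectrum_act s ` B"
        using cylinder_subset[of s] by (auto simp: spectrum_act_image[OF Bs] space_restrict_space sp)
      also have "emeasure ?R (spectrum_act s ` B) = emeasure \<mu> (spectrum_act s ` B)"
        using spectrum_act_image[OF Bs, of s] cylinder_subset[of s]
        by (intro emeasure_restrict_space) (auto simp: sp sets Int_absorb2)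
      finally show ?thesis .
    qed
    have cyl': "emeasure \<mu> (cylinder t) = ennreal (N t powr (- \<beta>))" for t
      by (simp add: emeasure_eq_measure cyl)
    have "distr ?R spectrum_borel (spectrum_inv s) = scale_measure (ennreal (N s powr (- \<beta>))) \<mu>"
    proof (rule spectrum_measure_eqI[OF count])
      show "emeasure (distr ?R spectrum_borel (spectrum_inv s)) (cylinder t) =
          emeasure (scale_measure (ennreal (N s powr (- \<beta>))) \<mu>) (cylinder t)" for t
        using scale_pos by (simp add: em spectrum_act_cylinder_image cyl' scale_mult powr_mult less_imp_le
            ennreal_mult)
      have "emeasure (distr ?R spectrum_borel (spectrum_inv s)) (cylinder 1) \<noteq> \<infinity>"
        using emeasure_finite by (simp add: em[OF cylinder_sets] del: cylinder_one)
      then show "emeasure (distr ?R spectrum_borel (spectrum_inv s)) spectrum \<noteq> \<infinity>"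
        by (simp only: cylinder_one) simp
    qed (simp_all add: sets)
    then have "emeasure \<mu> (spectrum_act s ` A) = ennreal (N s powr (- \<beta>)) * emeasure \<mu> A"
      using em[OF A] by simp
    then show ?thesis
      by (simp add: emeasure_eq_measure ennreal_mult[symmetric])
  qed
  show "scaling_measure N \<beta> \<mu>"
    unfolding scaling_measure_def using R sp act by blast
qed

lemma scaling_measure_unique:
  assumes count: "countable (UNIV :: 'a set)"
    and "scaling_measure N \<beta> \<mu>" "scaling_measure N \<beta> \<nu>"
  shows "\<mu> = \<nu>"
proof (rule spectrum_measure_eqI[OF count])
  interpret \<mu>: prob_space \<mu> using assms(2) by (simp add: scaling_measure_def)
  interpret \<nu>: prob_space \<nu> using assms(3) by (simp add: scaling_measure_def)
  show "sets \<mu> = sets spectrum_borel" "sets \<nu> = sets spectrum_borel"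
    using assms(2,3) by (auto simp: scaling_measure_def)
  show "emeasure \<mu> spectrum \<noteq> \<infinity>" by simp
  show "emeasure \<mu> (cylinder s) = emeasure \<nu> (cylinder s)" for s
    using assms(2,3)
    by (simp add: scaling_measure_iff_cylinders[OF count] \<mu>.emeasure_eq_measure \<nu>.emeasure_eq_measure)
qed

lemma measure_INT_cylinder:
  assumes count: "countable (UNIV :: 'a set)" and \<mu>: "scaling_measure N \<beta> \<mu>" and "finite A"
  shows "measure \<mu> (spectrum \<inter> (\<Inter>t\<in>A. cylinder t)) = meet_weight N \<beta> A"
proof -
  \<comment> \<open>Intersections of cylinders mirror those of ideals. The factor
    \<open>spectrum\<close> gives empty A its correct value; a generator of S other than 1 may occur
    there, so its cylinder must be identified with the whole spectrum.\<close>
  have INT: "((\<Inter>t\<in>A. rideal t) = {} \<longrightarrow> spectrum \<inter> (\<Inter>t\<in>A. cylinder t) = {}) \<and>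
      (\<forall>q. (\<Inter>t\<in>A. rideal t) = rideal q \<longrightarrow> spectrum \<inter> (\<Inter>t\<in>A. cylinder t) = cylinder q)"
    using \<open>finite A\<close>
  proof (induction A rule: finite_induct)
    case empty
    have "spectrum = cylinder q" if "UNIV = rideal q" for q :: 'a
      using cylinder_Int[of 1 1 q] that by simp
    then show ?case by simp
  next
    case (insert x A)
    have eq: "spectrum \<inter> (\<Inter>t\<in>insert x A. cylinder t) = cylinder x \<inter> (spectrum \<inter> (\<Inter>t\<in>A. cylinder t))"
      by auto
    show ?case
    proof (rule rideal_INT_cases[OF insert.hyps(1)])
      assume "(\<Inter>t\<in>A. rideal t) = {}"
      moreover from this have "spectrum \<inter> (\<Inter>t\<in>A. cylinder t) = {}" using insert.IH by blast
      ultimately show ?thesis unfolding eq by simp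
    next
      fix q assume q: "(\<Inter>t\<in>A. rideal t) = rideal q"
      then have "spectrum \<inter> (\<Inter>t\<in>A. cylinder t) = cylinder q" using insert.IH by blast
      moreover have "(\<Inter>t\<in>insert x A. rideal t) = rideal x \<inter> rideal q" using q by auto
      ultimately show ?thesis
        unfolding eq using cylinder_Int[of x q] cylinder_disjoint[of x q] by simp
    qed
  qed
  show ?thesis
  proof (rule rideal_INT_cases[OF \<open>finite A\<close>])
    assume "(\<Inter>t\<in>A. rideal t) = {}"
    then show ?thesis using INT by (simp add: meet_weight_None)
  next
    fix q assume q: "(\<Inter>t\<in>A. rideal t) = rideal q"
    then show ?thesis
      using INT \<mu> by (simp add: meet_weight_Some[OF q] scaling_measure_iff_cylinders[OF count])
  qed
qed

lemma measure_cylinder_diff: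
  assumes count: "countable (UNIV :: 'a set)" and \<mu>: "scaling_measure N \<beta> \<mu>" and "finite F"
  shows "measure \<mu> (cylinder_diff s F) = alt_sum (\<lambda>A. meet_weight N \<beta> (insert s A)) F"
proof -
  interpret prob_space \<mu> using \<mu> by (simp add: scaling_measure_def)
  have sets: "sets \<mu> = sets spectrum_borel" using \<mu> by (simp add: scaling_measure_def)
  have "measure \<mu> (cylinder_diff s F) =
      alt_sum (\<lambda>A. measure \<mu> (cylinder s \<inter> (\<Inter>t\<in>A. cylinder t))) F"
    unfolding cylinder_diff_def using \<open>finite F\<close>
    by (rule measure_Diff_UN) (simp_all add: sets cylinder_sets)
  also have "\<dots> = alt_sum (\<lambda>A. meet_weight N \<beta> (insert s A)) F"
  proof (rule alt_sum_cong)
    fix A assume "A \<subseteq> F"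
    then have "finite (insert s A)" using \<open>finite F\<close> finite_subset by blast
    moreover have "cylinder s \<inter> (\<Inter>t\<in>A. cylinder t) = spectrum \<inter> (\<Inter>t\<in>insert s A. cylinder t)"
      using cylinder_subset[of s] by auto
    ultimately show "measure \<mu> (cylinder s \<inter> (\<Inter>t\<in>A. cylinder t)) = meet_weight N \<beta> (insert s A)"
      using measure_INT_cylinder[OF count \<mu>, of "insert s A"] by (simp only:)
  qed
  finally show ?thesis .
qed

lemma scaling_measure_imp_nonneg:
  assumes count: "countable (UNIV :: 'a set)" and \<mu>: "scaling_measure N \<beta> \<mu>" and F: "finite F"
  shows "0 \<le> alt_sum (meet_weight N \<beta>) F"
proof -
  have "meet_weight N \<beta> (insert 1 A) = meet_weight N \<beta> A" for A
    unfolding meet_weight_def by simp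
  then have "alt_sum (meet_weight N \<beta>) F = measure \<mu> (cylinder_diff 1 F)"
    using measure_cylinder_diff[OF count \<mu> F, of 1] by simp
  then show ?thesis by simp
qed

lemma ex_scaling_measure:
  assumes count: "countable (UNIV :: 'a set)"
    and pos: "\<And>F. finite F \<Longrightarrow> 0 \<le> alt_sum (meet_weight N \<beta>) F"
  shows "\<exists>\<mu>. scaling_measure N \<beta> \<mu>"
proof -
  obtain M :: "('a \<Rightarrow> real) measure" and E where M: "prob_space M" and E: "\<And>s. E s \<in> sets M"
    and joint: "\<And>A. finite A \<Longrightarrow> measure M {x \<in> space M. \<forall>s\<in>A. x \<in> E s} = meet_weight N \<beta> A"
  proof (rule events_with_joint_probabilities[of "meet_weight N \<beta>"])
    show "0 \<le> alt_sum (\<lambda>K. meet_weight N \<beta> (A \<union> K)) B" if "finite A" "finite B" for A B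
      by (rule alt_sum_meet_weight_nonneg[OF pos that])
  qed (use that in \<open>simp, blast\<close>)
  interpret prob_space M by (rule M)
  define X where "X x s \<longleftrightarrow> x \<in> E s" for x s
  have Xm [measurable]: "Measurable.pred M (\<lambda>x. X x s)" for s
    unfolding X_def using E by (simp add: pred_sets2)
  have jointX: "measure M {x \<in> space M. \<forall>s\<in>A. X x s} = meet_weight N \<beta> A" if "finite A" for A
    unfolding X_def by (rule joint[OF that])
  have ev [measurable]: "Measurable.pred M (\<lambda>x. \<forall>s\<in>A. X x s)" if "finite A" for A
    using that by measurable
  \<comment> \<open>If adjoining B leaves the weight unchanged, then the event for A and its part on
    which B also holds have equal probability, so they differ by a null set. All relations between
    the events come from such equalities of weights.\<close>
  have imp: "AE x in M. (\<forall>s\<in>A. X x s) \<longrightarrow> (\<forall>s\<in>B. X x s)"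
    if A: "finite A" and B: "finite B" and eq: "meet_weight N \<beta> (A \<union> B) = meet_weight N \<beta> A" for A B
  proof (rule AE_I[of _ _ "{x \<in> space M. \<forall>s\<in>A. X x s} - {x \<in> space M. \<forall>s\<in>A \<union> B. X x s}"])
    have sets: "{x \<in> space M. \<forall>s\<in>C. X x s} \<in> sets M" if "finite C" for C
      using ev[OF that] by (simp add: pred_def)
    show diff: "{x \<in> space M. \<forall>s\<in>A. X x s} - {x \<in> space M. \<forall>s\<in>A \<union> B. X x s} \<in> sets M"
      using A B by (intro sets.Diff sets) auto
    have "measure M ({x \<in> space M. \<forall>s\<in>A. X x s} - {x \<in> space M. \<forall>s\<in>A \<union> B. X x s}) =
        meet_weight N \<beta> A - meet_weight N \<beta> (A \<union> B)"
      using A B jointX[of A] jointX[of "A \<union> B"] sets[of A] sets[of "A \<union> B"]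
      by (subst finite_measure_Diff) auto
    then show "emeasure M ({x \<in> space M. \<forall>s\<in>A. X x s} - {x \<in> space M. \<forall>s\<in>A \<union> B. X x s}) = 0"
      using eq by (simp add: emeasure_eq_measure)
  qed auto
  have one: "AE x in M. X x 1"
    using imp[of "{}" "{1}"] by simp
  have meet: "AE x in M. X x t \<longleftrightarrow> X x r \<and> X x s" if rst: "rideal r \<inter> rideal s = rideal t" for r s t
  proof -
    have "(\<Inter>u\<in>{t} \<union> {r, s}. rideal u) = rideal t" "(\<Inter>u\<in>{r, s}. rideal u) = rideal t"
      "(\<Inter>u\<in>{r, s} \<union> {t}. rideal u) = rideal t"
      using rst by auto
    then have "meet_weight N \<beta> ({t} \<union> {r, s}) = meet_weight N \<beta> {t}"
      "meet_weight N \<beta> ({r, s} \<union> {t}) = meet_weight N \<beta> {r, s}"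
      by (simp_all only: meet_weight_Some meet_weight_singleton)
    then have "AE x in M. (\<forall>u\<in>{t}. X x u) \<longrightarrow> (\<forall>u\<in>{r, s}. X x u)"
      "AE x in M. (\<forall>u\<in>{r, s}. X x u) \<longrightarrow> (\<forall>u\<in>{t}. X x u)"
      by (auto simp only: intro!: imp)
    then show ?thesis by (rule eventually_elim2) blast
  qed
  have disj: "AE x in M. \<not> (X x r \<and> X x s)" if rs: "rideal r \<inter> rideal s = {}" for r s
  proof (rule AE_I[of _ _ "{x \<in> space M. \<forall>u\<in>{r, s}. X x u}"])
    have "measure M {x \<in> space M. \<forall>u\<in>{r, s}. X x u} = meet_weight N \<beta> {r, s}"
      by (rule jointX) simp
    also have "\<dots> = 0" by (rule meet_weight_None) (use rs in simp)
    finally have "measure M {x \<in> space M. \<forall>u\<in>{r, s}. X x u} = 0" .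
    then show "emeasure M {x \<in> space M. \<forall>u\<in>{r, s}. X x u} = 0"
      by (simp add: emeasure_eq_measure)
    show "{x \<in> space M. \<forall>u\<in>{r, s}. X x u} \<in> sets M" using ev[of "{r, s}"] by (simp add: pred_def)
  qed auto
  \<comment> \<open>Countably many relations, each almost sure, hold simultaneously outside one null
    set.\<close>
  have "countable (UNIV \<times> UNIV :: ('a \<times> 'a) set)" "countable (UNIV \<times> UNIV \<times> UNIV :: ('a \<times> 'a \<times> 'a) set)"
    using count by (intro countable_SIGMA; assumption)+
  then have cS: "countable T" "countable T'" for T :: "('a \<times> 'a \<times> 'a) set" and T' :: "('a \<times> 'a) set"
    by (auto intro: countable_subset[rotated])
  have "AE x in M. \<forall>(r, s, t)\<in>{(r, s, t). rideal r \<inter> rideal s = rideal t}. X x t \<longleftrightarrow> X x r \<and> X x s"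
    by (rule AE_ball_countable'[OF _ cS(1)]) (use meet in auto)
  moreover have "AE x in M. \<forall>(r, s)\<in>{(r, s). rideal r \<inter> rideal s = {}}. \<not> (X x r \<and> X x s)"
    by (rule AE_ball_countable'[OF _ cS(2)]) (use disj in auto)
  ultimately have "AE x in M. ideal_filter (X x)"
    using one unfolding ideal_filter_def by eventually_elim blast
  then obtain Z where Z: "{x \<in> space M. \<not> ideal_filter (X x)} \<subseteq> Z" "emeasure M Z = 0" "Z \<in> sets M"
    by (rule AE_E)
  \<comment> \<open>On the null set Z the filter is replaced by the principal filter of 1, so that f
    takes values in the spectrum everywhere.\<close>
  define f where "f x = filter_char (if x \<in> Z then \<lambda>s. 1 \<in> rideal s else X x)" for x
  have filter: "ideal_filter (if x \<in> Z then \<lambda>s. 1 \<in> rideal s else X x)" if "x \<in> space M" for x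
    using that Z(1) ideal_filter_principal[of 1] by auto
  have f_cyl: "f x \<in> cylinder s \<longleftrightarrow> (if x \<in> Z then 1 \<in> rideal s else X x s)" if "x \<in> space M" for x s
    using filter_char_spectrum[OF filter[OF that]] filter_char_idem[OF filter[OF that], of s]
    unfolding f_def cylinder_def by simp
  have f: "f \<in> measurable M spectrum_borel"
  proof (rule measurable_into_spectrum[OF count])
    show "f x \<in> spectrum" if "x \<in> space M" for x
      unfolding f_def by (rule filter_char_spectrum[OF filter[OF that]])
    fix s
    have "{x \<in> space M. f x \<in> cylinder s} =
        {x \<in> space M. if x \<in> Z then 1 \<in> rideal s else X x s}"
      using f_cyl by (intro Collect_cong conj_cong refl)
    also have "\<dots> \<in> sets M"
      using Xm[of s] Z(3) by measurable
    finally show "{x \<in> space M. f x \<in> cylinder s} \<in> sets M" .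
  qed
  have "scaling_measure N \<beta> (distr M spectrum_borel f)"
    unfolding scaling_measure_iff_cylinders[OF count]
  proof (intro conjI allI)
    show "prob_space (distr M spectrum_borel f)" by (rule prob_space_distr[OF f])
    fix s
    have X1: "{x \<in> space M. X x s} \<in> sets M" using Xm[of s] by (simp add: pred_def)
    have "measure (distr M spectrum_borel f) (cylinder s) = measure M (f -` cylinder s \<inter> space M)"
      by (rule measure_distr[OF f cylinder_sets])
    also have "\<dots> = measure M {x \<in> space M. X x s}"
    proof (rule measure_eq_AE)
      have "AE x in M. x \<notin> Z" using Z(2,3) by (intro AE_not_in) auto
      with AE_space show "AE x in M. x \<in> f -` cylinder s \<inter> space M \<longleftrightarrow> x \<in> {x \<in> space M. X x s}"
        by eventually_elim (simp add: f_cyl)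
    qed (use measurable_sets[OF f cylinder_sets] X1 in auto)
    also have "\<dots> = N s powr (- \<beta>)" using jointX[of "{s}"] by simp
    finally show "measure (distr M spectrum_borel f) (cylinder s) = N s powr (- \<beta>)" .
  qed simp
  then show ?thesis by blast
qed

end

section \<open>KMS states restricted to the range projections\<close>

lemma entire_eq_on_reals:
  assumes f: "f holomorphic_on UNIV" and g: "g holomorphic_on UNIV"
    and eq: "\<And>t::real. f (of_real t) = g (of_real t)"
  shows "f z = g z"
proof -
  have "f z - g z = 0"
  proof (rule analytic_continuation[where f = "\<lambda>z. f z - g z" and w = z and S = UNIV and
        U = "range of_real" and \<xi> = 0])
    show "(\<lambda>z. f z - g z) holomorphic_on UNIV" by (intro holomorphic_intros f g)
    show "(0::complex) islimpt range of_real"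
      unfolding islimpt_approachable
    proof (intro allI impI)
      fix e :: real assume e: "0 < e"
      then have "dist (of_real (e / 2)) (0::complex) < e" by simp
      moreover have "of_real (e / 2) \<noteq> (0::complex)" using e by simp
      ultimately show "\<exists>x'\<in>range of_real. x' \<noteq> (0::complex) \<and> dist x' 0 < e" by blast
    qed
    show "f z - g z = 0" if "z \<in> range of_real" for z using that eq by auto
  qed auto
  then show ?thesis by simp
qed

text \<open>A primitive of \<open>h\<close> grows like \<open>c t\<close> and \<open>c' t\<close> along the edges of the strip, up to errors
  \<open>\<delta> t\<close> and \<open>\<delta>' t\<close>, while its difference across the strip stays bounded.\<close>

lemma entire_strip_edges:
  fixes h :: "complex \<Rightarrow> complex" and \<beta> :: real
  assumes h: "h holomorphic_on UNIV" and \<beta>: "0 \<le> \<beta>"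
    and lower: "\<And>t::real. cmod (h (of_real t) - c) \<le> \<delta>"
    and upper: "\<And>t::real. cmod (h (of_real t + \<i> * of_real \<beta>) - c') \<le> \<delta>'"
    and bdd: "\<And>t y::real. 0 \<le> y \<Longrightarrow> y \<le> \<beta> \<Longrightarrow> cmod (h (of_real t + \<i> * of_real y)) \<le> M"
  shows "cmod (c - c') \<le> \<delta> + \<delta>'"
proof (rule ccontr)
  assume "\<not> ?thesis"
  then have e: "0 < cmod (c - c') - (\<delta> + \<delta>')" (is "0 < ?e") by simp
  have M: "0 \<le> M" using bdd[of 0 0] \<beta> norm_ge_zero order_trans by blast
  obtain H where "\<And>z. z \<in> UNIV \<Longrightarrow> (H has_field_derivative h z) (at z within UNIV)"
    using holomorphic_convex_primitive'[OF convex_UNIV open_UNIV h] by blast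
  then have H: "(H has_field_derivative h z) (at z within S)" for z S
    using has_field_derivative_at_within by blast
  \<comment> \<open>Chosen so that \<open>T\<close> times the assumed gap equals
    \<open>2 * (M * \<beta>) + 1\<close>, just beyond the bound that the two vertical sides
    allow.\<close>
  define T where "T = (2 * (M * \<beta>) + 1) / ?e"
  have T: "0 < T" using e M \<beta> by (auto simp: T_def intro!: divide_pos_pos add_nonneg_pos)
  \<comment> \<open>Mean value inequality for \<open>H z - k * z\<close> along a horizontal line,
    where its derivative is at most d.\<close>
  have edge: "cmod ((H (of_real T + \<i> * of_real b) - k * (of_real T + \<i> * of_real b)) -
      (H (\<i> * of_real b) - k * (\<i> * of_real b))) \<le> d * T"
    if "\<And>t::real. cmod (h (of_real t + \<i> * of_real b) - k) \<le> d" for b k d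
  proof -
    let ?S = "{z::complex. Im z = b}"
    have "cmod ((H (of_real T + \<i> * of_real b) - k * (of_real T + \<i> * of_real b)) -
        (H (\<i> * of_real b) - k * (\<i> * of_real b))) \<le>
        d * cmod ((of_real T + \<i> * of_real b) - \<i> * of_real b)"
    proof (rule field_differentiable_bound[of ?S "\<lambda>z. H z - k * z" "\<lambda>z. h z - k"])
      show "convex ?S" by (auto simp: convex_def algebra_simps simp flip: distrib_right)
      show "((\<lambda>z. H z - k * z) has_field_derivative h z - k) (at z within ?S)" for z
        by (auto intro!: derivative_eq_intros H)
      show "cmod (h z - k) \<le> d" if "z \<in> ?S" for z
      proof -
        have "z = of_real (Re z) + \<i> * of_real b" using that by (simp add: complex_eq_iff)
        then show ?thesis using \<open>\<And>t. cmod (h (of_real t + \<i> * of_real b) - k) \<le> d\<close> by metis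
      qed
    qed auto
    then show ?thesis using T by simp
  qed
  have vert: "cmod (H (of_real t + \<i> * of_real \<beta>) - H (of_real t)) \<le> M * \<beta>" for t :: real
  proof -
    let ?S = "{z::complex. Re z = t \<and> 0 \<le> Im z \<and> Im z \<le> \<beta>}"
    have "cmod (H (of_real t + \<i> * of_real \<beta>) - H (of_real t)) \<le>
        M * cmod ((of_real t + \<i> * of_real \<beta>) - of_real t)"
    proof (rule field_differentiable_bound[of ?S H h])
      have "?S = ({z. Re z \<ge> t} \<inter> {z. Re z \<le> t}) \<inter> ({z. Im z \<ge> 0} \<inter> {z. Im z \<le> \<beta>})" by auto
      then show "convex ?S"
        by (simp add: convex_Int convex_halfspace_Im_ge convex_halfspace_Im_le
            convex_halfspace_Re_ge convex_halfspace_Re_le)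
      show "(H has_field_derivative h z) (at z within ?S)" for z by (rule H)
      show "cmod (h z) \<le> M" if "z \<in> ?S" for z
        using bdd[of "Im z" "Re z"] that by (metis (mono_tags, lifting) complex_eq mem_Collect_eq)
    qed (use \<beta> in auto)
    then show ?thesis using \<beta> by (simp add: norm_mult)
  qed
  \<comment> \<open>The corner values of H cancel around the rectangle; only the two linear terms
    survive.\<close>
  have "of_real T * (c - c') =
      - ((H (of_real T + \<i> * of_real 0) - c * (of_real T + \<i> * of_real 0)) -
          (H (\<i> * of_real 0) - c * (\<i> * of_real 0)))
      + ((H (of_real T + \<i> * of_real \<beta>) - c' * (of_real T + \<i> * of_real \<beta>)) -
          (H (\<i> * of_real \<beta>) - c' * (\<i> * of_real \<beta>)))
      + ((H (of_real 0 + \<i> * of_real \<beta>) - H (of_real 0)) - (H (of_real T + \<i> * of_real \<beta>) - H (of_real T)))"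
    by (simp add: algebra_simps)
  also have "cmod \<dots> \<le> \<delta> * T + \<delta>' * T + (M * \<beta> + M * \<beta>)"
  proof (intro order_trans[OF norm_triangle_ineq] add_mono)
    show "cmod (- ((H (of_real T + \<i> * of_real 0) - c * (of_real T + \<i> * of_real 0)) -
          (H (\<i> * of_real 0) - c * (\<i> * of_real 0)))) \<le> \<delta> * T"
      unfolding norm_minus_cancel by (rule edge) (use lower in simp)
    show "cmod ((H (of_real T + \<i> * of_real \<beta>) - c' * (of_real T + \<i> * of_real \<beta>)) -
          (H (\<i> * of_real \<beta>) - c' * (\<i> * of_real \<beta>))) \<le> \<delta>' * T"
      by (rule edge) (rule upper)
    show "cmod ((H (of_real 0 + \<i> * of_real \<beta>) - H (of_real 0)) -
        (H (of_real T + \<i> * of_real \<beta>) - H (of_real T))) \<le> M * \<beta> + M * \<beta>"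
      by (intro order_trans[OF norm_triangle_ineq4] add_mono vert)
  qed
  finally have "T * cmod (c - c') \<le> \<delta> * T + \<delta>' * T + (M * \<beta> + M * \<beta>)"
    using T by (simp add: norm_mult)
  then have "T * ?e \<le> 2 * (M * \<beta>)" by (simp add: algebra_simps)
  moreover have "T * ?e = 2 * (M * \<beta>) + 1" using e by (simp add: T_def)
  ultimately show False by simp
qed

text \<open>The Cauchy-Schwarz inequality for a positive sesquilinear form with values \<open>a\<close>, \<open>b\<close>, \<open>b'\<close>, \<open>d\<close> on
  the pairs \<open>(x, x)\<close>, \<open>(x, y)\<close>, \<open>(y, x)\<close>, \<open>(y, y)\<close>.\<close>

lemma positive_form_Cauchy_Schwarz:
  fixes a b b' d :: complex
  assumes pos: "\<And>l. a + l * b + cnj l * b' + cnj l * l * d \<in> \<real>\<^sub>\<ge>\<^sub>0" and d: "0 \<le> Re d"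
  shows "b' = cnj b" "(cmod b)\<^sup>2 \<le> Re a * Re d"
proof -
  have im: "Im (a + l * b + cnj l * b' + cnj l * l * d) = 0"
    and re: "0 \<le> Re (a + l * b + cnj l * b' + cnj l * l * d)" for l
    using pos[of l] by (auto simp: complex_nonneg_Reals_iff)
  have "Im a = 0" "Im d = 0"
    using im[of 0] im[of 1] im[of "- 1"] by simp_all
  then show b': "b' = cnj b"
    using im[of 1] im[of \<i>] by (simp add: complex_eq_iff)
  have ge: "0 \<le> Re a + 2 * k * (cmod b)\<^sup>2 + k\<^sup>2 * (cmod b)\<^sup>2 * Re d" for k
  proof -
    have "Re (a + of_real k * cnj b * b + cnj (of_real k * cnj b) * b' +
        cnj (of_real k * cnj b) * (of_real k * cnj b) * d) =
        Re a + 2 * k * (cmod b)\<^sup>2 + k\<^sup>2 * (cmod b)\<^sup>2 * Re d"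
      unfolding b' cmod_power2 by (simp add: power2_eq_square algebra_simps)
    then show ?thesis using re[of "of_real k * cnj b"] by simp
  qed
  \<comment> \<open>For positive d the minimiser \<open>k = - 1 / d\<close> gives the inequality.
    For d = 0 and b nonzero, k is chosen to make the linear expression equal to -1, a
    contradiction.\<close>
  show "(cmod b)\<^sup>2 \<le> Re a * Re d"
  proof (cases "Re d = 0")
    case True
    have "b = 0"
    proof (rule ccontr)
      assume "b \<noteq> 0"
      then have "0 < (cmod b)\<^sup>2" by simp
      then show False
        using ge[of "- (Re a + 1) / (2 * (cmod b)\<^sup>2)"] True by (simp add: field_simps)
    qed
    then show ?thesis using True by simp
  next
    case False
    then have "0 < Re d" using d by simp
    then show ?thesis using ge[of "- inverse (Re d)"] by (simp add: field_simps power2_eq_square)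
  qed
qed

section \<open>Density of the free algebra, homomorphisms and states\<close>

lemma closure_range_of_free: "closure (range of_free) = (UNIV :: 'a::right_lcm_semigroup lcm_cstar set)"
proof -
  have "x \<in> closure (range of_free)" for x :: "'a lcm_cstar"
  proof -
    obtain X where "(\<lambda>n. of_free (X n)) \<longlonglongrightarrow> x" by (rule of_free_dense)
    then show ?thesis
      unfolding closure_sequential by (intro exI[of _ "\<lambda>n. of_free (X n)"]) simp
  qed
  then show ?thesis by blast
qed

lemma lcm_cstar_dense_eqI:
  fixes f g :: "'a::right_lcm_semigroup lcm_cstar \<Rightarrow> 'b::t2_space"
  assumes "continuous_on UNIV f" "continuous_on UNIV g" "\<And>x. f (of_free x) = g (of_free x)"
  shows "f x = g x"
proof -
  have "closed {x. f x = g x}" using assms(1,2) by (rule closed_Collect_eq)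
  moreover have "range of_free \<subseteq> {x. f x = g x}" using assms(3) by auto
  ultimately have "closure (range of_free) \<subseteq> {x. f x = g x}" by (rule closure_minimal[rotated])
  then show ?thesis unfolding closure_range_of_free by blast
qed

lemma star_hom_eqI:
  fixes f g :: "'a::right_lcm_semigroup lcm_cstar \<Rightarrow> 'b::unital_cstar_algebra"
  assumes "star_hom f" "continuous_on UNIV f" "star_hom g" "continuous_on UNIV g"
    and "\<And>s. f (lcm_gen s) = g (lcm_gen s)"
  shows "f x = g x"
  using assms(2,4)
  by (rule lcm_cstar_dense_eqI) (simp add: star_hom_of_free assms)

lemma lcm_gen_relations:
  fixes s t r :: "'a::right_lcm_semigroup"
  shows lcm_gen_isometry: "star (lcm_gen s) * lcm_gen s = 1"
    and lcm_gen_one: "lcm_gen (1 :: 'a) = 1"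
    and lcm_gen_mult: "lcm_gen s * lcm_gen t = lcm_gen (s * t)"
    and lcm_gen_Int: "rideal s \<inter> rideal t = rideal r \<Longrightarrow>
      lcm_gen s * star (lcm_gen s) * (lcm_gen t * star (lcm_gen t)) = lcm_gen r * star (lcm_gen r)"
    and lcm_gen_disjoint: "rideal s \<inter> rideal t = {} \<Longrightarrow>
      lcm_gen s * star (lcm_gen s) * (lcm_gen t * star (lcm_gen t)) = 0"
  using lcm_relations_gen[where 'a = 'a] unfolding lcm_relations_def by blast+

text \<open>The images of the generators satisfy the relations, so the norm pulled back to the free
  algebra is one of the seminorms whose supremum is the universal norm; density does the
  rest.\<close>

lemma norm_star_hom_le:
  fixes f :: "'a::right_lcm_semigroup lcm_cstar \<Rightarrow> 'b::unital_cstar_algebra"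
  assumes f: "star_hom f" "continuous_on UNIV f"
  shows "norm (f x) \<le> norm x"
proof -
  have f0: "f 0 = 0" using star_homD(2)[OF f(1), of 0 0] by simp
  have rel: "lcm_relations (\<lambda>s. f (lcm_gen s))"
    unfolding lcm_relations_def
  proof (intro conjI allI impI)
    fix s t r :: 'a
    have pr: "f (lcm_gen s) * star (f (lcm_gen s)) * (f (lcm_gen t) * star (f (lcm_gen t))) =
        f (lcm_gen s * star (lcm_gen s) * (lcm_gen t * star (lcm_gen t)))"
      by (simp add: star_homD[OF f(1)])
    have "star (f (lcm_gen s)) * f (lcm_gen s) = f (star (lcm_gen s) * lcm_gen s)"
      by (simp add: star_homD[OF f(1)])
    then show "star (f (lcm_gen s)) * f (lcm_gen s) = 1"
      by (simp add: lcm_gen_isometry star_homD(4)[OF f(1)])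
    show "f (lcm_gen 1) = 1" by (simp add: lcm_gen_one star_homD(4)[OF f(1)])
    show "f (lcm_gen s) * f (lcm_gen t) = f (lcm_gen (s * t))"
      by (simp add: star_homD(3)[OF f(1), symmetric] lcm_gen_mult)
    show "f (lcm_gen s) * star (f (lcm_gen s)) * (f (lcm_gen t) * star (f (lcm_gen t))) =
        f (lcm_gen r) * star (f (lcm_gen r))" if "rideal s \<inter> rideal t = rideal r"
      unfolding pr lcm_gen_Int[OF that] by (simp add: star_homD[OF f(1)])
    show "f (lcm_gen s) * star (f (lcm_gen s)) * (f (lcm_gen t) * star (f (lcm_gen t))) = 0"
      if "rideal s \<inter> rideal t = {}"
      unfolding pr lcm_gen_disjoint[OF that] by (rule f0)
  qed
  have "norm (f (of_free y)) \<le> norm (of_free y)" for y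
    unfolding star_hom_of_free[OF f(1)] norm_of_free
    using univ_seminorm_upper[OF lcm_seminorm_eval[OF rel]] .
  moreover have "closed {x. norm (f x) \<le> norm x}"
    using f(2) by (intro closed_Collect_le continuous_intros)
  ultimately have "closure (range of_free) \<subseteq> {x. norm (f x) \<le> norm x}"
    by (intro closure_minimal) auto
  then show ?thesis unfolding closure_range_of_free by blast
qed

lemma star_hom_bounded_linear:
  fixes f :: "'a::right_lcm_semigroup lcm_cstar \<Rightarrow> 'b::unital_cstar_algebra"
  assumes f: "star_hom f" "continuous_on UNIV f"
  shows "bounded_linear f"
  by (rule bounded_linear_intro[where K = 1])
    (simp_all add: star_homD[OF f(1)] scaleR_scaleC norm_star_hom_le[OF f])

lemma cstar_stateD:
  assumes "cstar_state \<phi>"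
  shows "bounded_linear \<phi>" "\<phi> (c *\<^sub>C x) = c * \<phi> x" "\<phi> (star x * x) \<in> \<real>\<^sub>\<ge>\<^sub>0" "onorm \<phi> = 1"
  using assms unfolding cstar_state_def by blast+

lemma cstar_state_bound: "cstar_state \<phi> \<Longrightarrow> cmod (\<phi> x) \<le> norm x"
  using onorm[of \<phi> x] by (simp add: cstar_stateD)

text \<open>By Cauchy-Schwarz against 1, vanishing at 1 would force \<phi> = 0, against
  \<open>onorm \<phi> = 1\<close>. Positivity suffices, because the factor r is divided out in
  \<open>kms_state_imp_nonneg\<close>.\<close>

lemma cstar_state_one_pos:
  assumes \<phi>: "cstar_state \<phi>"
  shows "\<exists>r>0. \<phi> 1 = complex_of_real r"
proof -
  interpret bounded_linear \<phi> by (rule cstar_stateD(1)[OF \<phi>])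
  have "\<phi> 1 \<in> \<real>\<^sub>\<ge>\<^sub>0" using cstar_stateD(3)[OF \<phi>, of 1] by simp
  then obtain r where r: "r \<ge> 0" "\<phi> 1 = complex_of_real r"
    by (auto elim: nonneg_Reals_cases)
  have "r \<noteq> 0"
  proof
    assume "r = 0"
    then have one: "\<phi> 1 = 0" using r by simp
    have "\<phi> x = 0" for x
    proof -
      have "\<phi> (star x * x) + l * \<phi> (star x) + cnj l * \<phi> x + cnj l * l * \<phi> 1 \<in> \<real>\<^sub>\<ge>\<^sub>0" for l
      proof -
        have "star (x + l *\<^sub>C 1) * (x + l *\<^sub>C 1) =
            star x * x + l *\<^sub>C star x + cnj l *\<^sub>C x + (cnj l * l) *\<^sub>C 1"
          by (simp add: star_add star_scaleC distrib_left distrib_right mult_scaleC_left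
              mult_scaleC_right scaleC_scaleC scaleC_add_right mult.commute)
        then show ?thesis
          using cstar_stateD(3)[OF \<phi>, of "x + l *\<^sub>C 1"] by (simp add: add cstar_stateD(2)[OF \<phi>])
      qed
      from positive_form_Cauchy_Schwarz[OF this] show "\<phi> x = 0" by (simp add: one)
    qed
    then have "\<phi> = (\<lambda>_. 0)" by auto
    then show False using cstar_stateD(4)[OF \<phi>] by (simp add: onorm_zero)
  qed
  then show ?thesis using r by (intro exI[of _ r]) simp
qed

lemma entire_extension_continuous:
  assumes "entire_extension \<sigma> a f" shows "isCont f z"
proof -
  obtain d where d: "((\<lambda>w. inverse (w - z) *\<^sub>C (f w - f z)) \<longlongrightarrow> d) (at z)"
    using assms by (auto simp: entire_extension_def)
  have "((\<lambda>w. cmod (w - z) * norm (inverse (w - z) *\<^sub>C (f w - f z))) \<longlongrightarrow> cmod (z - z) * norm d) (at z)"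
    by (intro tendsto_intros d)
  then have "((\<lambda>w. cmod (w - z) * norm (inverse (w - z) *\<^sub>C (f w - f z))) \<longlongrightarrow> 0) (at z)" by simp
  then have "((\<lambda>w. norm (f w - f z)) \<longlongrightarrow> 0) (at z)"
    by (rule Lim_transform_eventually)
      (auto simp: eventually_at norm_scaleC norm_inverse intro!: exI[of _ 1])
  then have "((\<lambda>w. f w - f z) \<longlongrightarrow> 0) (at z)" by (rule tendsto_norm_zero_cancel)
  then show ?thesis unfolding isCont_def by (rule LIM_zero_cancel)
qed

text \<open>Composition with functionals reduces identities between vector-valued extensions to the
  scalar identity theorem.\<close>

lemma entire_extension_holomorphic:
  assumes f: "entire_extension \<sigma> a f"
    and \<psi>: "bounded_linear \<psi>" "\<And>c x. \<psi> (c *\<^sub>C x) = c * \<psi> x"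
  shows "(\<lambda>z. \<psi> (f z)) holomorphic_on UNIV"
proof -
  interpret bounded_linear \<psi> by (rule \<psi>(1))
  have "\<exists>D. ((\<lambda>z. \<psi> (f z)) has_field_derivative D) (at z)" for z
  proof -
    obtain d where d: "((\<lambda>w. inverse (w - z) *\<^sub>C (f w - f z)) \<longlongrightarrow> d) (at z)"
      using f by (auto simp: entire_extension_def)
    have "((\<lambda>w. (\<psi> (f w) - \<psi> (f z)) / (w - z)) \<longlongrightarrow> \<psi> d) (at z)"
      using tendsto[OF d] by (simp add: \<psi>(2) diff divide_inverse mult.commute)
    then show ?thesis unfolding has_field_derivative_iff by blast
  qed
  then show ?thesis by (auto simp: holomorphic_on_def field_differentiable_def)
qed

context lcm_scale
begin

lemma dynamics_gen:
  "lcm_dynamics N t (lcm_gen s) = exp (\<i> * of_real t * of_real (ln (N s))) *\<^sub>C lcm_gen s"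
proof -
  have "complex_of_real (N s) powr (\<i> * of_real t) = exp (\<i> * of_real t * of_real (ln (N s)))"
    using scale_pos[of s] by (simp add: powr_def Ln_of_real)
  then show ?thesis using lcm_dynamics(3)[OF scale, of t s] by simp
qed

lemmas dynamics_hom = lcm_dynamics(1)[OF scale]
  and dynamics_continuous = lcm_dynamics(2)[OF scale]

lemma dynamics_add: "lcm_dynamics N u (lcm_dynamics N t x) = lcm_dynamics N (u + t) x"
proof (rule star_hom_eqI[where f = "\<lambda>x. lcm_dynamics N u (lcm_dynamics N t x)"])
  show "star_hom (\<lambda>x. lcm_dynamics N u (lcm_dynamics N t x))"
    unfolding star_hom_def by (simp add: star_homD[OF dynamics_hom])
  show "continuous_on UNIV (\<lambda>x. lcm_dynamics N u (lcm_dynamics N t x))"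
    by (rule continuous_on_compose2[OF dynamics_continuous dynamics_continuous]) auto
  show "lcm_dynamics N u (lcm_dynamics N t (lcm_gen s)) = lcm_dynamics N (u + t) (lcm_gen s)" for s
    by (simp add: dynamics_gen star_homD(2)[OF dynamics_hom] scaleC_scaleC exp_add[symmetric]
        algebra_simps)
qed (rule dynamics_hom dynamics_continuous)+

lemma dynamics_bounded_linear: "bounded_linear (lcm_dynamics N t)"
  by (rule star_hom_bounded_linear[OF dynamics_hom dynamics_continuous])

lemma norm_dynamics_le: "norm (lcm_dynamics N t x) \<le> norm x"
  by (rule norm_star_hom_le[OF dynamics_hom dynamics_continuous])

text \<open>The generator \<open>v\<^sub>s\<close> need not lie in the subspace on which the KMS condition is given, but it is
  an eigenvector of the dynamics and a limit of elements \<open>a\<close> of that subspace; the function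
  \<open>N(s)\<^sup>-\<^sup>i\<^sup>z \<phi>(b \<sigma>\<^sub>z(a))\<close> is then almost constant on both edges of the strip.\<close>

lemma kms_state_gen:
  assumes kms: "kms_state (lcm_dynamics N) \<beta> \<phi>" and \<beta>: "0 \<le> \<beta>"
  shows "\<phi> (b * lcm_gen s) = of_real (N s powr \<beta>) * \<phi> (lcm_gen s * b)"
proof -
  let ?\<sigma> = "lcm_dynamics N"
  let ?v = "lcm_gen s :: 'a lcm_cstar"
  have st: "cstar_state \<phi>" using kms by (simp add: kms_state_def)
  interpret \<phi>: bounded_linear \<phi> by (rule cstar_stateD(1)[OF st])
  note \<phi>C = cstar_stateD(2)[OF st]
  obtain D where dense: "closure D = UNIV" and inv: "\<And>t a. a \<in> D \<Longrightarrow> ?\<sigma> t a \<in> D"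
    and ext: "\<And>a. a \<in> D \<Longrightarrow> \<exists>f. entire_extension ?\<sigma> a f \<and>
      (\<forall>b\<in>D. \<phi> (a * b) = \<phi> (b * f (\<i> * complex_of_real \<beta>)))"
    using kms unfolding kms_state_def by metis
  define L where "L = ln (N s)"
  have eL: "exp (\<beta> * L) = N s powr \<beta>"
    using scale_pos[of s] by (simp add: powr_def L_def)
  have \<sigma>v: "?\<sigma> t ?v = exp (\<i> * of_real t * of_real L) *\<^sub>C ?v" for t
    by (simp add: dynamics_gen L_def)
  have hol: "(\<lambda>z. \<phi> (b * ?\<sigma> t (f z))) holomorphic_on UNIV"
    "(\<lambda>z. \<phi> (b * f z)) holomorphic_on UNIV" if f: "entire_extension ?\<sigma> a f" for b t a f
  proof -
    have "bounded_linear (\<lambda>x. \<phi> (b * ?\<sigma> t x))" "bounded_linear (\<lambda>x. \<phi> (b * x))"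
      by (intro bounded_linear_compose[OF \<phi>.bounded_linear_axioms]
          bounded_linear_compose[OF bounded_linear_mult_right] dynamics_bounded_linear
          bounded_linear_mult_right)+
    then show "(\<lambda>z. \<phi> (b * ?\<sigma> t (f z))) holomorphic_on UNIV"
      "(\<lambda>z. \<phi> (b * f z)) holomorphic_on UNIV"
      using entire_extension_holomorphic[OF f, of "\<lambda>x. \<phi> (b * ?\<sigma> t x)"]
        entire_extension_holomorphic[OF f, of "\<lambda>x. \<phi> (b * x)"]
      by (simp_all add: star_homD(2)[OF dynamics_hom] mult_scaleC_right \<phi>C)
  qed
  have ext_real: "f (of_real t) = ?\<sigma> t a" if "entire_extension ?\<sigma> a f" for f a t
    using that by (simp add: entire_extension_def)
  have hol_shift: "(\<lambda>z. F (z + of_real t)) holomorphic_on UNIV" if "F holomorphic_on UNIV"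
    for F :: "complex \<Rightarrow> complex" and t :: real
    using holomorphic_on_compose_gen[of "\<lambda>z. z + of_real t" UNIV F UNIV] that
    by (simp add: o_def holomorphic_intros)
  have main: "cmod (\<phi> (b * ?v) - of_real (N s powr \<beta>) * \<phi> (?v * b)) \<le>
      norm b * e + N s powr \<beta> * (norm b * e)" if b: "b \<in> D" and e: "e > 0" for b e
  proof -
    obtain a where a: "a \<in> D" "dist a ?v < e"
      using dense e by (metis UNIV_I closure_approachable)
    obtain f where f: "entire_extension ?\<sigma> a f"
      and fk: "\<And>b. b \<in> D \<Longrightarrow> \<phi> (a * b) = \<phi> (b * f (\<i> * complex_of_real \<beta>))"
      using ext[OF a(1)] by blast
    \<comment> \<open>For real z this is the group law of the dynamics; both sides are entire in z,
      so it extends to complex z.\<close>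
    have shift: "\<phi> (b * f (z + of_real t)) = \<phi> (b * ?\<sigma> t (f z))" for z t
      by (rule entire_eq_on_reals[OF hol_shift[OF hol(2)[OF f]] hol(1)[OF f]])
        (simp add: ext_real[OF f] dynamics_add add.commute flip: of_real_add)
    \<comment> \<open>The KMS condition is applied to the translate of a by t, which lies in D by
      invariance. This controls the whole upper edge instead of the single point
      \<open>\<i> * \<beta>\<close>.\<close>
    have upper_edge: "\<phi> (b * f (\<i> * of_real \<beta> + of_real t)) = \<phi> (?\<sigma> t a * b)" for t
    proof -
      obtain g where g: "entire_extension ?\<sigma> (?\<sigma> t a) g"
        and gk: "\<And>b. b \<in> D \<Longrightarrow> \<phi> (?\<sigma> t a * b) = \<phi> (b * g (\<i> * complex_of_real \<beta>))"
        using ext[OF inv[OF a(1)]] by blast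
      have "\<phi> (b * f (z + of_real t)) = \<phi> (b * g z)" for z
        by (rule entire_eq_on_reals[OF hol_shift[OF hol(2)[OF f]] hol(2)[OF g]])
          (simp add: ext_real[OF f] ext_real[OF g] dynamics_add flip: of_real_add)
      then show ?thesis using gk[OF b] by simp
    qed
    \<comment> \<open>The exponential cancels the eigenvalue of \<open>v_s\<close>. If a were
      \<open>v_s\<close> itself, h would be constant, and its values on the two edges are the two
      numbers to be compared.\<close>
    define h where "h z = exp (- (\<i> * z * of_real L)) * \<phi> (b * f z)" for z
    have norm_e: "cmod (exp (- (\<i> * of_real t * of_real L))) = 1" for t
      by (simp add: norm_exp_eq_Re)
    have ev: "exp (- (\<i> * of_real t * of_real L)) * exp (\<i> * of_real t * of_real L) = (1::complex)" for t
      by (simp flip: exp_add)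
    have diff: "norm (?\<sigma> t (a - ?v)) \<le> e" for t
      using norm_dynamics_le[of t "a - ?v"] a(2) by (simp add: dist_norm)
    have \<sigma>diff: "?\<sigma> t (a - ?v) = ?\<sigma> t a - exp (\<i> * of_real t * of_real L) *\<^sub>C ?v" for t
      using linear_diff[OF bounded_linear.linear[OF dynamics_bounded_linear], of t a ?v] by (simp add: \<sigma>v)
    \<comment> \<open>Continuity bounds f on the vertical segment only; \<open>shift\<close> and
      contractivity of the dynamics carry the bound along the strip.\<close>
    have "continuous_on {0..\<beta>} (\<lambda>y. norm (f (\<i> * of_real y)))"
      by (intro continuous_intros continuous_at_imp_continuous_on ballI
          isCont_o2[OF _ entire_extension_continuous[OF f]])
    then have "bounded ((\<lambda>y. norm (f (\<i> * of_real y))) ` {0..\<beta>})"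
      by (intro compact_imp_bounded compact_continuous_image) auto
    then obtain B where "\<forall>x\<in>(\<lambda>y. norm (f (\<i> * of_real y))) ` {0..\<beta>}. norm x \<le> B"
      unfolding bounded_iff by blast
    then have B: "norm (f (\<i> * of_real y)) \<le> B" if "0 \<le> y" "y \<le> \<beta>" for y
      using that by auto
    have "cmod (\<phi> (b * ?v) - of_real (N s powr \<beta>) * \<phi> (?v * b)) \<le> norm b * e + N s powr \<beta> * (norm b * e)"
    proof (rule entire_strip_edges[of h \<beta> _ _ _ _ "exp (\<beta> * L) * (norm b * B)"])
      show "h holomorphic_on UNIV"
        unfolding h_def by (intro holomorphic_intros hol(2)[OF f])
      show "cmod (h (of_real t) - \<phi> (b * ?v)) \<le> norm b * e" for t
      proof -
        have "h (of_real t) - \<phi> (b * ?v) = exp (- (\<i> * of_real t * of_real L)) * \<phi> (b * ?\<sigma> t (a - ?v))"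
          unfolding \<sigma>diff h_def ext_real[OF f]
          by (simp add: right_diff_distrib \<phi>.diff mult_scaleC_right \<phi>C mult.assoc[symmetric] ev)
        then have "cmod (h (of_real t) - \<phi> (b * ?v)) = cmod (\<phi> (b * ?\<sigma> t (a - ?v)))"
          by (simp add: norm_mult norm_e)
        also have "\<dots> \<le> norm b * e"
          using cstar_state_bound[OF st] norm_mult_ineq mult_left_mono[OF diff norm_ge_zero]
          by (meson order_trans)
        finally show ?thesis .
      qed
      show "cmod (h (of_real t + \<i> * of_real \<beta>) - of_real (N s powr \<beta>) * \<phi> (?v * b)) \<le>
          N s powr \<beta> * (norm b * e)" for t
      proof -
        have "exp (- (\<i> * (of_real t + \<i> * of_real \<beta>) * of_real L)) =
            exp (- (\<i> * of_real t * of_real L)) * exp (of_real (\<beta> * L))"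
          unfolding exp_add[symmetric] by (simp add: algebra_simps)
        also have "exp (complex_of_real (\<beta> * L)) = of_real (N s powr \<beta>)"
          unfolding eL[symmetric] by (rule exp_of_real)
        finally have "h (of_real t + \<i> * of_real \<beta>) =
            of_real (N s powr \<beta>) * (exp (- (\<i> * of_real t * of_real L)) * \<phi> (?\<sigma> t a * b))"
          unfolding h_def using upper_edge[of t] by (simp add: add.commute)
        then have "h (of_real t + \<i> * of_real \<beta>) - of_real (N s powr \<beta>) * \<phi> (?v * b) =
            of_real (N s powr \<beta>) * (exp (- (\<i> * of_real t * of_real L)) * \<phi> (?\<sigma> t (a - ?v) * b))"
          unfolding \<sigma>diff
          by (simp add: left_diff_distrib right_diff_distrib \<phi>.diff mult_scaleC_left \<phi>C mult.assoc[symmetric] ev)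
        then have "cmod (h (of_real t + \<i> * of_real \<beta>) - of_real (N s powr \<beta>) * \<phi> (?v * b)) =
            N s powr \<beta> * cmod (\<phi> (?\<sigma> t (a - ?v) * b))"
          by (simp add: norm_mult norm_e)
        moreover have "cmod (\<phi> (?\<sigma> t (a - ?v) * b)) \<le> e * norm b"
          using cstar_state_bound[OF st] norm_mult_ineq mult_right_mono[OF diff norm_ge_zero]
          by (meson order_trans)
        ultimately show ?thesis by (simp add: mult.commute[of "norm b"] mult_left_mono)
      qed
      show "cmod (h (of_real t + \<i> * of_real y)) \<le> exp (\<beta> * L) * (norm b * B)"
        if y: "0 \<le> y" "y \<le> \<beta>" for t y
      proof -
        have "cmod (exp (- (\<i> * (of_real t + \<i> * of_real y) * of_real L))) = exp (y * L)"
          by (simp add: norm_exp_eq_Re)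
        also have "\<dots> \<le> exp (\<beta> * L)"
          using y scale_ge_one[of s] by (simp add: L_def mult_right_mono)
        finally have "cmod (exp (- (\<i> * (of_real t + \<i> * of_real y) * of_real L))) \<le> exp (\<beta> * L)" .
        moreover have "cmod (\<phi> (b * f (of_real t + \<i> * of_real y))) \<le> norm b * B"
        proof -
          have "\<phi> (b * f (of_real t + \<i> * of_real y)) = \<phi> (b * ?\<sigma> t (f (\<i> * of_real y)))"
            using shift[of "\<i> * of_real y" t] by (simp add: add.commute)
          also have "cmod \<dots> \<le> norm b * norm (?\<sigma> t (f (\<i> * of_real y)))"
            using cstar_state_bound[OF st] norm_mult_ineq order_trans by blast
          also have "\<dots> \<le> norm b * B"
            using norm_dynamics_le[of t "f (\<i> * of_real y)"] B[OF y] by (intro mult_left_mono) auto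
          finally show ?thesis .
        qed
        ultimately show ?thesis
          unfolding h_def norm_mult by (intro mult_mono) auto
      qed
    qed (rule \<beta>)
    then show ?thesis .
  qed
  have eqD: "\<phi> (b * ?v) = of_real (N s powr \<beta>) * \<phi> (?v * b)" if b: "b \<in> D" for b
  proof -
    define x where "x = cmod (\<phi> (b * ?v) - of_real (N s powr \<beta>) * \<phi> (?v * b))"
    define k where "k = norm b + N s powr \<beta> * norm b"
    have k: "0 \<le> k" by (simp add: k_def)
    have le: "x \<le> k * e" if "e > 0" for e
      using main[OF b that] by (simp add: x_def k_def algebra_simps)
    have "x \<le> 0"
    proof (rule ccontr)
      assume "\<not> x \<le> 0"
      then have x: "0 < x" by simp
      \<comment> \<open>The summand 1 in the denominator permits k = 0 and makes the resulting bound
        strictly smaller than x.\<close>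
      then have "x \<le> k * (x / (k + 1))" using k by (intro le) simp
      also have "\<dots> < x" using x k by (simp add: field_simps)
      finally show False by simp
    qed
    then show ?thesis by (simp add: x_def)
  qed
  have "closed {b. \<phi> (b * ?v) = of_real (N s powr \<beta>) * \<phi> (?v * b)}"
    by (intro closed_Collect_eq continuous_intros \<phi>.continuous_on)
  then have "closure D \<subseteq> {b. \<phi> (b * ?v) = of_real (N s powr \<beta>) * \<phi> (?v * b)}"
    using eqD by (intro closure_minimal) auto
  then show ?thesis using dense by blast
qed

lemma kms_state_imp_nonneg:
  assumes kms: "kms_state (lcm_dynamics N) \<beta> \<phi>" and \<beta>: "0 \<le> \<beta>" and F: "finite F"
  shows "0 \<le> alt_sum (meet_weight N \<beta>) F"
proof -
  have st: "cstar_state \<phi>" using kms by (simp add: kms_state_def)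
  interpret \<phi>: bounded_linear \<phi> by (rule cstar_stateD(1)[OF st])
  obtain r where r: "r > 0" "\<phi> 1 = complex_of_real r"
    using cstar_state_one_pos[OF st] by blast
  define e :: "'a \<Rightarrow> 'a lcm_cstar" where "e s = lcm_gen s * star (lcm_gen s)" for s
  have rel: "star (lcm_gen s) * lcm_gen s = 1" "lcm_gen 1 = 1"
    "rideal s \<inter> rideal t = rideal u \<Longrightarrow> e s * e t = e u"
    "rideal s \<inter> rideal t = {} \<Longrightarrow> e s * e t = 0" for s t u :: 'a
    unfolding e_def by (rule lcm_gen_relations; assumption)+
  have \<phi>e: "\<phi> (e s) = of_real (r * N s powr (- \<beta>))" for s
  proof -
    \<comment> \<open>With b the adjoint of \<open>v_s\<close>, the left side is \<phi> at
      \<open>star (v_s) * v_s = 1\<close>, the right side involves the range projection.\<close>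
    have "\<phi> 1 = of_real (N s powr \<beta>) * \<phi> (e s)"
      using kms_state_gen[OF kms \<beta>, of "star (lcm_gen s)" s] by (simp add: rel e_def)
    then show ?thesis using scale_pos[of s] r(2)
      by (simp add: powr_minus field_simps)
  qed
  have comm: "e s * e t = e t * e s" for s t
  proof (cases rule: rideal_Int_cases[of s t])
    case 1
    then show ?thesis using rel(4)[of s t] rel(4)[of t s] by (simp add: Int_commute)
  next
    case (2 u)
    then show ?thesis using rel(3)[of s t u] rel(3)[of t s u] by (simp add: Int_commute)
  qed
  have idem: "e s * e s = e s" for s by (rule rel(3)) simp
  have sa: "star (e s) = e s" for s by (simp add: e_def star_mult star_star)
  have star_diff: "star (x - y) = star x - star y" for x y :: "'a lcm_cstar"
    by (rule linear_diff[OF bounded_linear.linear[OF bounded_linear_star]])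
  \<comment> \<open>P is the product of the 1 - \<open>e t\<close> over t in F. The value is carried
    along for all \<open>e s * P\<close>, because the step turns \<open>e s * e x\<close> into 0 or
    another \<open>e u\<close>.\<close>
  have "\<exists>P. star P = P \<and> P * P = P \<and> (\<forall>s. e s * P = P * e s) \<and>
      (\<forall>s. \<phi> (e s * P) = of_real (r * alt_sum (\<lambda>A. meet_weight N \<beta> (insert s A)) F))"
    using F
  proof (induction F rule: finite_induct)
    case empty
    show ?case by (intro exI[of _ 1]) (simp add: \<phi>e)
  next
    case (insert x F)
    then obtain P where P: "star P = P" "P * P = P" "\<And>s. e s * P = P * e s"
      "\<And>s. \<phi> (e s * P) = of_real (r * alt_sum (\<lambda>A. meet_weight N \<beta> (insert s A)) F)"
      by blast
    show ?case
    proof (intro exI[of _ "P - e x * P"] conjI allI)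
      show "star (P - e x * P) = P - e x * P"
        by (simp add: star_diff star_mult sa P(1)) (simp add: P(3))
      have "P * (e x * P) = e x * P"
        using P(2,3) by (metis mult.assoc)
      moreover have "e x * P * (e x * P) = e x * P"
        using P(2,3) idem by (metis mult.assoc)
      ultimately show "(P - e x * P) * (P - e x * P) = P - e x * P"
        by (simp add: left_diff_distrib right_diff_distrib P(2) mult.assoc)
      show "e s * (P - e x * P) = (P - e x * P) * e s" for s
      proof -
        have "e s * (e x * P) = e x * P * e s"
          using P(3) comm by (metis mult.assoc)
        then show ?thesis by (simp add: left_diff_distrib right_diff_distrib P(3))
      qed
      show "\<phi> (e s * (P - e x * P)) =
          of_real (r * alt_sum (\<lambda>A. meet_weight N \<beta> (insert s A)) (insert x F))" for s
      proof -
        have "\<phi> (e s * (e x * P)) = of_real (r * alt_sum (\<lambda>A. meet_weight N \<beta> (insert s (insert x A))) F)"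
        proof (cases rule: rideal_Int_cases[of s x])
          case 1
          have "alt_sum (\<lambda>A. meet_weight N \<beta> (insert s (insert x A))) F = alt_sum (\<lambda>_. 0) F"
            using 1 by (intro alt_sum_cong meet_weight_None) auto
          then show ?thesis
            using rel(4)[OF 1] by (simp add: mult.assoc[symmetric] alt_sum_def \<phi>.zero)
        next
          case (2 u)
          have "meet_weight N \<beta> (insert s (insert x A)) = meet_weight N \<beta> (insert u A)" for A
          proof -
            have "(\<Inter>t\<in>insert s (insert x A). rideal t) = (\<Inter>t\<in>insert u A. rideal t)"
              using 2 by auto
            then show ?thesis unfolding meet_weight_def by simp
          qed
          then show ?thesis
            using rel(3)[OF 2] P(4)[of u] by (simp add: mult.assoc[symmetric])
        qed
        then show ?thesis
          using insert.hyps(1) P(4)[of s]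
          by (simp add: right_diff_distrib \<phi>.diff alt_sum_insert)
      qed
    qed
  qed
  then obtain P where P: "star P = P" "P * P = P"
    "\<phi> (e 1 * P) = of_real (r * alt_sum (\<lambda>A. meet_weight N \<beta> (insert 1 A)) F)"
    by blast
  have "meet_weight N \<beta> (insert 1 A) = meet_weight N \<beta> A" for A
    unfolding meet_weight_def by simp
  then have "\<phi> P = of_real (r * alt_sum (meet_weight N \<beta>) F)"
    using P(3) by (simp add: e_def rel)
  \<comment> \<open>A self-adjoint idempotent is of the form \<open>star P * P\<close>.\<close>
  moreover have "\<phi> P \<in> \<real>\<^sub>\<ge>\<^sub>0" using cstar_stateD(3)[OF st, of P] P by simp
  ultimately have "0 \<le> r * alt_sum (meet_weight N \<beta>) F"
    by (simp add: complex_nonneg_Reals_iff)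
  then show ?thesis using r(1) by (simp add: zero_le_mult_iff)
qed

end

section \<open>Positive functionals on the free algebra\<close>

text \<open>Relators are required to vanish with arbitrary factors on both sides, hence on the
  two-sided ideal they generate; this lets the relations hold as operators on the GNS space.\<close>

locale lcm_functional =
  fixes \<psi> :: "'a::right_lcm_semigroup free_alg \<Rightarrow> complex"
  assumes functional_add: "\<psi> (x + y) = \<psi> x + \<psi> y"
    and functional_scale: "\<psi> (free_scale c x) = c * \<psi> x"
    and functional_pos: "\<psi> (free_star x * x) \<in> \<real>\<^sub>\<ge>\<^sub>0"
    and functional_relator: "r \<in> lcm_relators \<Longrightarrow> \<psi> (x * r * y) = 0"
    and functional_one: "\<psi> 1 = 1"
begin

definition gns :: "'a free_alg \<Rightarrow> real" where
  "gns y = sqrt (Re (\<psi> (free_star y * y)))"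

lemma functional_diff: "\<psi> (x - y) = \<psi> x - \<psi> y"
  using functional_add[of "x - y" y] by simp

lemma functional_zero [simp]: "\<psi> 0 = 0"
  using functional_add[of 0 0] by simp

lemma functional_nonneg: "0 \<le> Re (\<psi> (free_star x * x))"
  using functional_pos[of x] by (simp add: complex_nonneg_Reals_iff)

lemma gns_nonneg [simp]: "0 \<le> gns y"
  by (simp add: gns_def functional_nonneg)

lemma gns_power2: "(gns y)\<^sup>2 = Re (\<psi> (free_star y * y))"
  by (simp add: gns_def functional_nonneg)

lemma gns_zero [simp]: "gns 0 = 0"
  by (simp add: gns_def)

lemma gns_Cauchy_Schwarz: "cmod (\<psi> (free_star y * z)) \<le> gns y * gns z"
proof -
  have "\<psi> (free_star y * y) + l * \<psi> (free_star y * z) + cnj l * \<psi> (free_star z * y) +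
      cnj l * l * \<psi> (free_star z * z) \<in> \<real>\<^sub>\<ge>\<^sub>0" for l
  proof -
    have "free_star (y + free_scale l z) * (y + free_scale l z) =
        free_star y * y + free_scale l (free_star y * z) + free_scale (cnj l) (free_star z * y) +
        free_scale (cnj l * l) (free_star z * z)"
      by (simp add: free_star_add free_star_scale ring_distribs free_scale_mult_left
          free_scale_mult_right free_scale_scale free_scale_add mult.commute)
    then show ?thesis
      using functional_pos[of "y + free_scale l z"] by (simp add: functional_add functional_scale)
  qed
  from positive_form_Cauchy_Schwarz(2)[OF this functional_nonneg]
  have "(cmod (\<psi> (free_star y * z)))\<^sup>2 \<le> (gns y * gns z)\<^sup>2"
    by (simp add: power_mult_distrib gns_power2)
  then show ?thesis by (rule power2_le_imp_le) simp
qed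

lemma gns_scale: "gns (free_scale c y) = cmod c * gns y"
proof -
  have "\<psi> (free_star (free_scale c y) * free_scale c y) = of_real ((cmod c)\<^sup>2) * \<psi> (free_star y * y)"
    unfolding complex_norm_square
    by (simp add: free_star_scale free_scale_mult_left free_scale_mult_right free_scale_scale
        functional_scale)
  then show ?thesis by (simp add: gns_def real_sqrt_mult)
qed

lemma gns_triangle: "gns (y + z) \<le> gns y + gns z"
proof (rule power2_le_imp_le)
  have "\<psi> (free_star (y + z) * (y + z)) =
      \<psi> (free_star y * y) + \<psi> (free_star y * z) + \<psi> (free_star z * y) + \<psi> (free_star z * z)"
    by (simp add: free_star_add ring_distribs functional_add)
  then have "(gns (y + z))\<^sup>2 =
      (gns y)\<^sup>2 + Re (\<psi> (free_star y * z)) + Re (\<psi> (free_star z * y)) + (gns z)\<^sup>2"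
    by (simp add: gns_power2)
  also have "\<dots> \<le> (gns y)\<^sup>2 + gns y * gns z + gns z * gns y + (gns z)\<^sup>2"
    by (intro add_mono order_refl order_trans[OF complex_Re_le_cmod] gns_Cauchy_Schwarz)
  also have "\<dots> = (gns y + gns z)\<^sup>2" by (simp add: power2_sum)
  finally show "(gns (y + z))\<^sup>2 \<le> (gns y + gns z)\<^sup>2" .
qed simp

lemma gns_relator:
  assumes r: "r \<in> lcm_relators" shows "gns (r * y) = 0"
proof -
  have "free_star (r * y) * (r * y) = (free_star y * free_star r) * r * y"
    by (simp add: free_star_mult mult.assoc)
  then show ?thesis using functional_relator[OF r] by (simp add: gns_def)
qed

text \<open>The relator for \<open>v_s\<close> being an isometry makes left multiplication by it
  preserve the GNS seminorm.\<close>

lemma gns_fgen: "gns (fgen s * y) = gns y"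
proof -
  have rel: "free_star (fgen s) * fgen s - 1 \<in> lcm_relators"
    unfolding lcm_relators_def by blast
  have "free_star (fgen s * y) * (fgen s * y) - free_star y * y =
      free_star y * (free_star (fgen s) * fgen s - 1) * y"
    by (simp add: free_star_mult mult.assoc ring_distribs)
  then have "\<psi> (free_star (fgen s * y) * (fgen s * y)) - \<psi> (free_star y * y) = 0"
    using functional_relator[OF rel, of "free_star y" y] by (simp only: functional_diff[symmetric])
  then show ?thesis by (simp add: gns_def)
qed

text \<open>The adjoint of an isometry is a contraction: the squared seminorm of z is the pairing of
  y with \<open>fgen s * z\<close>, and \<open>gns_fgen\<close> removes the factor before
  dividing.\<close>

lemma gns_fgen_star: "gns (free_star (fgen s) * y) \<le> gns y"
proof -
  let ?z = "free_star (fgen s) * y"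
  have "(gns ?z)\<^sup>2 = Re (\<psi> (free_star y * (fgen s * ?z)))"
    by (simp add: gns_power2 free_star_mult mult.assoc)
  also have "\<dots> \<le> gns y * gns (fgen s * ?z)"
    by (rule order_trans[OF complex_Re_le_cmod gns_Cauchy_Schwarz])
  finally have le: "gns ?z * gns ?z \<le> gns y * gns ?z"
    by (simp add: gns_fgen power2_eq_square)
  show ?thesis
  proof (cases "gns ?z = 0")
    case False
    then have "0 < gns ?z" by (simp add: less_le)
    with le show ?thesis by (rule mult_right_le_imp_le)
  qed simp
qed

lemma gns_word: "gns (Poly_Mapping.single (GWord ls) 1 * y) \<le> gns y"
proof (induction ls)
  case Nil
  then show ?case by (simp flip: zero_gword_def add: single_one)
next
  case (Cons l ls)
  have "Poly_Mapping.single (GWord (l # ls)) (1::complex) * y =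
      Poly_Mapping.single (GWord [l]) 1 * (Poly_Mapping.single (GWord ls) 1 * y)"
    by (simp add: mult_single mult.assoc[symmetric])
  moreover have "gns (Poly_Mapping.single (GWord [l]) 1 * z) \<le> gns z" for z
  proof (cases l)
    case (Gen s)
    then show ?thesis using gns_fgen[of s z] by (simp add: fgen_def)
  next
    case (GenStar s)
    then show ?thesis using gns_fgen_star[of s z] by (simp add: fgen_def)
  qed
  ultimately show ?case using Cons.IH order_trans by metis
qed

lemma gns_mult_bound: "\<exists>C\<ge>0. \<forall>y. gns (x * y) \<le> C * gns y"
proof (induction x rule: free_alg_induct)
  case (single w c)
  have "gns (Poly_Mapping.single w c * y) \<le> cmod c * gns y" for y
  proof -
    have "Poly_Mapping.single w c * y = free_scale c (Poly_Mapping.single w 1 * y)"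
      by (simp flip: free_scale_mult_left)
    then show ?thesis
      by (cases w) (simp add: gns_scale gns_word mult_left_mono)
  qed
  then show ?case by (intro exI[of _ "cmod c"]) simp
next
  case (add x y)
  then obtain A B where A: "A \<ge> 0" "\<And>z. gns (x * z) \<le> A * gns z"
    and B: "B \<ge> 0" "\<And>z. gns (y * z) \<le> B * gns z" by blast
  have "gns ((x + y) * z) \<le> (A + B) * gns z" for z
    using gns_triangle[of "x * z" "y * z"] A(2)[of z] B(2)[of z] by (simp add: ring_distribs)
  then show ?case using A(1) B(1) by (intro exI[of _ "A + B"]) simp
qed

text \<open>The operator norm of left multiplication by x in the GNS representation, with vectors
  represented by elements of the free algebra.\<close>

definition gns_op :: "'a free_alg \<Rightarrow> real" where
  "gns_op x = (SUP y\<in>{y. gns y \<le> 1}. gns (x * y))"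

lemma gns_op_least:
  assumes "0 \<le> C" "\<And>y. gns (x * y) \<le> C * gns y" shows "gns_op x \<le> C"
  unfolding gns_op_def
proof (rule cSUP_least)
  show "{y. gns y \<le> 1} \<noteq> {}" using gns_zero by (metis (mono_tags) empty_iff mem_Collect_eq zero_le_one)
  show "gns (x * y) \<le> C" if "y \<in> {y. gns y \<le> 1}" for y
    using assms(2)[of y] mult_left_mono[of "gns y" 1 C] that assms(1) by simp
qed

lemma gns_op_bdd: "bdd_above ((\<lambda>y. gns (x * y)) ` {y. gns y \<le> 1})"
proof -
  obtain C where C: "C \<ge> 0" "\<And>y. gns (x * y) \<le> C * gns y" using gns_mult_bound by blast
  have "gns (x * y) \<le> C" if "gns y \<le> 1" for y
    using C(2)[of y] mult_left_mono[OF that C(1)] by simp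
  then show ?thesis by (auto simp: bdd_above_def)
qed

lemma gns_op_nonneg [simp]: "0 \<le> gns_op x"
  using cSUP_upper[OF _ gns_op_bdd, of 0 x] by (simp add: gns_op_def)

text \<open>Vectors of positive seminorm are normalised; null vectors cannot be, and are handled by
  the boundedness of left multiplication.\<close>

lemma gns_op_upper: "gns (x * y) \<le> gns_op x * gns y"
proof (cases "gns y = 0")
  case True
  obtain C where "gns (x * y) \<le> C * gns y" using gns_mult_bound by blast
  then show ?thesis using True by simp
next
  case False
  then have y: "0 < gns y" by (simp add: less_le)
  define c where "c = complex_of_real (inverse (gns y))"
  have c: "cmod c = inverse (gns y)" using y by (simp add: c_def norm_inverse)
  have "gns (x * free_scale c y) \<le> gns_op x"
    unfolding gns_op_def by (rule cSUP_upper[OF _ gns_op_bdd]) (use y c in \<open>simp add: gns_scale\<close>)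
  then show ?thesis using y c by (simp add: free_scale_mult_right gns_scale field_simps)
qed

text \<open>Puts the GNS norm below the universal one, so that the functional is bounded in the norm
  of the completion.\<close>

lemma lcm_seminorm_gns_op: "lcm_seminorm gns_op"
  unfolding lcm_seminorm_def
proof (intro conjI allI ballI)
  fix x y :: "'a free_alg" and c
  show "gns_op (x + y) \<le> gns_op x + gns_op y"
  proof (rule gns_op_least)
    show "gns ((x + y) * z) \<le> (gns_op x + gns_op y) * gns z" for z
      using gns_triangle[of "x * z" "y * z"] gns_op_upper[of x z] gns_op_upper[of y z]
      by (simp add: ring_distribs)
  qed simp
  have scale_le: "gns_op (free_scale c x) \<le> cmod c * gns_op x" for c x
    by (rule gns_op_least)
      (simp_all add: free_scale_mult_left gns_scale gns_op_upper mult_left_mono mult.assoc)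
  show "gns_op (free_scale c x) = cmod c * gns_op x"
  proof (cases "c = 0")
    case True
    then show ?thesis using scale_le[of c x] gns_op_nonneg[of "free_scale c x"] by (simp del: gns_op_nonneg)
  next
    case False
    have "gns_op x \<le> inverse (cmod c) * gns_op (free_scale c x)"
      using scale_le[of "inverse c" "free_scale c x"] False by (simp add: free_scale_scale norm_inverse)
    then show ?thesis using False scale_le[of c x] by (simp add: field_simps)
  qed
  show mult: "gns_op (x * y) \<le> gns_op x * gns_op y" for x y
  proof (rule gns_op_least)
    show "gns (x * y * z) \<le> gns_op x * gns_op y * gns z" for z
      using gns_op_upper[of x "y * z"] mult_left_mono[OF gns_op_upper[of y z] gns_op_nonneg[of x]]
      by (simp add: mult.assoc)
  qed simp
  \<comment> \<open>The nontrivial half of the C*-identity: move x to the other side of the pairing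
    and apply Cauchy-Schwarz.\<close>
  have sq_le: "(gns_op x)\<^sup>2 \<le> gns_op (free_star x * x)" for x
  proof -
    have "gns_op x \<le> sqrt (gns_op (free_star x * x))"
    proof (rule gns_op_least)
      fix z
      have "(gns (x * z))\<^sup>2 = Re (\<psi> (free_star z * (free_star x * x * z)))"
        by (simp add: gns_power2 free_star_mult mult.assoc)
      also have "\<dots> \<le> gns z * gns (free_star x * x * z)"
        by (rule order_trans[OF complex_Re_le_cmod gns_Cauchy_Schwarz])
      also have "\<dots> \<le> gns z * (gns_op (free_star x * x) * gns z)"
        by (intro mult_left_mono gns_op_upper) simp
      also have "\<dots> = (sqrt (gns_op (free_star x * x)) * gns z)\<^sup>2"
        by (simp add: power_mult_distrib) (simp add: power2_eq_square)
      finally show "gns (x * z) \<le> sqrt (gns_op (free_star x * x)) * gns z"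
        by (rule power2_le_imp_le) simp
    qed simp
    then have "(gns_op x)\<^sup>2 \<le> (sqrt (gns_op (free_star x * x)))\<^sup>2" by (rule power_mono) simp
    then show ?thesis by simp
  qed
  have star_le: "gns_op x \<le> gns_op (free_star x)" for x
  proof (cases "gns_op x = 0")
    case False
    have "gns_op x * gns_op x \<le> gns_op (free_star x) * gns_op x"
      using order_trans[OF sq_le mult] by (simp add: power2_eq_square)
    moreover have "0 < gns_op x" using False by (simp add: less_le)
    ultimately show ?thesis by (rule mult_right_le_imp_le)
  qed simp
  have star: "gns_op (free_star x) = gns_op x" for x
    using star_le[of x] star_le[of "free_star x"] by simp
  show "gns_op (free_star x * x) = (gns_op x)\<^sup>2"
    using sq_le[of x] mult[of "free_star x" x] by (simp add: star power2_eq_square)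
next
  fix r :: "'a free_alg" assume "r \<in> lcm_relators"
  then have "gns_op r \<le> 0"
    by (intro gns_op_least) (simp_all add: gns_relator)
  then show "gns_op r = 0" using gns_op_nonneg[of r] by linarith
qed

text \<open>The vector of 1 is a unit vector, and \<psi> is its vector functional.\<close>

lemma functional_bound: "cmod (\<psi> x) \<le> univ_seminorm x"
proof -
  have "gns 1 = 1" by (simp add: gns_def functional_one)
  then have "cmod (\<psi> x) \<le> gns_op x"
    using gns_Cauchy_Schwarz[of 1 x] gns_op_upper[of x 1] by simp
  also have "\<dots> \<le> univ_seminorm x" by (rule univ_seminorm_upper[OF lcm_seminorm_gns_op])
  finally show ?thesis .
qed

lemma ex_state: "\<exists>\<phi>. cstar_state \<phi> \<and> (\<forall>x. \<phi> (of_free x) = \<psi> x)"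
proof -
  have le: "cmod (\<psi> x - \<psi> y) \<le> norm (of_free x - of_free y)" for x y
    using functional_bound[of "x - y"] by (simp add: functional_diff of_free_diff[symmetric] norm_of_free)
  have conv: "convergent (\<lambda>n. \<psi> (X n))" if X: "(\<lambda>n. of_free (X n)) \<longlonglongrightarrow> x" for X and x :: "'a lcm_cstar"
  proof (rule Cauchy_convergent, rule metric_CauchyI)
    fix e :: real assume "e > 0"
    then obtain M where M: "\<forall>m\<ge>M. \<forall>n\<ge>M. dist (of_free (X m)) (of_free (X n)) < e"
      using LIMSEQ_imp_Cauchy[OF X] unfolding Cauchy_def by blast
    have "dist (\<psi> (X m)) (\<psi> (X n)) < e" if "m \<ge> M" "n \<ge> M" for m n
      using M that le[of "X m" "X n"] unfolding dist_norm by (meson le_less_trans)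
    then show "\<exists>M. \<forall>m\<ge>M. \<forall>n\<ge>M. dist (\<psi> (X m)) (\<psi> (X n)) < e" by blast
  qed
  have "\<forall>x :: 'a lcm_cstar. \<exists>X. (\<lambda>n. of_free (X n)) \<longlonglongrightarrow> x"
    by (metis of_free_dense)
  then obtain R where R: "\<And>x :: 'a lcm_cstar. (\<lambda>n. of_free (R x n)) \<longlonglongrightarrow> x" by metis
  define \<phi> where "\<phi> x = lim (\<lambda>n. \<psi> (R x n))" for x
  have \<phi>R: "(\<lambda>n. \<psi> (R x n)) \<longlonglongrightarrow> \<phi> x" for x
    using conv[OF R] unfolding \<phi>_def by (simp add: convergent_LIMSEQ_iff)
  have lim: "(\<lambda>n. \<psi> (X n)) \<longlonglongrightarrow> \<phi> x" if X: "(\<lambda>n. of_free (X n)) \<longlonglongrightarrow> x" for X x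
  proof -
    have "(\<lambda>n. of_free (X n) - of_free (R x n)) \<longlonglongrightarrow> x - x" by (intro tendsto_diff X R)
    then have "(\<lambda>n. norm (of_free (X n) - of_free (R x n))) \<longlonglongrightarrow> 0"
      by (simp add: tendsto_norm_zero)
    then have "(\<lambda>n. cmod (\<psi> (X n) - \<psi> (R x n))) \<longlonglongrightarrow> 0"
      by (rule tendsto_le_zero) (auto simp: le)
    then have "(\<lambda>n. \<psi> (X n) - \<psi> (R x n)) \<longlonglongrightarrow> 0" by (rule tendsto_norm_zero_cancel)
    then have "(\<lambda>n. \<psi> (X n) - \<psi> (R x n) + \<psi> (R x n)) \<longlonglongrightarrow> 0 + \<phi> x"
      by (intro tendsto_add \<phi>R)
    then show ?thesis by simp
  qed
  have \<phi>_eqI: "\<phi> x = a" if "(\<lambda>n. of_free (X n)) \<longlonglongrightarrow> x" "(\<lambda>n. \<psi> (X n)) \<longlonglongrightarrow> a" for x a X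
    using LIMSEQ_unique[OF lim[OF that(1)] that(2)] .
  have free: "\<phi> (of_free x) = \<psi> x" for x by (rule \<phi>_eqI[of "\<lambda>_. x"]) auto
  have add: "\<phi> (x + y) = \<phi> x + \<phi> y" for x y
    by (rule \<phi>_eqI[of "\<lambda>n. R x n + R y n"]) (auto simp: of_free_add functional_add intro!: tendsto_add R \<phi>R)
  have scale: "\<phi> (c *\<^sub>C x) = c * \<phi> x" for c x
    by (rule \<phi>_eqI[of "\<lambda>n. free_scale c (R x n)"])
      (auto simp: of_free_scale functional_scale intro!: tendsto_mult_left
        bounded_linear.tendsto[OF bounded_linear_scaleC] R \<phi>R)
  have bound: "cmod (\<phi> x) \<le> norm x" for x
  proof (rule LIMSEQ_le[OF tendsto_norm[OF \<phi>R] tendsto_norm[OF R]])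
    show "\<exists>N. \<forall>n\<ge>N. cmod (\<psi> (R x n)) \<le> norm (of_free (R x n))"
      unfolding norm_of_free using functional_bound by blast
  qed
  have bl: "bounded_linear \<phi>"
    by (rule bounded_linear_intro[where K = 1])
      (simp_all add: add scaleR_scaleC scale bound scaleR_conv_of_real)
  have one: "\<phi> 1 = 1" using free[of 1] by (simp add: of_free_one functional_one)
  have "closed {x. \<phi> (star x * x) \<in> \<real>\<^sub>\<ge>\<^sub>0}"
  proof -
    have "continuous_on UNIV (\<lambda>x. \<phi> (star x * x))"
      by (intro bounded_linear.continuous_on[OF bl] continuous_intros
          bounded_linear.continuous_on[OF bounded_linear_star])
    then have "closed ((\<lambda>x. \<phi> (star x * x)) -` \<real>\<^sub>\<ge>\<^sub>0)"
      by (intro closed_vimage closed_nonneg_Reals_complex)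
    then show ?thesis by (simp add: vimage_def)
  qed
  moreover have "range of_free \<subseteq> {x. \<phi> (star x * x) \<in> \<real>\<^sub>\<ge>\<^sub>0}"
    using functional_pos by (auto simp: of_free_star[symmetric] of_free_mult[symmetric] free)
  ultimately have "closure (range of_free) \<subseteq> {x. \<phi> (star x * x) \<in> \<real>\<^sub>\<ge>\<^sub>0}"
    by (rule closure_minimal[rotated])
  then have pos: "\<phi> (star x * x) \<in> \<real>\<^sub>\<ge>\<^sub>0" for x
    unfolding closure_range_of_free by blast
  have "onorm \<phi> = 1"
  proof (rule antisym)
    show "onorm \<phi> \<le> 1" by (rule onorm_bound) (simp_all add: bound)
    \<comment> \<open>The class of algebras does not fix the norm of 1, so the bound comes from the
      estimate of the universal seminorm on words.\<close>
    have "norm (1 :: 'a lcm_cstar) \<le> 1"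
      using norm_of_free[of "1 :: 'a free_alg"] lcm_seminorm_le_one[OF lcm_seminorm_univ, of "0 :: 'a gword"]
      by (simp add: of_free_one single_one)
    moreover have "1 \<le> onorm \<phi> * norm (1 :: 'a lcm_cstar)"
      using onorm[OF bl, of 1] by (simp add: one)
    ultimately show "1 \<le> onorm \<phi>"
      using mult_left_mono[of "norm (1 :: 'a lcm_cstar)" 1 "onorm \<phi>"] onorm_pos_le[OF bl] by simp
  qed
  then show ?thesis
    unfolding cstar_state_def using bl scale pos free by blast
qed

end

section \<open>The KMS state of a scaling measure\<close>

lemma spectrum_act_one: "\<xi> \<in> spectrum \<Longrightarrow> spectrum_act 1 \<xi> = \<xi>"
  using spectrum_act_idem_mult[of 1 \<xi>] by (intro spectrum_eqI spectrum_act_in_spectrum) simp_all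

lemma spectrum_act_mult:
  assumes \<xi>: "\<xi> \<in> spectrum"
  shows "spectrum_act s (spectrum_act t \<xi>) = spectrum_act (s * t) \<xi>"
proof -
  let ?\<eta> = "spectrum_act s (spectrum_act t \<xi>)"
  have \<eta>: "?\<eta> \<in> cylinder (s * t)"
    using spectrum_act_cylinder[OF \<xi>, of t] spectrum_act_cylinder_image[of s t] by blast
  have "spectrum_inv (s * t) ?\<eta> = \<xi>"
    by (rule spectrum_eqI) (simp_all add: \<xi> spectrum_inv_in_spectrum[OF \<eta>] spectrum_inv_idem[OF \<eta>] mult.assoc)
  then show ?thesis using spectrum_act_inv[OF \<eta>] by simp
qed

section \<open>The partial action of words on characters\<close>

fun letter_act :: "'a::right_lcm_semigroup letter \<Rightarrow> (('a \<rightharpoonup> 'a) \<Rightarrow> nat) \<Rightarrow> (('a \<rightharpoonup> 'a) \<Rightarrow> nat) option" where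
  "letter_act (Gen s) \<xi> = Some (spectrum_act s \<xi>)"
| "letter_act (GenStar s) \<xi> = (if \<xi> \<in> cylinder s then Some (spectrum_inv s \<xi>) else None)"

text \<open>The last letter acts first, as in a product of operators, and \<open>None\<close>
  records that a basis vector is sent to 0.\<close>

fun letters_act :: "'a::right_lcm_semigroup letter list \<Rightarrow> (('a \<rightharpoonup> 'a) \<Rightarrow> nat) \<Rightarrow> (('a \<rightharpoonup> 'a) \<Rightarrow> nat) option" where
  "letters_act [] \<xi> = Some \<xi>"
| "letters_act (l # ls) \<xi> = Option.bind (letters_act ls \<xi>) (letter_act l)"

fun word_act :: "'a::right_lcm_semigroup gword \<Rightarrow> (('a \<rightharpoonup> 'a) \<Rightarrow> nat) \<Rightarrow> (('a \<rightharpoonup> 'a) \<Rightarrow> nat) option" where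
  "word_act (GWord ls) \<xi> = letters_act ls \<xi>"

lemma letter_act_in_spectrum:
  "letter_act l \<xi> = Some \<eta> \<Longrightarrow> \<xi> \<in> spectrum \<Longrightarrow> \<eta> \<in> spectrum"
  by (cases l) (auto simp: spectrum_act_in_spectrum spectrum_inv_in_spectrum split: if_splits)

lemma letters_act_in_spectrum:
  "letters_act ls \<xi> = Some \<eta> \<Longrightarrow> \<xi> \<in> spectrum \<Longrightarrow> \<eta> \<in> spectrum"
  by (induction ls arbitrary: \<eta>) (auto simp: bind_eq_Some_conv intro: letter_act_in_spectrum)

lemma word_act_in_spectrum:
  "word_act w \<xi> = Some \<eta> \<Longrightarrow> \<xi> \<in> spectrum \<Longrightarrow> \<eta> \<in> spectrum"
  by (cases w) (auto intro: letters_act_in_spectrum)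

lemma letters_act_append:
  "letters_act (ks @ ls) \<xi> = Option.bind (letters_act ls \<xi>) (letters_act ks)"
  by (induction ks) (auto simp: bind_assoc)

lemma word_act_zero [simp]: "word_act 0 \<xi> = Some \<xi>"
  by (simp add: zero_gword_def)

lemma word_act_add: "word_act (v + w) \<xi> = Option.bind (word_act w \<xi>) (word_act v)"
proof (cases v; cases w)
  fix ks ls :: "'a letter list" assume "v = GWord ks" "w = GWord ls"
  moreover have "word_act (GWord ks) = letters_act ks" by (rule ext) simp
  ultimately show ?thesis by (simp add: letters_act_append)
qed

text \<open>The adjoint letter acts as the inverse partial bijection, as the adjoint of a partial
  isometry permuting basis vectors does.\<close>

lemma letter_act_star:
  assumes "\<xi> \<in> spectrum" "\<eta> \<in> spectrum"
  shows "letter_act (letter_star l) \<eta> = Some \<xi> \<longleftrightarrow> letter_act l \<xi> = Some \<eta>"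
proof (cases l)
  case (Gen s)
  then show ?thesis
    using spectrum_act_inv[of \<eta> s] spectrum_inv_act[of \<xi> s] spectrum_act_cylinder[of \<xi> s] assms by auto
next
  case (GenStar s)
  then show ?thesis
    using spectrum_act_inv[of \<xi> s] spectrum_inv_act[of \<eta> s] spectrum_act_cylinder[of \<eta> s] assms by auto
qed

lemma letters_act_star:
  assumes "\<xi> \<in> spectrum" "\<eta> \<in> spectrum"
  shows "letters_act (rev (map letter_star ls)) \<eta> = Some \<xi> \<longleftrightarrow> letters_act ls \<xi> = Some \<eta>"
  using assms
proof (induction ls arbitrary: \<eta>)
  case (Cons l ls)
  have "letters_act (rev (map letter_star (l # ls))) \<eta> = Some \<xi> \<longleftrightarrow>
      (\<exists>\<zeta>. letter_act (letter_star l) \<eta> = Some \<zeta> \<and> letters_act (rev (map letter_star ls)) \<zeta> = Some \<xi>)"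
    by (simp add: letters_act_append bind_eq_Some_conv)
  also have "\<dots> \<longleftrightarrow> (\<exists>\<zeta>. letter_act l \<zeta> = Some \<eta> \<and> letters_act ls \<xi> = Some \<zeta>)"
    using Cons.IH[OF Cons.prems(1)] letter_act_star[OF _ Cons.prems(2)]
      letter_act_in_spectrum[OF _ Cons.prems(2)] letters_act_in_spectrum[OF _ Cons.prems(1)]
    by blast
  also have "\<dots> \<longleftrightarrow> letters_act (l # ls) \<xi> = Some \<eta>"
    by (auto simp: bind_eq_Some_conv)
  finally show ?case .
qed auto

lemma word_act_star:
  assumes "\<xi> \<in> spectrum" "\<eta> \<in> spectrum"
  shows "word_act (word_star w) \<eta> = Some \<xi> \<longleftrightarrow> word_act w \<xi> = Some \<eta>"
  using letters_act_star[OF assms] by (cases w) simp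

definition word_fix :: "'a::right_lcm_semigroup gword \<Rightarrow> (('a \<rightharpoonup> 'a) \<Rightarrow> nat) set" where
  "word_fix w = {\<xi> \<in> spectrum. word_act w \<xi> = Some \<xi>}"

text \<open>The combinatorial form of moving v across the inner product: the diagonal coefficient is
  1 exactly when v and w send the basis vector to the same basis vector.\<close>

lemma word_fix_star_add:
  "word_fix (word_star v + w) = {\<xi> \<in> spectrum. word_act w \<xi> \<noteq> None \<and> word_act v \<xi> = word_act w \<xi>}"
proof -
  have "word_act (word_star v + w) \<xi> = Some \<xi> \<longleftrightarrow> word_act w \<xi> \<noteq> None \<and> word_act v \<xi> = word_act w \<xi>"
    if \<xi>: "\<xi> \<in> spectrum" for \<xi>
  proof (cases "word_act w \<xi>")
    case (Some \<eta>)
    then show ?thesis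
      using word_act_star[OF \<xi> word_act_in_spectrum[OF Some \<xi>]] by (simp add: word_act_add)
  qed (simp add: word_act_add)
  then show ?thesis by (auto simp: word_fix_def)
qed

lemma letter_act_preimage_sets:
  assumes count: "countable (UNIV :: 'a::right_lcm_semigroup set)"
    and A: "A \<in> sets (spectrum_borel :: (('a \<rightharpoonup> 'a) \<Rightarrow> nat) measure)"
  shows "{\<xi> \<in> spectrum. \<exists>\<eta>\<in>A. letter_act l \<xi> = Some \<eta>} \<in> sets spectrum_borel"
proof (cases l)
  case (Gen s)
  then have "{\<xi> \<in> spectrum. \<exists>\<eta>\<in>A. letter_act l \<xi> = Some \<eta>} =
      spectrum_act s -` A \<inter> space spectrum_borel" by auto
  then show ?thesis using measurable_sets[OF spectrum_act_measurable[OF count] A] by simp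
next
  case (GenStar s)
  have "A \<subseteq> spectrum" using sets.sets_into_space[OF A] by simp
  then have "{\<xi> \<in> spectrum. \<exists>\<eta>\<in>A. letter_act l \<xi> = Some \<eta>} = spectrum_act s ` A"
    using GenStar cylinder_subset[of s] by (auto simp: spectrum_act_image split: if_splits)
  then show ?thesis using spectrum_act_image_sets[OF count A] by simp
qed

lemma letters_act_preimage_sets:
  assumes count: "countable (UNIV :: 'a::right_lcm_semigroup set)"
    and A: "A \<in> sets (spectrum_borel :: (('a \<rightharpoonup> 'a) \<Rightarrow> nat) measure)"
  shows "{\<xi> \<in> spectrum. \<exists>\<eta>\<in>A. letters_act ls \<xi> = Some \<eta>} \<in> sets spectrum_borel"
  using A
proof (induction ls arbitrary: A)
  case Nil
  then have "A \<subseteq> spectrum" using sets.sets_into_space by fastforce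
  then have "{\<xi> \<in> spectrum. \<exists>\<eta>\<in>A. letters_act [] \<xi> = Some \<eta>} = A" by auto
  then show ?case using Nil by simp
next
  case (Cons l ls)
  have "{\<xi> \<in> spectrum. \<exists>\<eta>\<in>A. letters_act (l # ls) \<xi> = Some \<eta>} =
      {\<xi> \<in> spectrum. \<exists>\<zeta>\<in>{\<zeta> \<in> spectrum. \<exists>\<eta>\<in>A. letter_act l \<zeta> = Some \<eta>}. letters_act ls \<xi> = Some \<zeta>}"
    using letters_act_in_spectrum by (fastforce simp: bind_eq_Some_conv)
  then show ?case using Cons.IH[OF letter_act_preimage_sets[OF count Cons.prems]] by simp
qed

lemma spectrum_eqI_cylinder:
  assumes "\<xi> \<in> spectrum" "\<eta> \<in> spectrum" "\<And>s. \<xi> \<in> cylinder s \<longleftrightarrow> \<eta> \<in> cylinder s"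
  shows "\<xi> = \<eta>"
proof (rule spectrum_eqI)
  fix s
  show "\<xi> (idem s) = \<eta> (idem s)"
    using assms(3)[of s] assms(1,2) spectrum_values[OF assms(1), of "idem s"]
      spectrum_values[OF assms(2), of "idem s"] by (auto simp: cylinder_def)
qed (rule assms)+

lemma word_fix_sets:
  assumes count: "countable (UNIV :: 'a::right_lcm_semigroup set)"
  shows "word_fix (w :: 'a gword) \<in> sets spectrum_borel"
proof -
  define P where "P t = {\<xi> \<in> spectrum. \<exists>\<eta>\<in>cylinder t. word_act w \<xi> = Some \<eta>}" for t
  have P: "P t \<in> sets spectrum_borel" for t
    using letters_act_preimage_sets[OF count cylinder_sets] unfolding P_def by (cases w) simp
  \<comment> \<open>\<open>P 1\<close> is the domain of w. Membership in \<open>Q t\<close> says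
    that w is defined at \<xi> and that \<xi> and its image agree about the cylinder of t; all t
    together say that they are equal.\<close>
  define Q where "Q t = P t \<inter> cylinder t \<union> (P 1 - P t - cylinder t)" for t
  have "word_fix w = (\<Inter>t. Q t)"
  proof (intro set_eqI iffI)
    fix \<xi> assume "\<xi> \<in> word_fix w"
    then show "\<xi> \<in> (\<Inter>t. Q t)" by (auto simp: word_fix_def Q_def P_def)
  next
    fix \<xi> assume \<xi>: "\<xi> \<in> (\<Inter>t. Q t)"
    then have "\<xi> \<in> Q 1" by blast
    then have "\<xi> \<in> P 1" by (auto simp: Q_def)
    then obtain \<eta> where \<eta>: "\<xi> \<in> spectrum" "\<eta> \<in> spectrum" "word_act w \<xi> = Some \<eta>"
      by (auto simp: P_def)
    have "\<xi> = \<eta>"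
    proof (rule spectrum_eqI_cylinder[OF \<eta>(1,2)])
      fix t
      have "\<xi> \<in> Q t" using \<xi> by blast
      then show "\<xi> \<in> cylinder t \<longleftrightarrow> \<eta> \<in> cylinder t" using \<eta> by (auto simp: Q_def P_def)
    qed
    then show "\<xi> \<in> word_fix w" using \<eta> by (simp add: word_fix_def)
  qed
  also have "\<dots> \<in> sets spectrum_borel"
    by (rule sets.countable_INT'[OF count]) (auto simp: Q_def intro!: P cylinder_sets)
  finally show ?thesis .
qed

text \<open>Words with the same action are interchangeable in every context, which gives vanishing
  on the ideal of the relators.\<close>

lemma word_fix_cong:
  assumes "\<And>\<xi>. \<xi> \<in> spectrum \<Longrightarrow> word_act u \<xi> = word_act u' \<xi>"
  shows "word_fix (v + u + w) = word_fix (v + u' + w)"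
proof -
  have "word_act (v + u + w) \<xi> = word_act (v + u' + w) \<xi>" if \<xi>: "\<xi> \<in> spectrum" for \<xi>
  proof (cases "word_act w \<xi>")
    case (Some \<eta>)
    then show ?thesis using assms[OF word_act_in_spectrum[OF Some \<xi>]] by (simp add: word_act_add)
  qed (simp add: word_act_add)
  then show ?thesis by (auto simp: word_fix_def)
qed

lemma word_fix_empty:
  assumes "\<And>\<xi>. \<xi> \<in> spectrum \<Longrightarrow> word_act u \<xi> = None"
  shows "word_fix (v + u + w) = {}"
  using assms word_act_in_spectrum by (fastforce simp: word_fix_def word_act_add bind_eq_Some_conv)

section \<open>Linear extension of functions on words\<close>

definition free_lin :: "('a gword \<Rightarrow> complex) \<Rightarrow> 'a free_alg \<Rightarrow> complex" where
  "free_lin g x = (\<Sum>k\<in>Poly_Mapping.keys x. Poly_Mapping.lookup x k * g k)"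

lemma free_lin_single [simp]: "free_lin g (Poly_Mapping.single k c) = c * g k"
  by (cases "c = 0") (simp_all add: free_lin_def)

lemma free_lin_add: "free_lin g (x + y) = free_lin g x + free_lin g y"
proof -
  let ?K = "Poly_Mapping.keys x \<union> Poly_Mapping.keys y"
  have "free_lin g z = (\<Sum>k\<in>?K. Poly_Mapping.lookup z k * g k)"
    if "Poly_Mapping.keys z \<subseteq> ?K" for z
    unfolding free_lin_def
    by (rule sum.mono_neutral_left) (use that in \<open>auto simp: in_keys_iff\<close>)
  then show ?thesis
    using Poly_Mapping.keys_add[of x y]
    by (simp add: lookup_add distrib_right sum.distrib)
qed

lemma free_lin_diff: "free_lin g (x - y) = free_lin g x - free_lin g y"
  using free_lin_add[of g "x - y" y] by simp

lemma free_lin_scale: "free_lin g (free_scale c x) = c * free_lin g x"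
  by (induction x rule: free_alg_induct)
    (simp_all add: free_scale_add free_lin_add distrib_left)

lemma free_lin_star_mult:
  "free_lin g (free_star y * x) =
    (\<Sum>v\<in>Poly_Mapping.keys y. \<Sum>w\<in>Poly_Mapping.keys x.
      cnj (Poly_Mapping.lookup y v) * Poly_Mapping.lookup x w * g (word_star v + w))"
proof -
  \<comment> \<open>The dependence on y is conjugate-linear; the nested conjugations make it linear,
    so that induction over y applies.\<close>
  have "free_lin g (free_star y * x) =
      cnj (free_lin (\<lambda>v. cnj (free_lin (\<lambda>w. g (word_star v + w)) x)) y)"
  proof (induction y rule: free_alg_induct)
    case (single v c)
    show ?case
      by (induction x rule: free_alg_induct)
        (simp_all add: mult_single ring_distribs free_lin_add)
  qed (simp add: free_star_add ring_distribs free_lin_add)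
  then show ?thesis
    by (simp add: free_lin_def sum_distrib_left mult.assoc)
qed

text \<open>The vector state of the basis vector \<open>\<delta>\<^sub>\<xi>\<close> in the representation of \<open>S\<close> on \<open>\<ell>\<^sup>2\<close> of the spectrum
  by \<open>\<delta>\<^sub>\<eta> \<mapsto> \<delta>\<^sub>s\<^sub>\<cdot>\<^sub>\<eta>\<close> is positive; \<open>u \<eta>\<close> is the coordinate of \<open>x \<delta>\<^sub>\<xi>\<close> at \<open>\<eta>\<close>.\<close>

lemma free_lin_word_fix_pos:
  fixes x :: "'a::right_lcm_semigroup free_alg"
  assumes \<xi>: "\<xi> \<in> spectrum"
  shows "free_lin (\<lambda>w. of_real (indicator (word_fix w) \<xi>)) (free_star x * x) \<in> \<real>\<^sub>\<ge>\<^sub>0"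
proof -
  let ?K = "Poly_Mapping.keys x" and ?c = "Poly_Mapping.lookup x"
  \<comment> \<open>All points reached from \<xi> by words of x. \<open>the None\<close> may enter
    as well, which does not disturb the sums because \<open>a\<close> tests for
    \<open>Some\<close>.\<close>
  define H where "H = the ` (\<lambda>w. word_act w \<xi>) ` ?K"
  have H: "finite H" by (simp add: H_def)
  define a where "a w \<eta> = (of_bool (word_act w \<xi> = Some \<eta>) :: complex)" for w \<eta>
  have cnj_a: "cnj (a w \<eta>) = a w \<eta>" for w \<eta> by (simp add: a_def)
  define u where "u \<eta> = (\<Sum>w\<in>?K. ?c w * a w \<eta>)" for \<eta>
  have ind: "of_real (indicator (word_fix (word_star v + w)) \<xi>) = (\<Sum>\<eta>\<in>H. a v \<eta> * a w \<eta>)"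
    if "w \<in> ?K" for v w
  proof (cases "word_act w \<xi>")
    case None
    then show ?thesis by (simp add: word_fix_star_add a_def)
  next
    case (Some \<zeta>)
    then have "\<zeta> \<in> H" using that unfolding H_def by force
    have "(\<Sum>\<eta>\<in>H. a v \<eta> * a w \<eta>) = (\<Sum>\<eta>\<in>H. if \<eta> = \<zeta> then a v \<zeta> else 0)"
      by (rule sum.cong) (auto simp: a_def Some)
    also have "\<dots> = a v \<zeta>" using H \<open>\<zeta> \<in> H\<close> by simp
    finally show ?thesis using Some \<xi> by (simp add: word_fix_star_add a_def indicator_def)
  qed
  have "free_lin (\<lambda>w. of_real (indicator (word_fix w) \<xi>)) (free_star x * x) =
      (\<Sum>v\<in>?K. \<Sum>w\<in>?K. cnj (?c v) * ?c w * (\<Sum>\<eta>\<in>H. a v \<eta> * a w \<eta>))"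
    unfolding free_lin_star_mult by (intro sum.cong refl) (simp add: ind)
  also have "\<dots> = (\<Sum>v\<in>?K. \<Sum>w\<in>?K. \<Sum>\<eta>\<in>H. cnj (?c v) * a v \<eta> * (?c w * a w \<eta>))"
    by (simp add: sum_distrib_left mult_ac)
  also have "\<dots> = (\<Sum>v\<in>?K. \<Sum>\<eta>\<in>H. \<Sum>w\<in>?K. cnj (?c v) * a v \<eta> * (?c w * a w \<eta>))"
    by (intro sum.cong refl sum.swap)
  also have "\<dots> = (\<Sum>\<eta>\<in>H. \<Sum>v\<in>?K. \<Sum>w\<in>?K. cnj (?c v) * a v \<eta> * (?c w * a w \<eta>))"
    by (rule sum.swap)
  also have "\<dots> = (\<Sum>\<eta>\<in>H. cnj (u \<eta>) * u \<eta>)"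
    unfolding u_def by (intro sum.cong refl) (simp add: sum_product cnj_a)
  also have "\<dots> = of_real (\<Sum>\<eta>\<in>H. (cmod (u \<eta>))\<^sup>2)"
    unfolding of_real_sum complex_norm_square by (simp add: mult.commute)
  also have "\<dots> \<in> \<real>\<^sub>\<ge>\<^sub>0" unfolding nonneg_Reals_of_real_iff by (simp add: sum_nonneg)
  finally show ?thesis .
qed

section \<open>The KMS condition on words\<close>

context lcm_scale
begin

text \<open>The dynamics multiplies a letter by its weight to the power \<open>\<i> * t\<close>, and
  an adjoint by the conjugate phase, hence the inverse.\<close>

fun letter_weight :: "'a letter \<Rightarrow> real" where
  "letter_weight (Gen s) = N s"
| "letter_weight (GenStar s) = inverse (N s)"

fun word_weight :: "'a gword \<Rightarrow> real" where
  "word_weight (GWord ls) = prod_list (map letter_weight ls)"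

lemma letter_weight_pos: "0 < letter_weight l"
  by (cases l) (simp_all add: scale_pos)

lemma letters_weight_pos: "0 < prod_list (map letter_weight ls)"
  by (induction ls) (simp_all add: letter_weight_pos)

lemma word_weight_pos: "0 < word_weight w"
  by (cases w) (simp add: letters_weight_pos)

text \<open>The fixed points of \<open>l w\<close> and of \<open>w l\<close> correspond to each other under \<open>l\<close>.\<close>

lemma measure_word_fix_letter:
  assumes count: "countable (UNIV :: 'a set)" and \<mu>: "scaling_measure N \<beta> \<mu>"
  shows "measure \<mu> (word_fix (GWord [l] + w)) =
    letter_weight l powr (- \<beta>) * measure \<mu> (word_fix (w + GWord [l]))"
proof -
  have act: "measure \<mu> (spectrum_act s ` word_fix v) = N s powr (- \<beta>) * measure \<mu> (word_fix v)" for s v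
    using \<mu> word_fix_sets[OF count] by (simp add: scaling_measure_def)
  show ?thesis
  proof (cases l)
    case (Gen s)
    have "word_fix (GWord [l] + w) = spectrum_act s ` word_fix (w + GWord [l])"
    proof (intro set_eqI iffI)
      fix \<xi> assume "\<xi> \<in> word_fix (GWord [l] + w)"
      then obtain \<eta> where \<eta>: "\<xi> \<in> spectrum" "word_act w \<xi> = Some \<eta>" "spectrum_act s \<eta> = \<xi>"
        by (auto simp: word_fix_def word_act_add bind_eq_Some_conv Gen)
      then have "\<eta> \<in> word_fix (w + GWord [l])"
        using word_act_in_spectrum by (auto simp: word_fix_def word_act_add Gen)
      then show "\<xi> \<in> spectrum_act s ` word_fix (w + GWord [l])" using \<eta>(3) by blast
    next
      fix \<xi> assume "\<xi> \<in> spectrum_act s ` word_fix (w + GWord [l])"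
      then show "\<xi> \<in> word_fix (GWord [l] + w)"
        by (auto simp: word_fix_def word_act_add Gen spectrum_act_in_spectrum)
    qed
    then show ?thesis using act Gen by simp
  next
    case (GenStar s)
    \<comment> \<open>For an adjoint letter the translation by s goes in the opposite direction, so
      the scaling identity is solved for the other side.\<close>
    have "word_fix (w + GWord [l]) = spectrum_act s ` word_fix (GWord [l] + w)"
    proof (intro set_eqI iffI)
      fix \<xi> assume "\<xi> \<in> word_fix (w + GWord [l])"
      then have \<xi>: "\<xi> \<in> cylinder s" "word_act w (spectrum_inv s \<xi>) = Some \<xi>"
        by (auto simp: word_fix_def word_act_add bind_eq_Some_conv GenStar split: if_splits)
      then have "spectrum_inv s \<xi> \<in> word_fix (GWord [l] + w)"
        by (simp add: word_fix_def word_act_add GenStar spectrum_inv_in_spectrum)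
      then show "\<xi> \<in> spectrum_act s ` word_fix (GWord [l] + w)"
        using spectrum_act_inv[OF \<xi>(1)] by (metis imageI)
    next
      fix \<xi> assume "\<xi> \<in> spectrum_act s ` word_fix (GWord [l] + w)"
      then obtain \<eta> where \<eta>: "\<eta> \<in> word_fix (GWord [l] + w)" "\<xi> = spectrum_act s \<eta>" by blast
      then obtain \<zeta> where \<zeta>: "\<eta> \<in> spectrum" "word_act w \<eta> = Some \<zeta>" "\<zeta> \<in> cylinder s"
        "spectrum_inv s \<zeta> = \<eta>"
        by (auto simp: word_fix_def word_act_add bind_eq_Some_conv GenStar split: if_splits)
      then have "\<zeta> = \<xi>" using spectrum_act_inv[OF \<zeta>(3)] \<eta>(2) by simp
      then show "\<xi> \<in> word_fix (w + GWord [l])"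
        using \<zeta> cylinder_subset[of s] by (auto simp: word_fix_def word_act_add GenStar)
    qed
    then have "measure \<mu> (word_fix (w + GWord [l])) =
        N s powr (- \<beta>) * measure \<mu> (word_fix (GWord [l] + w))"
      using act by simp
    then show ?thesis
      using GenStar scale_pos[of s] by (simp add: powr_minus inverse_powr less_imp_le)
  qed
qed

text \<open>This is the KMS relation on words. The letters of v are moved from the front to the back
  one at a time, each contributing its weight.\<close>

lemma measure_word_fix_commute:
  assumes count: "countable (UNIV :: 'a set)" and \<mu>: "scaling_measure N \<beta> \<mu>"
  shows "measure \<mu> (word_fix (v + w)) = word_weight v powr (- \<beta>) * measure \<mu> (word_fix (w + v))"
proof -
  obtain ls where v: "v = GWord ls" by (cases v)
  have "measure \<mu> (word_fix (GWord ls + w)) =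
      prod_list (map letter_weight ls) powr (- \<beta>) * measure \<mu> (word_fix (w + GWord ls))"
  proof (induction ls arbitrary: w)
    case Nil
    then show ?case by (simp flip: zero_gword_def)
  next
    case (Cons l ls)
    have split: "GWord (l # ls) = GWord [l] + GWord ls" by simp
    have "measure \<mu> (word_fix (GWord (l # ls) + w)) =
        letter_weight l powr (- \<beta>) * measure \<mu> (word_fix (GWord ls + (w + GWord [l])))"
      unfolding split add.assoc using measure_word_fix_letter[OF count \<mu>, of l "GWord ls + w"]
      by (simp add: add.assoc)
    also have "\<dots> = letter_weight l powr (- \<beta>) * (prod_list (map letter_weight ls) powr (- \<beta>) *
        measure \<mu> (word_fix (w + GWord (l # ls))))"
      unfolding Cons.IH split by (simp only: add.assoc)
    finally show ?case
      using letter_weight_pos[of l] letters_weight_pos[of ls] by (simp add: powr_mult less_imp_le)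
  qed
  then show ?thesis by (simp add: v)
qed

lemma scaling_functional:
  assumes count: "countable (UNIV :: 'a set)" and \<mu>: "scaling_measure N \<beta> \<mu>"
  shows "lcm_functional (free_lin (\<lambda>w :: 'a gword. of_real (measure \<mu> (word_fix w))))"
proof
  let ?\<psi> = "free_lin (\<lambda>w :: 'a gword. complex_of_real (measure \<mu> (word_fix w)))"
  interpret prob_space \<mu> using \<mu> by (simp add: scaling_measure_def)
  have sets: "sets \<mu> = sets spectrum_borel" and sp: "space \<mu> = spectrum"
    using \<mu> by (auto simp: scaling_measure_def)
  have fix_sets: "word_fix w \<in> sets \<mu>" for w :: "'a gword" by (simp add: sets word_fix_sets[OF count])
  have fix_Int: "word_fix w \<inter> spectrum = word_fix w" for w :: "'a gword" by (auto simp: word_fix_def)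
  fix x y :: "'a free_alg" and c
  show "?\<psi> (x + y) = ?\<psi> x + ?\<psi> y" by (rule free_lin_add)
  show "?\<psi> (free_scale c x) = c * ?\<psi> x" by (rule free_lin_scale)
  show "?\<psi> 1 = 1"
  proof -
    have "word_fix (0 :: 'a gword) = space \<mu>" by (simp add: word_fix_def sp)
    then have "?\<psi> (Poly_Mapping.single 0 1) = 1"
      unfolding free_lin_single using prob_space by simp
    then show ?thesis by (simp add: single_one)
  qed
  show "?\<psi> (free_star x * x) \<in> \<real>\<^sub>\<ge>\<^sub>0"
  proof -
    let ?p = "\<lambda>\<xi>. free_lin (\<lambda>w. of_real (indicator (word_fix w) \<xi>)) (free_star x * x)"
    have int: "integrable \<mu> (\<lambda>\<xi>. complex_of_real (indicator (word_fix w) \<xi>))" for w :: "'a gword"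
      using fix_sets by (intro integrable_of_real integrable_real_indicator) (auto simp: emeasure_eq_measure)
    \<comment> \<open>The functional is the integral of the positive vector functionals, and the sum
      over words is finite, so integration is termwise.\<close>
    have \<psi>: "(LINT \<xi>|\<mu>. ?p \<xi>) = ?\<psi> (free_star x * x)"
      unfolding free_lin_def
      using int fix_sets fix_Int by (subst Bochner_Integration.integral_sum) (auto simp: sp)
    have "(LINT \<xi>|\<mu>. ?p \<xi>) = (LINT \<xi>|\<mu>. complex_of_real (Re (?p \<xi>)))"
    proof (rule Bochner_Integration.integral_cong[OF refl])
      fix \<xi> assume "\<xi> \<in> space \<mu>"
      then show "?p \<xi> = complex_of_real (Re (?p \<xi>))"
        using free_lin_word_fix_pos[of \<xi> x] unfolding sp
        by (auto simp: complex_nonneg_Reals_iff complex_eq_iff)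
    qed
    also have "\<dots> = complex_of_real (LINT \<xi>|\<mu>. Re (?p \<xi>))" by (rule integral_complex_of_real)
    finally have "?\<psi> (free_star x * x) = complex_of_real (LINT \<xi>|\<mu>. Re (?p \<xi>))"
      unfolding \<psi> .
    moreover have "0 \<le> (LINT \<xi>|\<mu>. Re (?p \<xi>))"
      using free_lin_word_fix_pos[of _ x]
      by (intro Bochner_Integration.integral_nonneg) (auto simp: sp complex_nonneg_Reals_iff)
    ultimately show ?thesis by (simp only: nonneg_Reals_of_real_iff)
  qed
  fix r :: "'a free_alg" assume r: "r \<in> lcm_relators"
  have lin: "?\<psi> (x * r * y) = 0"
    if "\<And>v w. ?\<psi> (Poly_Mapping.single v 1 * r * Poly_Mapping.single w 1) = 0"
  proof (induction x rule: free_alg_induct)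
    case (single v c)
    show ?case
    proof (induction y rule: free_alg_induct)
      case (single w d)
      have "Poly_Mapping.single v c * r * Poly_Mapping.single w d =
          free_scale (c * d) (Poly_Mapping.single v 1 * r * Poly_Mapping.single w 1)"
      proof -
        have "Poly_Mapping.single v c = free_scale c (Poly_Mapping.single v 1)"
          "Poly_Mapping.single w d = free_scale d (Poly_Mapping.single w 1)" by simp_all
        then show ?thesis
          by (simp only: free_scale_mult_left free_scale_mult_right free_scale_scale mult.commute)
      qed
      then show ?case using that by (simp only: free_lin_scale mult_zero_right)
    qed (simp add: ring_distribs free_lin_add)
  qed (simp add: ring_distribs free_lin_add)
  \<comment> \<open>All relators except those for disjoint ideals are differences of two words with
    the same action.\<close>
  have cong: "?\<psi> (x * r * y) = 0"
    if "r = Poly_Mapping.single u 1 - Poly_Mapping.single u' 1"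
      "\<And>\<xi>. \<xi> \<in> spectrum \<Longrightarrow> word_act u \<xi> = word_act u' \<xi>" for u u'
    using word_fix_cong[OF that(2)] unfolding that(1)
    by (intro lin[unfolded that(1)]) (simp add: ring_distribs mult_single free_lin_diff)
  have proj: "fproj s * fproj t = Poly_Mapping.single (GWord [Gen s, GenStar s, Gen t, GenStar t]) 1"
    "fproj s = Poly_Mapping.single (GWord [Gen s, GenStar s]) 1" for s t :: 'a
    by (simp_all add: fproj_def fgen_def mult_single)
  have act_proj: "Option.bind (letter_act (GenStar s) \<xi>) (letter_act (Gen s)) =
      (if \<xi> \<in> cylinder s then Some \<xi> else None)" for s :: 'a and \<xi>
    by (simp add: spectrum_act_inv)
  consider (iso) s where "r = free_star (fgen s) * fgen s - 1"
    | (one) "r = fgen 1 - 1"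
    | (mult) s t where "r = fgen s * fgen t - fgen (s * t)"
    | (Int) s t q where "r = fproj s * fproj t - fproj q" "rideal s \<inter> rideal t = rideal q"
    | (disj) s t where "r = fproj s * fproj t" "rideal s \<inter> rideal t = {}"
    using r unfolding lcm_relators_def by blast
  then show "?\<psi> (x * r * y) = 0"
  proof cases
    case (iso s)
    have "r = Poly_Mapping.single (GWord [GenStar s, Gen s]) 1 - Poly_Mapping.single (GWord []) 1"
      unfolding iso by (simp add: fgen_def mult_single single_one flip: zero_gword_def)
    then show ?thesis
      by (rule cong) (simp add: spectrum_act_cylinder spectrum_inv_act)
  next
    case one
    have "r = Poly_Mapping.single (GWord [Gen 1]) 1 - Poly_Mapping.single (GWord []) 1"
      unfolding one by (simp add: fgen_def single_one flip: zero_gword_def)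
    then show ?thesis by (rule cong) (simp add: spectrum_act_one)
  next
    case (mult s t)
    have "r = Poly_Mapping.single (GWord [Gen s, Gen t]) 1 - Poly_Mapping.single (GWord [Gen (s * t)]) 1"
      unfolding mult by (simp add: fgen_def mult_single)
    then show ?thesis by (rule cong) (simp add: spectrum_act_mult)
  next
    case (Int s t q)
    have "r = Poly_Mapping.single (GWord [Gen s, GenStar s, Gen t, GenStar t]) 1 -
        Poly_Mapping.single (GWord [Gen q, GenStar q]) 1"
      unfolding Int by (simp add: proj mult_single)
    then show ?thesis
      by (rule cong) (use cylinder_Int[OF Int(2)] in \<open>auto simp: spectrum_act_inv\<close>)
  next
    case (disj s t)
    \<comment> \<open>For disjoint ideals the relator is a single word, and it is defined at no
      character.\<close>
    have "word_fix (v + GWord [Gen s, GenStar s, Gen t, GenStar t] + w) = {}" for v w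
      by (rule word_fix_empty) (use cylinder_disjoint[OF disj(2)] in \<open>auto simp: spectrum_act_inv\<close>)
    then show ?thesis
      by (intro lin) (simp add: disj(1) proj mult_single)
  qed
qed

text \<open>Words are eigenvectors of the dynamics, which makes their entire extensions
  explicit.\<close>

lemma word_eval_dynamics:
  "word_eval (\<lambda>s. lcm_dynamics N t (lcm_gen s)) w =
    exp (\<i> * of_real t * of_real (ln (word_weight w))) *\<^sub>C of_free (Poly_Mapping.single w 1)"
proof -
  have id: "star_hom (\<lambda>x :: 'a lcm_cstar. x)" by (simp add: star_hom_def)
  have free: "of_free (Poly_Mapping.single w 1) = word_eval lcm_gen w" for w :: "'a gword"
    using star_hom_of_free[OF id, of "Poly_Mapping.single w 1"] by simp
  have letter: "letter_eval (\<lambda>s. lcm_dynamics N t (lcm_gen s)) l =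
      exp (\<i> * of_real t * of_real (ln (letter_weight l))) *\<^sub>C letter_eval lcm_gen l" for l
    using scale_pos by (cases l) (simp_all add: dynamics_gen star_scaleC exp_cnj ln_inverse)
  obtain ls where w: "w = GWord ls" by (cases w)
  have "prod_list (map (letter_eval (\<lambda>s. lcm_dynamics N t (lcm_gen s))) ls) =
      exp (\<i> * of_real t * of_real (ln (prod_list (map letter_weight ls)))) *\<^sub>C
      prod_list (map (letter_eval lcm_gen) ls)"
  proof (induction ls)
    case (Cons l ls)
    have "ln (letter_weight l * prod_list (map letter_weight ls)) =
        ln (letter_weight l) + ln (prod_list (map letter_weight ls))"
      using letter_weight_pos[of l] letters_weight_pos[of ls] by (simp add: ln_mult)
    then show ?case using Cons
      by (simp add: letter mult_scaleC_left mult_scaleC_right scaleC_scaleC exp_add distrib_left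
          mult.commute)
  qed simp
  then show ?thesis unfolding free by (simp add: w)
qed

lemma dynamics_of_free_single:
  "lcm_dynamics N t (of_free (Poly_Mapping.single w c)) =
    (c * exp (\<i> * of_real t * of_real (ln (word_weight w)))) *\<^sub>C of_free (Poly_Mapping.single w 1)"
  by (simp add: star_hom_of_free[OF dynamics_hom] word_eval_dynamics scaleC_scaleC)

lemma ex_kms_state:
  assumes count: "countable (UNIV :: 'a set)" and \<mu>: "scaling_measure N \<beta> \<mu>"
  shows "\<exists>\<phi> :: 'a lcm_cstar \<Rightarrow> complex. kms_state (lcm_dynamics N) \<beta> \<phi>"
proof -
  define \<psi> where "\<psi> = free_lin (\<lambda>w :: 'a gword. complex_of_real (measure \<mu> (word_fix w)))"
  interpret lcm_functional \<psi> unfolding \<psi>_def by (rule scaling_functional[OF count \<mu>])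
  obtain \<phi> where \<phi>: "cstar_state \<phi>" "\<And>x. \<phi> (of_free x) = \<psi> x" using ex_state by blast
  note \<phi>_add = linear_add[OF bounded_linear.linear[OF cstar_stateD(1)[OF \<phi>(1)]]]
  have kms: "\<psi> (Poly_Mapping.single w c * y) =
      of_real (word_weight w powr (- \<beta>)) * \<psi> (y * Poly_Mapping.single w c)" for w c y
    by (induction y rule: free_alg_induct)
      (simp_all add: \<psi>_def mult_single ring_distribs free_lin_add measure_word_fix_commute[OF count \<mu>, of w])
  have ext: "\<exists>f. entire_extension (lcm_dynamics N) (of_free x) f \<and>
      (\<forall>y. \<phi> (of_free x * of_free y) = \<phi> (of_free y * f (\<i> * complex_of_real \<beta>)))" for x
  proof (induction x rule: free_alg_induct)
    case (single w c)
    define L where "L = ln (word_weight w)"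
    define k where "k z = c * exp (\<i> * z * of_real L)" for z
    define v where "v = of_free (Poly_Mapping.single w (1::complex))"
    define f where "f z = k z *\<^sub>C v" for z
    have "\<exists>d. ((\<lambda>u. inverse (u - z) *\<^sub>C (f u - f z)) \<longlongrightarrow> d) (at z)" for z
    proof -
      have "(k has_field_derivative c * (exp (\<i> * z * of_real L) * (\<i> * of_real L))) (at z)"
        unfolding k_def by (auto intro!: derivative_eq_intros)
      then have "((\<lambda>u. (k u - k z) / (u - z)) \<longlongrightarrow> c * (exp (\<i> * z * of_real L) * (\<i> * of_real L))) (at z)"
        by (simp add: has_field_derivative_iff)
      moreover have "bounded_linear (\<lambda>a. a *\<^sub>C v)"
        by (rule bounded_linear_intro[where K = "norm v"])
          (simp_all add: scaleC_add_left norm_scaleC scaleR_scaleC scaleC_scaleC scaleR_conv_of_real)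
      ultimately have "((\<lambda>u. ((k u - k z) / (u - z)) *\<^sub>C v) \<longlongrightarrow>
          (c * (exp (\<i> * z * of_real L) * (\<i> * of_real L))) *\<^sub>C v) (at z)"
        by (rule bounded_linear.tendsto[rotated])
      moreover have "inverse (u - z) *\<^sub>C (f u - f z) = ((k u - k z) / (u - z)) *\<^sub>C v" for u
        using scaleC_add_left[of "k u - k z" "k z" v]
        by (simp add: f_def scaleC_scaleC divide_inverse mult.commute eq_diff_eq[symmetric] del: eq_diff_eq)
      ultimately show ?thesis by auto
    qed
    moreover have "f (of_real t) = lcm_dynamics N t (of_free (Poly_Mapping.single w c))" for t
      by (simp add: f_def k_def v_def L_def dynamics_of_free_single)
    ultimately have "entire_extension (lcm_dynamics N) (of_free (Poly_Mapping.single w c)) f"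
      by (simp add: entire_extension_def)
    moreover have "\<phi> (of_free (Poly_Mapping.single w c) * of_free y) =
        \<phi> (of_free y * f (\<i> * complex_of_real \<beta>))" for y
    proof -
      \<comment> \<open>At \<open>z = \<i> * \<beta>\<close> the phase becomes the factor
        \<open>word_weight w powr (- \<beta>)\<close> produced by cycling the word in
        \<open>kms\<close>.\<close>
      have "exp (\<i> * (\<i> * complex_of_real \<beta>) * of_real L) = exp (of_real (- \<beta> * L))"
        by (simp add: algebra_simps flip: mult.assoc)
      also have "\<dots> = of_real (exp (- \<beta> * L))" by (rule exp_of_real)
      also have "exp (- \<beta> * L) = word_weight w powr (- \<beta>)"
        using word_weight_pos[of w] by (simp add: powr_def L_def)
      finally have "f (\<i> * complex_of_real \<beta>) =
          of_real (word_weight w powr (- \<beta>)) *\<^sub>C of_free (Poly_Mapping.single w c)"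
        by (simp add: f_def k_def v_def of_free_scale[symmetric] mult.commute)
      then have "\<phi> (of_free y * f (\<i> * complex_of_real \<beta>)) =
          of_real (word_weight w powr (- \<beta>)) * \<psi> (y * Poly_Mapping.single w c)"
        by (simp add: mult_scaleC_right cstar_stateD(2)[OF \<phi>(1)] of_free_mult[symmetric] \<phi>(2))
      then show ?thesis by (simp add: of_free_mult[symmetric] \<phi>(2) kms)
    qed
    ultimately show ?case by blast
  next
    case (add x y)
    then obtain f g where f: "entire_extension (lcm_dynamics N) (of_free x) f"
        "\<And>z. \<phi> (of_free x * of_free z) = \<phi> (of_free z * f (\<i> * complex_of_real \<beta>))"
      and g: "entire_extension (lcm_dynamics N) (of_free y) g"
        "\<And>z. \<phi> (of_free y * of_free z) = \<phi> (of_free z * g (\<i> * complex_of_real \<beta>))"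
      by blast
    have "entire_extension (lcm_dynamics N) (of_free (x + y)) (\<lambda>z. f z + g z)"
      unfolding entire_extension_def
    proof (intro conjI allI)
      fix z
      obtain d where "((\<lambda>u. inverse (u - z) *\<^sub>C (f u - f z)) \<longlongrightarrow> d) (at z)"
        using f(1) unfolding entire_extension_def by blast
      moreover obtain d' where "((\<lambda>u. inverse (u - z) *\<^sub>C (g u - g z)) \<longlongrightarrow> d') (at z)"
        using g(1) unfolding entire_extension_def by blast
      ultimately have "((\<lambda>u. inverse (u - z) *\<^sub>C (f u - f z) + inverse (u - z) *\<^sub>C (g u - g z)) \<longlongrightarrow> d + d') (at z)"
        by (rule tendsto_add)
      then show "\<exists>d. ((\<lambda>u. inverse (u - z) *\<^sub>C (f u + g u - (f z + g z))) \<longlongrightarrow> d) (at z)"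
        by (auto simp: add_diff_add scaleC_add_right)
    next
      show "f (of_real t) + g (of_real t) = lcm_dynamics N t (of_free (x + y))" for t
        using f(1) g(1) by (simp add: entire_extension_def of_free_add star_homD(1)[OF dynamics_hom])
    qed
    moreover have "\<phi> (of_free (x + y) * of_free z) =
        \<phi> (of_free z * (f (\<i> * complex_of_real \<beta>) + g (\<i> * complex_of_real \<beta>)))" for z
      by (simp add: of_free_add ring_distribs \<phi>_add f(2) g(2))
    ultimately show ?case by blast
  qed
  have inv: "lcm_dynamics N t (of_free x) \<in> range of_free" for t x
  proof (induction x rule: free_alg_induct)
    case (single w c)
    show ?case unfolding dynamics_of_free_single of_free_scale[symmetric] by blast
  next
    case (add x y)
    then show ?case
      by (auto simp: of_free_add star_homD(1)[OF dynamics_hom]) (metis of_free_add rangeI)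
  qed
  have "kms_state (lcm_dynamics N) \<beta> \<phi>"
    unfolding kms_state_def
  proof (intro conjI exI[of _ "range of_free"])
    show "0 \<in> range of_free" using of_free_zero by (metis rangeI)
    show "\<forall>a\<in>range of_free. \<forall>b\<in>range of_free. a + b \<in> range of_free"
      by (auto simp: of_free_add[symmetric])
    show "\<forall>c. \<forall>a\<in>range of_free. c *\<^sub>C a \<in> range of_free"
      by (auto simp: of_free_scale[symmetric])
    show "\<forall>t. \<forall>a\<in>range of_free. lcm_dynamics N t a \<in> range of_free" using inv by blast
    show "\<forall>a\<in>range of_free. \<exists>f. entire_extension (lcm_dynamics N) a f \<and>
        (\<forall>b\<in>range of_free. \<phi> (a * b) = \<phi> (b * f (\<i> * complex_of_real \<beta>)))"
      using ext by blast
  qed (rule \<phi> closure_range_of_free)+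
  then show ?thesis by blast
qed

end

theorem proposition3p8:
  fixes N :: "'a::right_lcm_semigroup \<Rightarrow> real" and \<beta> :: real
  assumes "countable (UNIV :: 'a set)"
    and "scale N"
    and "\<And>s t. t \<in> ker_scale N \<Longrightarrow> \<exists>k\<in>ker_scale N. rideal s \<inter> rideal t = rideal (s * k)"
    and "0 \<le> \<beta>"
  shows "(\<forall>\<mu> \<nu>. scaling_measure N \<beta> \<mu> \<and> scaling_measure N \<beta> \<nu> \<longrightarrow> \<mu> = \<nu>) \<and>
    (\<forall>\<mu>. scaling_measure N \<beta> \<mu> \<longrightarrow>
       (\<forall>s F. finite F \<and> F \<subseteq> rideal s \<longrightarrow>
          measure \<mu> (cylinder_diff s F) = incl_excl N \<beta> s (scale_class N ` F))) \<and>
    ((\<exists>\<mu>. scaling_measure N \<beta> \<mu>) \<longleftrightarrow>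
       (\<exists>\<phi> :: 'a lcm_cstar \<Rightarrow> complex. kms_state (lcm_dynamics N) \<beta> \<phi>)) \<and>
    ((\<exists>\<mu>. scaling_measure N \<beta> \<mu>) \<longleftrightarrow>
       (\<forall>G. finite G \<and>
            G \<subseteq> {C \<in> scale_quot N. class_le N (scale_class N 1) C \<and> C \<noteq> scale_class N 1} \<longrightarrow>
            0 \<le> incl_excl N \<beta> 1 G))"
proof -
  interpret lcm_scale_ker N
    by unfold_locales (use assms(2,3) in blast)+
  note count = assms(1)
  \<comment> \<open>Nonnegativity of the alternating sums is the common hub: a KMS state implies it,
    it yields a measure, and a measure yields a KMS state.\<close>
  have measure_iff: "(\<exists>\<mu>. scaling_measure N \<beta> \<mu>) \<longleftrightarrow>
      (\<forall>F. finite F \<longrightarrow> 0 \<le> alt_sum (meet_weight N \<beta>) F)"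
    using scaling_measure_imp_nonneg[OF count] ex_scaling_measure[OF count] by blast
  have kms_iff: "(\<exists>\<mu>. scaling_measure N \<beta> \<mu>) \<longleftrightarrow>
      (\<exists>\<phi> :: 'a lcm_cstar \<Rightarrow> complex. kms_state (lcm_dynamics N) \<beta> \<phi>)"
    using ex_kms_state[OF count] kms_state_imp_nonneg[OF _ assms(4)] measure_iff by blast
  show ?thesis
    unfolding incl_excl_nonneg_iff
    using scaling_measure_unique[OF count] measure_cylinder_diff[OF count] incl_excl_eq_alt_sum
      measure_iff kms_iff by metis
qed

end
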